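(* Let $k$ be an algebraically closed field of characteristic zero and let $(F,\Gamma)$ be a matched pair of finite groups such that $|F|$ and $|\Gamma|$ are relatively prime. Let $A$ be a Hopf algebra fitting into an extension $$k\to k^\Gamma\to A\to kF\to k$$ affording the actions of the given matched pair. Then $A$ is obtained from the split extension $k^\Gamma\# kF$ by twisting the multiplication and the comultiplication.
   Context: A matched pair of finite groups $(F,\Gamma)$ consists of actions by permutations $\triangleright:\Gamma\times F\to F$ (left) and $\triangleleft:\Gamma\times F\to\Gamma$ (right) with $s\triangleright(xy)=(s\triangleright x)((s\triangleleft x)\triangleright y)$ and $(st)\triangleleft x=(s\triangleleft(t\triangleright x))(t\triangleleft x)$ for $s,t\in\Gamma$, $x,y\in F$. Hopf algebra extensions $k\to k^\Gamma\to A\to kF\to k$ (exact sequences of finite-dimensional Hopf algebras) affording these actions are, up to equivalence, exactly the bicrossed products $A=k^\Gamma\,{}^{\tau}\#_\sigma kF$: here $\sigma:F\times F\to(k^\Gamma)^\times$ and $\tau:\Gamma\times\Gamma\to(k^F)^\times$ are normalized 2-cocycles, written $\sigma_s(x,y)$, $\tau_x(s,t)$, subject to the compatibility conditions making $k^\Gamma\otimes kF$, with basis $e_s\#x$ ($s\in\Gamma$, $x\in F$), a Hopf algebra under $$(e_s\#x)(e_t\#y)=\delta_{s\triangleleft x,t}\,\sigma_s(x,y)\,e_s\#xy,\qquad \Delta(e_s\#x)=\sum_{tu=s}\tau_x(t,u)\,(e_t\#(u\triangleright x))\otimes(e_u\#x).$$ The split extension $k^\Gamma\#kF$ is the one with $\sigma=1$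 and $\tau=1$. Twisting the comultiplication of a Hopf algebra $B$ means replacing $\Delta$ by $J\Delta(\cdot)J^{-1}$ for an invertible $J\in B\otimes B$ with $(\epsilon\otimes\operatorname{id})(J)=1=(\operatorname{id}\otimes\epsilon)(J)$ and $(1\otimes J)(\operatorname{id}\otimes\Delta)(J)=(J\otimes1)(\Delta\otimes\operatorname{id})(J)$. Twisting the multiplication means replacing it by $a\cdot b=\kappa(a_1,b_1)\,a_2b_2\,\kappa^{-1}(a_3,b_3)$ for a convolution-invertible normalized Hopf 2-cocycle $\kappa:B\otimes B\to k$ (the dual notion). "Obtained by twisting the multiplication and the comultiplication" means isomorphic as a Hopf algebra to the result of applying these two kinds of operations in succession (in some order, either possibly trivial). *)

theory Defs
  imports "HOL-Analysis.Analysis"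
begin

text \<open>
  A finite-dimensional space is \<open>'k ^ 'b\<close> for a finite index type \<open>'b\<close>, with library scalar
  multiplication \<open>*s\<close>; correspondingly \<open>'k ^ ('b \<times> 'c)\<close> is the tensor product of \<open>'k ^ 'b\<close> and
  \<open>'k ^ 'c\<close>. The spaces \<open>k\<^sup>\<Gamma>\<close>, \<open>kF\<close>, \<open>k\<^sup>\<Gamma> \<otimes> kF\<close> are literally \<open>'k ^ 'g\<close>, \<open>'k ^ 'f\<close>, \<open>'k ^ ('g \<times> 'f)\<close>.
  Finite groups are types of class \<open>{group_add, finite}\<close>. The class \<open>group_add\<close> does not assume
  commutativity; the group law is written \<open>+\<close> and the identity \<open>0\<close>.
\<close>

abbreviation klinear :: "('k::field ^ 'b \<Rightarrow> 'k ^ 'c) \<Rightarrow> bool" where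
  "klinear \<equiv> Vector_Spaces.linear (*s) (*s)"

abbreviation klinear_form :: "('k::field ^ 'b \<Rightarrow> 'k) \<Rightarrow> bool" where
  "klinear_form \<equiv> Vector_Spaces.linear (*s) (*)"


section \<open>Tensors\<close>

definition tensor :: "'k::field ^ 'b \<Rightarrow> 'k ^ 'c \<Rightarrow> 'k ^ ('b \<times> 'c)" (infixr "\<otimes>\<^sub>k" 75) where
  "v \<otimes>\<^sub>k w = (\<chi> p. v $ fst p * w $ snd p)"

text \<open>
  For bilinear \<open>\<beta>\<close>, \<open>tlift \<beta>\<close> is the linear map on the tensor product with
  \<open>tlift \<beta> (v \<otimes>\<^sub>k w) = \<beta> v w\<close>, and \<open>tform \<beta>\<close> is the same for scalar-valued \<open>\<beta>\<close>.
  Thus \<open>tlift (\<lambda>a\<^sub>1 a\<^sub>2. E a\<^sub>1 a\<^sub>2) (comult H a)\<close> renders the Sweedler expression \<open>E a\<^sub>1 a\<^sub>2\<close>.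
\<close>

definition tlift :: "('k::field ^ 'b \<Rightarrow> 'k ^ 'c \<Rightarrow> 'k ^ 'd) \<Rightarrow> 'k ^ ('b \<times> 'c) \<Rightarrow> 'k ^ 'd" where
  "tlift \<beta> t = (\<Sum>p\<in>UNIV. t $ p *s \<beta> (axis (fst p) 1) (axis (snd p) 1))"

definition tform :: "('k::field ^ 'b \<Rightarrow> 'k ^ 'c \<Rightarrow> 'k) \<Rightarrow> 'k ^ ('b \<times> 'c) \<Rightarrow> 'k" where
  "tform \<beta> t = (\<Sum>p\<in>UNIV. t $ p * \<beta> (axis (fst p) 1) (axis (snd p) 1))"

definition tmap :: "('k::field ^ 'b \<Rightarrow> 'k ^ 'd) \<Rightarrow> ('k ^ 'c \<Rightarrow> 'k ^ 'e) \<Rightarrow> 'k ^ ('b \<times> 'c) \<Rightarrow> 'k ^ ('d \<times> 'e)" where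
  "tmap f g = tlift (\<lambda>v w. f v \<otimes>\<^sub>k g w)"

definition tassoc :: "'k::field ^ (('b::finite \<times> 'c::finite) \<times> 'd::finite) \<Rightarrow> 'k ^ ('b \<times> ('c \<times> 'd))" where
  "tassoc t = (\<chi> p. t $ ((fst p, fst (snd p)), snd (snd p)))"

text \<open>The product \<open>(a \<otimes> b)(a' \<otimes> b') = aa' \<otimes> bb'\<close> on a tensor product of algebras.\<close>

definition tmult :: "('k::field ^ 'b \<Rightarrow> 'k ^ 'b \<Rightarrow> 'k ^ 'b) \<Rightarrow> ('k ^ 'c \<Rightarrow> 'k ^ 'c \<Rightarrow> 'k ^ 'c)
    \<Rightarrow> 'k ^ ('b \<times> 'c) \<Rightarrow> 'k ^ ('b \<times> 'c) \<Rightarrow> 'k ^ ('b \<times> 'c)" where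
  "tmult m n t u = tlift (\<lambda>a b. tlift (\<lambda>a' b'. m a a' \<otimes>\<^sub>k n b b') u) t"


section \<open>Hopf algebras\<close>

record ('k, 'b::finite) hopf =
  mul :: "'k ^ 'b \<Rightarrow> 'k ^ 'b \<Rightarrow> 'k ^ 'b"
  unity :: "'k ^ 'b"
  comult :: "'k ^ 'b \<Rightarrow> 'k ^ ('b \<times> 'b)"
  counit :: "'k ^ 'b \<Rightarrow> 'k"

definition algebra_ax :: "('k::field, 'b::finite) hopf \<Rightarrow> bool" where
  "algebra_ax H \<longleftrightarrow>
     (\<forall>a. klinear (mul H a)) \<and> (\<forall>b. klinear (\<lambda>a. mul H a b)) \<and>
     (\<forall>a b c. mul H (mul H a b) c = mul H a (mul H b c)) \<and>
     (\<forall>a. mul H (unity H) a = a) \<and> (\<forall>a. mul H a (unity H) = a)"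

definition coalgebra_ax :: "('k::field, 'b::finite) hopf \<Rightarrow> bool" where
  "coalgebra_ax H \<longleftrightarrow>
     klinear (comult H) \<and> klinear_form (counit H) \<and>
     (\<forall>a. tassoc (tmap (comult H) id (comult H a)) = tmap id (comult H) (comult H a)) \<and>
     (\<forall>a. tlift (\<lambda>a\<^sub>1 a\<^sub>2. counit H a\<^sub>1 *s a\<^sub>2) (comult H a) = a) \<and>
     (\<forall>a. tlift (\<lambda>a\<^sub>1 a\<^sub>2. counit H a\<^sub>2 *s a\<^sub>1) (comult H a) = a)"

definition bialgebra :: "('k::field, 'b::finite) hopf \<Rightarrow> bool" where
  "bialgebra H \<longleftrightarrow> algebra_ax H \<and> coalgebra_ax H \<and>
     (\<forall>a b. comult H (mul H a b) = tmult (mul H) (mul H) (comult H a) (comult H b)) \<and>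
     comult H (unity H) = unity H \<otimes>\<^sub>k unity H \<and>
     (\<forall>a b. counit H (mul H a b) = counit H a * counit H b) \<and>
     counit H (unity H) = 1"

definition antipode :: "('k::field, 'b::finite) hopf \<Rightarrow> ('k ^ 'b \<Rightarrow> 'k ^ 'b) \<Rightarrow> bool" where
  "antipode H S \<longleftrightarrow> klinear S \<and>
     (\<forall>a. tlift (\<lambda>a\<^sub>1 a\<^sub>2. mul H (S a\<^sub>1) a\<^sub>2) (comult H a) = counit H a *s unity H) \<and>
     (\<forall>a. tlift (\<lambda>a\<^sub>1 a\<^sub>2. mul H a\<^sub>1 (S a\<^sub>2)) (comult H a) = counit H a *s unity H)"

definition hopf_algebra :: "('k::field, 'b::finite) hopf \<Rightarrow> bool" where
  "hopf_algebra H \<longleftrightarrow> bialgebra H \<and> (\<exists>S. antipode H S)"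

text \<open>Compatibility with the antipodes is automatic for bialgebra maps.\<close>

definition hopf_hom :: "('k::field, 'b::finite) hopf \<Rightarrow> ('k, 'c::finite) hopf \<Rightarrow> ('k ^ 'b \<Rightarrow> 'k ^ 'c) \<Rightarrow> bool" where
  "hopf_hom H K f \<longleftrightarrow> klinear f \<and>
     (\<forall>a b. f (mul H a b) = mul K (f a) (f b)) \<and> f (unity H) = unity K \<and>
     (\<forall>a. comult K (f a) = tmap f f (comult H a)) \<and> (\<forall>a. counit K (f a) = counit H a)"

definition hopf_iso :: "('k::field, 'b::finite) hopf \<Rightarrow> ('k, 'c::finite) hopf \<Rightarrow> bool" (infix "\<cong>\<^sub>H" 50) where
  "H \<cong>\<^sub>H K \<longleftrightarrow> (\<exists>f. hopf_hom H K f \<and> bij f)"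


section \<open>Twisting\<close>

definition comult_twist :: "('k::field, 'b::finite) hopf \<Rightarrow> 'k ^ ('b \<times> 'b) \<Rightarrow> 'k ^ ('b \<times> 'b) \<Rightarrow> ('k, 'b) hopf" where
  "comult_twist B J J' = B\<lparr>comult :=
     \<lambda>a. tmult (mul B) (mul B) (tmult (mul B) (mul B) J (comult B a)) J'\<rparr>"

text \<open>The last condition is an equation in
  \<open>B \<otimes> (B \<otimes> B)\<close>.\<close>

definition is_twist :: "('k::field, 'b::finite) hopf \<Rightarrow> 'k ^ ('b \<times> 'b) \<Rightarrow> 'k ^ ('b \<times> 'b) \<Rightarrow> bool" where
  "is_twist B J J' \<longleftrightarrow>
     (let m = mul B; mm = tmult m m; mmm = tmult m mm; u = unity B in
      mm J J' = u \<otimes>\<^sub>k u \<and> mm J' J = u \<otimes>\<^sub>k u \<and>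
      tlift (\<lambda>a b. counit B a *s b) J = u \<and>
      tlift (\<lambda>a b. counit B b *s a) J = u \<and>
      mmm (u \<otimes>\<^sub>k J) (tmap id (comult B) J) = mmm (tassoc (J \<otimes>\<^sub>k u)) (tassoc (tmap (comult B) id J)))"

definition twists_comult :: "('k::field, 'b::finite) hopf \<Rightarrow> ('k, 'b) hopf \<Rightarrow> bool" where
  "twists_comult B C \<longleftrightarrow> (\<exists>J J'. is_twist B J J' \<and> C = comult_twist B J J')"

definition mult_twist :: "('k::field, 'b::finite) hopf \<Rightarrow> ('k ^ 'b \<Rightarrow> 'k ^ 'b \<Rightarrow> 'k) \<Rightarrow> ('k ^ 'b \<Rightarrow> 'k ^ 'b \<Rightarrow> 'k)
    \<Rightarrow> ('k, 'b) hopf" where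
  "mult_twist B \<kappa> \<kappa>' = B\<lparr>mul := \<lambda>a b.
     tlift (\<lambda>a\<^sub>1. tlift (\<lambda>a\<^sub>2 a\<^sub>3.
       tlift (\<lambda>b\<^sub>1. tlift (\<lambda>b\<^sub>2 b\<^sub>3.
         (\<kappa> a\<^sub>1 b\<^sub>1 * \<kappa>' a\<^sub>3 b\<^sub>3) *s mul B a\<^sub>2 b\<^sub>2)) (tmap id (comult B) (comult B b))))
     (tmap id (comult B) (comult B a))\<rparr>"

definition bilinear_form :: "('k::field ^ 'b \<Rightarrow> 'k ^ 'b \<Rightarrow> 'k) \<Rightarrow> bool" where
  "bilinear_form \<kappa> \<longleftrightarrow> (\<forall>a. klinear_form (\<kappa> a)) \<and> (\<forall>b. klinear_form (\<lambda>a. \<kappa> a b))"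

text \<open>Convolution of forms on \<open>B \<otimes> B\<close>.\<close>

definition convolve :: "('k::field, 'b::finite) hopf \<Rightarrow> ('k ^ 'b \<Rightarrow> 'k ^ 'b \<Rightarrow> 'k) \<Rightarrow> ('k ^ 'b \<Rightarrow> 'k ^ 'b \<Rightarrow> 'k)
    \<Rightarrow> 'k ^ 'b \<Rightarrow> 'k ^ 'b \<Rightarrow> 'k" where
  "convolve B \<kappa> \<mu> a b =
     tform (\<lambda>a\<^sub>1 a\<^sub>2. tform (\<lambda>b\<^sub>1 b\<^sub>2. \<kappa> a\<^sub>1 b\<^sub>1 * \<mu> a\<^sub>2 b\<^sub>2) (comult B b)) (comult B a)"

definition is_hopf_cocycle :: "('k::field, 'b::finite) hopf \<Rightarrow> ('k ^ 'b \<Rightarrow> 'k ^ 'b \<Rightarrow> 'k) \<Rightarrow> ('k ^ 'b \<Rightarrow> 'k ^ 'b \<Rightarrow> 'k)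
    \<Rightarrow> bool" where
  "is_hopf_cocycle B \<kappa> \<kappa>' \<longleftrightarrow>
     bilinear_form \<kappa> \<and> bilinear_form \<kappa>' \<and>
     (\<forall>a b. convolve B \<kappa> \<kappa>' a b = counit B a * counit B b) \<and>
     (\<forall>a b. convolve B \<kappa>' \<kappa> a b = counit B a * counit B b) \<and>
     (\<forall>a. \<kappa> (unity B) a = counit B a) \<and> (\<forall>a. \<kappa> a (unity B) = counit B a) \<and>
     (\<forall>a b c.
        tform (\<lambda>b\<^sub>1 b\<^sub>2. tform (\<lambda>c\<^sub>1 c\<^sub>2. \<kappa> b\<^sub>1 c\<^sub>1 * \<kappa> a (mul B b\<^sub>2 c\<^sub>2)) (comult B c)) (comult B b) =
        tform (\<lambda>a\<^sub>1 a\<^sub>2. tform (\<lambda>b\<^sub>1 b\<^sub>2. \<kappa> a\<^sub>1 b\<^sub>1 * \<kappa> (mul B a\<^sub>2 b\<^sub>2) c) (comult B b)) (comult B a))"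

definition twists_mult :: "('k::field, 'b::finite) hopf \<Rightarrow> ('k, 'b) hopf \<Rightarrow> bool" where
  "twists_mult B C \<longleftrightarrow> (\<exists>\<kappa> \<kappa>'. is_hopf_cocycle B \<kappa> \<kappa>' \<and> C = mult_twist B \<kappa> \<kappa>')"

text \<open>Either twist may be trivial, since \<open>J = 1 \<otimes> 1\<close> and \<open>\<kappa> = \<epsilon> \<otimes> \<epsilon>\<close> are admissible.\<close>

definition obtained_by_twisting :: "('k::field, 'b::finite) hopf \<Rightarrow> ('k, 'c::finite) hopf \<Rightarrow> bool" where
  "obtained_by_twisting A B \<longleftrightarrow>
     (\<exists>C D. twists_comult B C \<and> twists_mult C D \<and> A \<cong>\<^sub>H D) \<or>
     (\<exists>C D. twists_mult B C \<and> twists_comult C D \<and> A \<cong>\<^sub>H D)"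


section \<open>Matched pairs and bicrossed products\<close>

locale matched_pair =
  fixes lact :: "'g::{group_add,finite} \<Rightarrow> 'f::{group_add,finite} \<Rightarrow> 'f" (infixr "\<triangleright>" 68)
    and ract :: "'g \<Rightarrow> 'f \<Rightarrow> 'g" (infixl "\<triangleleft>" 68)
  assumes lact_zero: "0 \<triangleright> x = x"
    and lact_add: "(s + t) \<triangleright> x = s \<triangleright> (t \<triangleright> x)"
    and ract_zero: "s \<triangleleft> 0 = s"
    and ract_add: "s \<triangleleft> (x + y) = (s \<triangleleft> x) \<triangleleft> y"
    and lact_mult: "s \<triangleright> (x + y) = (s \<triangleright> x) + ((s \<triangleleft> x) \<triangleright> y)"
    and ract_mult: "(s + t) \<triangleleft> x = (s \<triangleleft> (t \<triangleright> x)) + (t \<triangleleft> x)"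

text \<open>\<open>k\<^sup>\<Gamma>\<close>, the algebra of functions on \<open>\<Gamma>\<close>; \<open>axis s 1\<close> is the idempotent \<open>e\<^sub>s\<close>.\<close>

definition function_algebra :: "('k::field, 'g::{group_add,finite}) hopf" where
  "function_algebra = \<lparr>
     mul = \<lambda>a b. \<chi> s. a $ s * b $ s,
     unity = \<chi> s. 1,
     comult = \<lambda>a. \<chi> p. a $ (fst p + snd p),
     counit = \<lambda>a. a $ 0\<rparr>"

definition group_algebra :: "('k::field, 'f::{group_add,finite}) hopf" where
  "group_algebra = \<lparr>
     mul = \<lambda>a b. \<Sum>x\<in>UNIV. \<Sum>y\<in>UNIV. (a $ x * b $ y) *s axis (x + y) 1,
     unity = axis 0 1,
     comult = \<lambda>a. \<Sum>x\<in>UNIV. a $ x *s (axis x 1 \<otimes>\<^sub>k axis x 1),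
     counit = \<lambda>a. \<Sum>x\<in>UNIV. a $ x\<rparr>"

text \<open>\<open>axis (s, x) 1\<close> is \<open>e\<^sub>s # x\<close>. The unit and counit are those for normalized \<open>\<sigma>\<close>, \<open>\<tau>\<close>.\<close>

definition bicrossed_product ::
  "('g::{group_add,finite} \<Rightarrow> 'f::{group_add,finite} \<Rightarrow> 'f) \<Rightarrow> ('g \<Rightarrow> 'f \<Rightarrow> 'g)
    \<Rightarrow> ('g \<Rightarrow> 'f \<Rightarrow> 'f \<Rightarrow> 'k::field) \<Rightarrow> ('f \<Rightarrow> 'g \<Rightarrow> 'g \<Rightarrow> 'k) \<Rightarrow> ('k, 'g \<times> 'f) hopf" where
  "bicrossed_product lact ract \<sigma> \<tau> = \<lparr>
     mul = \<lambda>a b. \<Sum>(s, x)\<in>UNIV. \<Sum>(t, y)\<in>UNIV. (a $ (s, x) * b $ (t, y)) *s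
        (if ract s x = t then \<sigma> s x y *s axis (s, x + y) 1 else 0),
     unity = \<Sum>s\<in>UNIV. axis (s, 0) 1,
     comult = \<lambda>a. \<Sum>(s, x)\<in>UNIV. a $ (s, x) *s
        (\<Sum>(t, u)\<in>{(t, u). t + u = s}. \<tau> x t u *s (axis (t, lact u x) 1 \<otimes>\<^sub>k axis (u, x) 1)),
     counit = \<lambda>a. \<Sum>(s, x)\<in>UNIV. if s = 0 then a $ (s, x) else 0\<rparr>"

definition split_extension ::
  "('g::{group_add,finite} \<Rightarrow> 'f::{group_add,finite} \<Rightarrow> 'f) \<Rightarrow> ('g \<Rightarrow> 'f \<Rightarrow> 'g) \<Rightarrow> ('k::field, 'g \<times> 'f) hopf" where
  "split_extension lact ract = bicrossed_product lact ract (\<lambda>_ _ _. 1) (\<lambda>_ _ _. 1)"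


section \<open>Extensions\<close>

text \<open>Exactness of \<open>k \<rightarrow> B \<rightarrow> A \<rightarrow> H \<rightarrow> k\<close>: besides injectivity and surjectivity,
  \<open>ker \<pi> = A \<iota>(B)\<^sup>+\<close> and \<open>\<iota>(B)\<close> is the algebra of coinvariants of \<open>\<pi>\<close>.\<close>

definition exact_sequence ::
  "('k::field, 'b::finite) hopf \<Rightarrow> ('k ^ 'b \<Rightarrow> 'k ^ 'a) \<Rightarrow> ('k, 'a::finite) hopf \<Rightarrow> ('k ^ 'a \<Rightarrow> 'k ^ 'c)
    \<Rightarrow> ('k, 'c::finite) hopf \<Rightarrow> bool" where
  "exact_sequence B \<iota> A \<pi> H \<longleftrightarrow>
     hopf_hom B A \<iota> \<and> inj \<iota> \<and> hopf_hom A H \<pi> \<and> surj \<pi> \<and>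
     {a. \<pi> a = 0} = vec.span {mul A a (\<iota> b) | a b. counit B b = 0} \<and>
     range \<iota> = {a. tmap id \<pi> (comult A a) = a \<otimes>\<^sub>k unity H}"

text \<open>
  The actions attached to an extension \<open>k \<rightarrow> k\<^sup>\<Gamma> \<rightarrow> A \<rightarrow> kF \<rightarrow> k\<close>, read off without choosing a
  section of \<open>\<pi>\<close>. Through \<open>(id \<otimes> \<pi>)\<Delta>\<close>, \<open>A\<close> is graded by \<open>F\<close>, with \<open>\<iota>(k\<^sup>\<Gamma>)\<close> in degree 1.
  Homogeneous elements \<open>a\<close> of degree \<open>x\<close> (e.g. the values at \<open>x\<close> of sections \<open>kF \<rightarrow> A\<close> of \<open>\<pi>\<close>)
  commute past \<open>k\<^sup>\<Gamma>\<close> by the action \<open>(x \<cdot> f)(s) = f(s \<triangleleft> x)\<close> of \<open>F\<close> on \<open>k\<^sup>\<Gamma>\<close>, i.e.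
  \<open>a \<iota>(f) = \<iota>(x \<cdot> f) a\<close>; on idempotents, \<open>\<iota>(e\<^sub>s) a = a \<iota>(e\<^bsub>s \<triangleleft> x\<^esub>)\<close>.
  Dually, \<open>\<triangleright>\<close> is the coaction of \<open>k\<^sup>\<Gamma>\<close> on \<open>kF\<close>: the left \<open>kF\<close>-coaction \<open>(\<pi> \<otimes> id)\<Delta>\<close> puts
  \<open>\<iota>(e\<^sub>s) a\<close> in degree \<open>s \<triangleright> x\<close>. In a bicrossed product, the component of degree \<open>x\<close> is spanned by
  the \<open>e\<^sub>s # x\<close>.
\<close>

definition affords ::
  "('g::{group_add,finite} \<Rightarrow> 'f::{group_add,finite} \<Rightarrow> 'f) \<Rightarrow> ('g \<Rightarrow> 'f \<Rightarrow> 'g)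
    \<Rightarrow> (('k::field, 'g) vec \<Rightarrow> 'k ^ 'a) \<Rightarrow> ('k, 'a::finite) hopf \<Rightarrow> ('k ^ 'a \<Rightarrow> ('k, 'f) vec) \<Rightarrow> bool" where
  "affords lact ract \<iota> A \<pi> \<longleftrightarrow>
     (\<forall>a x s. tmap id \<pi> (comult A a) = a \<otimes>\<^sub>k axis x 1 \<longrightarrow>
        mul A (\<iota> (axis s 1)) a = mul A a (\<iota> (axis (ract s x) 1)) \<and>
        tmap \<pi> id (comult A (mul A (\<iota> (axis s 1)) a)) =
          axis (lact s x) 1 \<otimes>\<^sub>k mul A (\<iota> (axis s 1)) a)"


section \<open>Bicrossed products are extensions affording the given actions\<close>

lemma tmap_nth: "tmap f g t $ (i, j) = (\<Sum>p\<in>UNIV. \<Sum>q\<in>UNIV. t $ (p, q) * (f (axis p 1) $ i * g (axis q 1) $ j))"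
  by (simp add: tmap_def tlift_def tensor_def sum.cartesian_product' UNIV_Times_UNIV[symmetric] del: UNIV_Times_UNIV)

lemma tensor_nth [simp]: "(v \<otimes>\<^sub>k w) $ (i, j) = v $ i * w $ j" by (simp add: tensor_def)

lemma add_idem_imp_zero: "a = a + a \<Longrightarrow> a = (0::'a::group_add)"
proof -
  assume "a = a + a" then have "a + 0 = a + a" by simp
  then show "a = 0" by (simp only: add_left_cancel)
qed

context matched_pair begin

lemma ract_eq_iff: "s \<triangleleft> x = t \<triangleleft> x \<longleftrightarrow> s = t"
  by (metis ract_add ract_zero right_minus)

lemma zero_ract: "0 \<triangleleft> x = 0"
  using ract_mult[of 0 0 x] by (intro add_idem_imp_zero) (simp add: lact_zero)

lemma bic_mult: "mul (bicrossed_product (\<triangleright>) (\<triangleleft>) \<sigma> \<tau>) a b $ (s, z) =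
   (\<Sum>x\<in>UNIV. a $ (s, x) * b $ (s \<triangleleft> x, - x + z) * \<sigma> s x (- x + z))"
proof -
  have *: "s' = s \<and> x + y = z \<longleftrightarrow> s' = s \<and> y = - x + z" for s' x y
    by (metis add_minus_cancel minus_add_cancel)
  have "mul (bicrossed_product (\<triangleright>) (\<triangleleft>) \<sigma> \<tau>) a b $ (s, z) =
    (\<Sum>s'\<in>UNIV. \<Sum>x\<in>UNIV. \<Sum>t\<in>UNIV. \<Sum>y\<in>UNIV. if t = s' \<triangleleft> x then (if s' = s then if y = - x + z then a $ (s', x) * b $ (t, y) * \<sigma> s' x y else 0 else 0) else 0)"
    unfolding bicrossed_product_def UNIV_Times_UNIV[symmetric] sum.cartesian_product[symmetric]
    apply (simp del: UNIV_Times_UNIV)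
    apply (intro sum.cong refl)
    using * by (auto simp: axis_def)
  also have "\<dots> = (\<Sum>s'\<in>UNIV. \<Sum>x\<in>UNIV. \<Sum>t\<in>UNIV. if t = s' \<triangleleft> x then (if s' = s then a $ (s', x) * b $ (t, -x+z) * \<sigma> s' x (-x+z) else 0) else 0)"
    by (intro sum.cong refl) auto
  also have "\<dots> = (\<Sum>s'\<in>UNIV. if s' = s then \<Sum>x\<in>UNIV. a $ (s', x) * b $ (s' \<triangleleft> x, -x+z) * \<sigma> s' x (-x+z) else 0)"
    by (intro sum.cong refl) auto
  finally show ?thesis by simp
qed

lemma bic_comult: "comult (bicrossed_product (\<triangleright>) (\<triangleleft>) \<sigma> \<tau>) a $ ((t, z), (u, x)) =
   (if z = u \<triangleright> x then \<tau> x t u * a $ (t + u, x) else 0)"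
proof -
  have *: "(\<Sum>(t', u')\<in>{(t', u'). t' + u' = s}. \<tau> y t' u' *s (axis (t', u' \<triangleright> y) 1 \<otimes>\<^sub>k axis (u', y) 1)) $ ((t, z), (u, x))
     = (if s = t + u then if y = x then if z = u \<triangleright> x then \<tau> x t u else 0 else 0 else 0)" for s y
  proof -
    have "(\<Sum>(t', u')\<in>{(t', u'). t' + u' = s}. \<tau> y t' u' *s (axis (t', u' \<triangleright> y) 1 \<otimes>\<^sub>k axis (u', y) 1)) $ ((t, z), (u, x))
      = (\<Sum>p\<in>{(t', u'). t' + u' = s}. if p = (t, u) then (if y = x then if z = u \<triangleright> x then \<tau> x t u else 0 else 0) else 0)"
      unfolding sum_component by (intro sum.cong refl) (auto simp: axis_def split_beta tensor_def)
    then show ?thesis by (simp add: sum.delta finite_subset[OF subset_UNIV]) 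
  qed
  have "comult (bicrossed_product (\<triangleright>) (\<triangleleft>) \<sigma> \<tau>) a $ ((t, z), (u, x)) =
    (\<Sum>s\<in>UNIV. \<Sum>y\<in>UNIV. a $ (s, y) * (if s = t + u then if y = x then if z = u \<triangleright> x then \<tau> x t u else 0 else 0 else 0))"
    unfolding bicrossed_product_def UNIV_Times_UNIV[symmetric] sum.cartesian_product[symmetric] hopf.simps
      sum_component vector_smult_component *[unfolded sum_component] by (rule refl)
  also have "\<dots> = (\<Sum>s\<in>UNIV. \<Sum>y\<in>UNIV. if y = x then if s = t + u then (if z = u \<triangleright> x then \<tau> x t u * a $ (t + u, x) else 0) else 0 else 0)"
    by (intro sum.cong refl) auto
  finally show ?thesis by simp
qed

definition bicrossed_inc :: "('k::field, 'g) vec \<Rightarrow> ('k, 'g \<times> 'f) vec" where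
  "bicrossed_inc f = (\<chi> p. if snd p = 0 then f $ fst p else 0)"
definition bicrossed_proj :: "('k::field, 'g \<times> 'f) vec \<Rightarrow> ('k, 'f) vec" where
  "bicrossed_proj a = (\<chi> x. a $ (0, x))"

lemma zero_lact: "u \<triangleright> 0 = 0"
  using lact_mult[of u 0 0] by (intro add_idem_imp_zero) (simp add: ract_zero)

lemma tmap_prj: "tmap id bicrossed_proj t $ (i, x) = t $ (i, (0, x))" "tmap bicrossed_proj id t $ (x, i) = t $ ((0, x), i)"
proof -
  have "tmap id bicrossed_proj t $ (i, x) = (\<Sum>p\<in>UNIV. \<Sum>q\<in>UNIV. if q = (0,x) then if p = i then t $ (p, q) else 0 else 0)"
    unfolding tmap_nth by (intro sum.cong refl) (auto simp: bicrossed_proj_def axis_def)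
  then show "tmap id bicrossed_proj t $ (i, x) = t $ (i, (0, x))" by simp
  have "tmap bicrossed_proj id t $ (x, i) = (\<Sum>p\<in>UNIV. \<Sum>q\<in>UNIV. if q = i then if p = (0,x) then t $ (p, q) else 0 else 0)"
    unfolding tmap_nth by (intro sum.cong refl) (auto simp: bicrossed_proj_def axis_def)
  then show "tmap bicrossed_proj id t $ (x, i) = t $ ((0, x), i)" by simp
qed

lemma tmap_prj2: "tmap bicrossed_proj bicrossed_proj t $ (x, y) = t $ ((0, x), (0, y))"
proof -
  have "tmap bicrossed_proj bicrossed_proj t $ (x, y) = (\<Sum>p\<in>UNIV. \<Sum>q\<in>UNIV. if q = (0,y) then if p = (0,x) then t $ (p, q) else 0 else 0)"
    unfolding tmap_nth by (intro sum.cong refl) (auto simp: bicrossed_proj_def axis_def)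
  then show ?thesis by simp
qed

lemma tmap_inc: "tmap bicrossed_inc bicrossed_inc t $ ((s, x), (u, y)) = (if x = 0 \<and> y = 0 then t $ (s, u) else 0)"
proof -
  have "tmap bicrossed_inc bicrossed_inc t $ ((s, x), (u, y)) = (\<Sum>p\<in>UNIV. \<Sum>q\<in>UNIV. if q = u then if p = s then (if x = 0 \<and> y = 0 then t $ (s, u) else 0) else 0 else 0)"
    unfolding tmap_nth by (intro sum.cong refl) (auto simp: bicrossed_inc_def axis_def)
  then show ?thesis by simp
qed

text \<open>Consistency check for \<open>exact_sequence\<close> and \<open>affords\<close>. The conditions \<open>\<sigma>\<^sub>1 = 1\<close> and
  \<open>\<tau>\<^sub>1 = 1\<close> say that the counit is multiplicative and that \<open>\<Delta>(1) = 1 \<otimes> 1\<close>.\<close>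

lemma bicrossed_product_extension:
  fixes \<sigma> :: "'g \<Rightarrow> 'f \<Rightarrow> 'f \<Rightarrow> 'k::field"
  assumes sg: "\<And>s x. \<sigma> s 0 x = 1" "\<And>s x. \<sigma> s x 0 = 1" "\<And>x y. \<sigma> 0 x y = 1"
    and ta: "\<And>x t. \<tau> x 0 t = 1" "\<And>x t. \<tau> x t 0 = 1" "\<And>t u. \<tau> 0 t u = 1"
  defines "B \<equiv> bicrossed_product (\<triangleright>) (\<triangleleft>) \<sigma> \<tau>"
  shows "exact_sequence function_algebra bicrossed_inc B bicrossed_proj group_algebra" "affords (\<triangleright>) (\<triangleleft>) bicrossed_inc B bicrossed_proj"
proof -
  have one: "unity B $ (s, x) = (if x = 0 then 1 else 0)" for s x
  proof -
    have "unity B $ (s, x) = (\<Sum>r\<in>UNIV. if r = s then if x = 0 then 1 else 0 else (0::'k))"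
      unfolding B_def bicrossed_product_def hopf.simps sum_component
      by (intro sum.cong refl) (auto simp: axis_def)
    then show ?thesis by simp
  qed
  have cu: "counit B a = (\<Sum>x\<in>UNIV. a $ (0, x))" for a
    unfolding B_def bicrossed_product_def UNIV_Times_UNIV[symmetric] sum.cartesian_product[symmetric]
    by (subst hopf.simps, subst sum.swap) simp
  have mi: "mul B (bicrossed_inc f) a $ (s, z) = f $ s * a $ (s, z)" for f a s z
  proof -
    have "mul B (bicrossed_inc f) a $ (s, z) = (\<Sum>x::'f\<in>UNIV. if x = 0 then f $ s * a $ (s, z) else 0)"
      unfolding B_def bic_mult by (rule sum.cong[OF refl]) (auto simp: bicrossed_inc_def ract_zero sg)
    then show ?thesis by simp
  qed
  have im: "mul B a (bicrossed_inc f) $ (s, z) = a $ (s, z) * f $ (s \<triangleleft> z)" for f a s z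
  proof -
    have "mul B a (bicrossed_inc f) $ (s, z) = (\<Sum>x\<in>UNIV. if x = z then a $ (s, z) * f $ (s \<triangleleft> z) else 0)"
      unfolding B_def bic_mult by (rule sum.cong[OF refl]) (auto simp: bicrossed_inc_def sg add_eq_0_iff neg_eq_iff_add_eq_0)
    then show ?thesis by simp
  qed
  have cm: "comult B a $ ((t, z), (u, x)) = (if z = u \<triangleright> x then \<tau> x t u * a $ (t + u, x) else 0)" for a t z u x
    unfolding B_def by (rule bic_comult)
  have ga: "mul group_algebra a b $ z = (\<Sum>x\<in>UNIV. a $ x * b $ (- x + z))" for a b :: "('k,'f) vec" and z
  proof -
    have "mul group_algebra a b $ z = (\<Sum>x\<in>UNIV. \<Sum>y\<in>UNIV. if y = - x + z then a $ x * b $ y else 0)"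
      unfolding group_algebra_def hopf.simps sum_component vector_smult_component
      by (intro sum.cong refl) (auto simp: axis_def add.assoc[symmetric])
    then show ?thesis by simp
  qed
  have gc: "comult group_algebra a $ (x, y) = (if x = y then a $ x else 0)" for a :: "('k,'f) vec" and x y
  proof -
    have "comult group_algebra a $ (x, y) = (\<Sum>z\<in>UNIV. if z = x then (if x = y then a $ x else 0) else 0)"
      unfolding group_algebra_def hopf.simps sum_component vector_smult_component
      by (intro sum.cong refl) (auto simp: axis_def)
    then show ?thesis by simp
  qed
  have hi: "hopf_hom function_algebra B bicrossed_inc"
    unfolding hopf_hom_def
  proof (intro conjI allI)
    show "klinear bicrossed_inc" by unfold_locales (auto simp: bicrossed_inc_def vec_eq_iff)
    fix a b
    show "bicrossed_inc (mul function_algebra a b) = mul B (bicrossed_inc a) (bicrossed_inc b)"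
      by (auto simp: vec_eq_iff mi) (auto simp: bicrossed_inc_def function_algebra_def)
    show "bicrossed_inc (unity function_algebra) = unity B"
      by (auto simp: vec_eq_iff one) (auto simp: bicrossed_inc_def function_algebra_def)
    show "comult B (bicrossed_inc a) = tmap bicrossed_inc bicrossed_inc (comult function_algebra a)"
      by (auto simp: vec_eq_iff cm tmap_inc zero_lact) (auto simp: bicrossed_inc_def function_algebra_def ta zero_lact split: if_splits)
    show "counit B (bicrossed_inc a) = counit function_algebra a"
      by (simp add: cu) (simp add: bicrossed_inc_def function_algebra_def)
  qed
  have hp: "hopf_hom B group_algebra bicrossed_proj"
    unfolding hopf_hom_def
  proof (intro conjI allI)
    show "klinear bicrossed_proj" by unfold_locales (auto simp: bicrossed_proj_def vec_eq_iff)
    fix a b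
    show "bicrossed_proj (mul B a b) = mul group_algebra (bicrossed_proj a) (bicrossed_proj b)"
      by (auto simp: vec_eq_iff ga) (auto simp: bicrossed_proj_def B_def bic_mult sg zero_ract)
    show "bicrossed_proj (unity B) = unity group_algebra"
      by (auto simp: vec_eq_iff bicrossed_proj_def one group_algebra_def axis_def)
    show "comult group_algebra (bicrossed_proj a) = tmap bicrossed_proj bicrossed_proj (comult B a)"
      by (auto simp: vec_eq_iff tmap_prj2 gc cm ta lact_zero) (auto simp: bicrossed_proj_def)
    show "counit group_algebra (bicrossed_proj a) = counit B a"
      by (simp add: cu) (simp add: bicrossed_proj_def group_algebra_def)
  qed
  have hom: "tmap id bicrossed_proj (comult B a) = a \<otimes>\<^sub>k axis x 1 \<longleftrightarrow> (\<forall>t z. z \<noteq> x \<longrightarrow> a $ (t, z) = 0)" for a x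
    by (auto simp: vec_eq_iff tmap_prj cm lact_zero ta axis_def)
  have ker: "{a. bicrossed_proj a = 0} = vec.span {mul B a (bicrossed_inc b) | a b. counit function_algebra b = 0}" (is "?K = vec.span ?S")
  proof
    show "?K \<subseteq> vec.span ?S"
    proof safe
      fix a :: "('k, 'g \<times> 'f) vec" assume a: "bicrossed_proj a = 0"
      define b :: "('k,'g) vec" where "b = (\<chi> s. if s = 0 then 0 else 1)"
      have "s \<triangleleft> z = 0 \<longleftrightarrow> s = 0" for s z using ract_eq_iff[of s z 0] by (simp add: zero_ract)
      then have "a = mul B a (bicrossed_inc b)" using a
        by (auto simp: vec_eq_iff im b_def bicrossed_proj_def)
      moreover have "counit function_algebra b = 0" by (simp add: b_def function_algebra_def)
      ultimately show "a \<in> vec.span ?S" by (intro vec.span_base) blast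
    qed
    have "vec.subspace ?K" by (auto simp: vec.subspace_def vec_eq_iff bicrossed_proj_def)
    moreover have "?S \<subseteq> ?K" by (auto simp: vec_eq_iff bicrossed_proj_def im zero_ract function_algebra_def)
    ultimately show "vec.span ?S \<subseteq> ?K" by (rule vec.span_minimal[rotated])
  qed
  have ran: "range bicrossed_inc = {a. tmap id bicrossed_proj (comult B a) = a \<otimes>\<^sub>k unity group_algebra}"
  proof -
    have "a \<in> range bicrossed_inc" if "\<forall>t z. z \<noteq> 0 \<longrightarrow> a $ (t, z) = 0" for a :: "('k, 'g \<times> 'f) vec"
    proof
      show "a = bicrossed_inc (\<chi> s. a $ (s, 0))" using that by (auto simp: vec_eq_iff bicrossed_inc_def)
    qed simp
    then show ?thesis by (auto simp: hom group_algebra_def) (auto simp: bicrossed_inc_def)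
  qed
  have "inj (bicrossed_inc :: ('k, 'g) vec \<Rightarrow> _)" by (auto simp: inj_on_def bicrossed_inc_def vec_eq_iff)
  moreover have "surj (bicrossed_proj :: _ \<Rightarrow> ('k, 'f) vec)"
    unfolding surj_def
  proof
    fix b :: "('k, 'f) vec"
    have "b = bicrossed_proj (\<chi> p. b $ snd p)" by (simp add: bicrossed_proj_def vec_eq_iff)
    then show "\<exists>a. b = bicrossed_proj a" by blast
  qed
  ultimately show "exact_sequence function_algebra bicrossed_inc B bicrossed_proj group_algebra"
    using hi hp ker ran by (simp add: exact_sequence_def)
  show "affords (\<triangleright>) (\<triangleleft>) bicrossed_inc B bicrossed_proj"
    unfolding affords_def
  proof (intro allI impI)
    fix a x s assume "tmap id bicrossed_proj (comult B a) = a \<otimes>\<^sub>k axis x 1"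
    then have a: "\<And>t z. z \<noteq> x \<Longrightarrow> a $ (t, z) = 0" by (simp add: hom)
    show "mul B (bicrossed_inc (axis s 1)) a = mul B a (bicrossed_inc (axis (s \<triangleleft> x) 1)) \<and>
      tmap bicrossed_proj id (comult B (mul B (bicrossed_inc (axis s 1)) a)) = axis (s \<triangleright> x) 1 \<otimes>\<^sub>k mul B (bicrossed_inc (axis s 1)) a"
    proof
      show "mul B (bicrossed_inc (axis s 1)) a = mul B a (bicrossed_inc (axis (s \<triangleleft> x) 1))"
        using a by (auto simp: vec_eq_iff mi im axis_def ract_eq_iff) (metis ract_eq_iff)+
      show "tmap bicrossed_proj id (comult B (mul B (bicrossed_inc (axis s 1)) a)) = axis (s \<triangleright> x) 1 \<otimes>\<^sub>k mul B (bicrossed_inc (axis s 1)) a"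
        using a by (auto simp: vec_eq_iff mi im axis_def tmap_prj cm ta) metis+
    qed
  qed
qed

end

end

theory Submission
  imports Defs
begin

text \<open>The proof has a Hopf-algebraic half and a cohomological half.

  Every extension is a bicrossed product (\<open>ex_bicrossed_product\<close>). Through \<open>(id \<otimes> \<pi>)\<Delta>\<close> the algebra
  \<open>A\<close> is graded by \<open>F\<close> with \<open>k\<^sup>\<Gamma>\<close> in degree \<open>0\<close>. If \<open>\<pi>(b)\<close> is the group element \<open>x\<close>, the antipode
  identity \<open>S(b\<^sub>1) b\<^sub>2 = 1\<close> exhibits \<open>1\<close> as a sum of products of elements of degrees \<open>-x\<close> and \<open>x\<close>, so the
  grading is strong (\<open>strongly_graded\<close>). Cutting with the idempotents \<open>e\<^sub>s\<close> of \<open>k\<^sup>\<Gamma>\<close>, each piece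
  \<open>e\<^sub>s A\<^sub>x\<close> is a line (\<open>one_dimensional\<close>), and generators \<open>d s x\<close> of these lines form a basis that
  plays the role of the \<open>e\<^sub>s # x\<close>. The structure constants in this basis are the cocycles \<open>\<sigma>\<close> and \<open>\<tau>\<close>;
  the Hopf algebra axioms become the conditions collected in \<open>kac_cocycle\<close>.

  It remains to see that \<open>(\<sigma>, \<tau>)\<close> differs by a coboundary from a pair built from a 2-cocycle \<open>\<alpha>\<close> of \<open>F\<close>
  and a 2-cocycle \<open>\<beta>\<close> of \<open>\<Gamma>\<close>. In terms of the Kac exact sequence
  \<open>H\<^sup>2(F, k\<^sup>\<times>) \<oplus> H\<^sup>2(\<Gamma>, k\<^sup>\<times>) \<rightarrow> Opext \<rightarrow> H\<^sup>3(F \<bowtie> \<Gamma>, k\<^sup>\<times>)\<close>, this says that the first map is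
  surjective. Instead of comparing \<open>H\<^sup>3\<close> with its restrictions to \<open>F\<close> and \<open>\<Gamma>\<close>, the argument averages
  explicitly: multiplying \<open>\<sigma>\<close> over one of its arguments trivializes its power \<open>|F|\<close>, which turns \<open>\<tau>\<close> into
  a 1-cocycle of \<open>F\<close>, and averaging once more leaves only a 2-cocycle of \<open>\<Gamma>\<close>. So \<open>|F|\<^sup>2\<close>
  times the class of \<open>(\<sigma>, \<tau>)\<close> comes from \<open>H\<^sup>2(\<Gamma>, k\<^sup>\<times>)\<close> (\<open>kac_cocycle_power_F\<close>), and symmetrically
  \<open>|\<Gamma>|\<^sup>2\<close> times it comes from \<open>H\<^sup>2(F, k\<^sup>\<times>)\<close> (\<open>kac_cocycle_power_\<Gamma>\<close>). As \<open>|F|\<^sup>2\<close> and \<open>|\<Gamma>|\<^sup>2\<close> are coprime,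
  the class itself lies in the image (\<open>kac_cocycle_edge_image\<close>).

  Finally, a 2-cocycle \<open>\<beta>\<close> of \<open>\<Gamma>\<close> is a twist \<open>\<Sum> \<beta>(s, t) e\<^sub>s \<otimes> e\<^sub>t\<close> lying in \<open>k\<^sup>\<Gamma> \<otimes> k\<^sup>\<Gamma>\<close>, and a 2-cocycle
  \<open>\<alpha>\<close> of \<open>F\<close> pulls back along the projection to \<open>kF\<close> to a Hopf 2-cocycle. Twisting the split
  extension by these two produces exactly the pair built from \<open>\<alpha>\<close> and \<open>\<beta>\<close>
  (\<open>comult_twist_bicrossed\<close>, \<open>mult_twist_bicrossed\<close>).\<close>

section \<open>Linear algebra on coordinate tensors\<close>

lemma klinear_iff:
  fixes f :: "'k::field ^ 'b \<Rightarrow> 'k ^ 'c"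
  shows "klinear f \<longleftrightarrow> (\<forall>a b. f (a + b) = f a + f b) \<and> (\<forall>c a. f (c *s a) = c *s f a)"
  unfolding Vector_Spaces.linear_iff by (auto intro: vec.vector_space_axioms)

lemma klinear_form_iff:
  fixes f :: "'k::field ^ 'b \<Rightarrow> 'k"
  shows "klinear_form f \<longleftrightarrow> (\<forall>a b. f (a + b) = f a + f b) \<and> (\<forall>c a. f (c *s a) = c * f a)"
proof -
  have "vector_space ((*) :: 'k \<Rightarrow> 'k \<Rightarrow> 'k)" by unfold_locales (auto simp: algebra_simps)
  then show ?thesis unfolding Vector_Spaces.linear_iff by (auto intro: vec.vector_space_axioms)
qed

lemma klinear_zero: "klinear f \<Longrightarrow> f 0 = 0"
  unfolding klinear_iff by (metis add_cancel_right_right)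

lemma klinear_form_zero: "klinear_form f \<Longrightarrow> f 0 = 0"
  unfolding klinear_form_iff by (metis add_cancel_right_right)

lemma klinear_sum: "klinear f \<Longrightarrow> f (\<Sum>i\<in>I. g i) = (\<Sum>i\<in>I. f (g i))"
  by (induction I rule: infinite_finite_induct) (auto simp: klinear_zero klinear_iff)

lemma klinear_form_sum: "klinear_form f \<Longrightarrow> f (\<Sum>i\<in>I. g i) = (\<Sum>i\<in>I. f (g i))"
  by (induction I rule: infinite_finite_induct) (auto simp: klinear_form_zero klinear_form_iff)

lemma klinear_expand: "klinear f \<Longrightarrow> f v = (\<Sum>i\<in>UNIV. v $ i *s f (axis i 1))"
  by (subst basis_expansion[symmetric], subst klinear_sum) (auto simp: klinear_iff)

lemma klinear_form_expand: "klinear_form f \<Longrightarrow> f v = (\<Sum>i\<in>UNIV. v $ i * f (axis i 1))"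
  by (subst basis_expansion[symmetric], subst klinear_form_sum) (auto simp: klinear_form_iff)

lemma klinear_eqI:
  assumes "klinear f" "klinear g" "\<And>i. f (axis i 1) = g (axis i 1)"
  shows "f v = g v"
  unfolding klinear_expand[OF assms(1), of v] klinear_expand[OF assms(2), of v] assms(3) by (rule refl)

lemma klinear_id [simp]: "klinear (\<lambda>a. a)" "klinear id"
  by (auto simp: klinear_iff)

lemma klinear_comp: "klinear f \<Longrightarrow> klinear g \<Longrightarrow> klinear (\<lambda>v. f (g v))"
  by (auto simp: klinear_iff)

definition kbilinear :: "('k::field ^ 'b \<Rightarrow> 'k ^ 'c \<Rightarrow> 'k ^ 'd) \<Rightarrow> bool" where
  "kbilinear \<beta> \<longleftrightarrow> (\<forall>v. klinear (\<beta> v)) \<and> (\<forall>w. klinear (\<lambda>v. \<beta> v w))"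

lemma klinear_tlift: "klinear (tlift \<beta>)"
  by (auto simp: klinear_iff tlift_def vec_eq_iff algebra_simps sum.distrib sum_distrib_left)

lemma klinear_tmap: "klinear (tmap f g)"
  unfolding tmap_def by (rule klinear_tlift)

lemma klinear_tensor: "klinear (\<lambda>v. v \<otimes>\<^sub>k w)" "klinear (\<lambda>w. v \<otimes>\<^sub>k w)"
  by (auto simp: klinear_iff vec_eq_iff algebra_simps)

lemma axis_pair: "axis (i, j) 1 = axis i 1 \<otimes>\<^sub>k (axis j 1 :: 'k::field ^ 'c)"
  by (auto simp: vec_eq_iff axis_def)

lemma tensor_eqI:
  assumes "klinear f" "klinear g" "\<And>v w. f (v \<otimes>\<^sub>k w) = g (v \<otimes>\<^sub>k w)"
  shows "f t = g t"
  by (rule klinear_eqI) (use assms in \<open>auto simp: axis_pair\<close>)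

lemma tlift_axis: "tlift \<beta> (axis (i, j) 1) = \<beta> (axis i 1) (axis j 1)"
proof -
  have "tlift \<beta> (axis (i, j) 1) = (\<Sum>p\<in>UNIV. if p = (i, j) then \<beta> (axis i 1) (axis j 1) else 0)"
    unfolding tlift_def by (intro sum.cong refl) (auto simp: axis_def)
  then show ?thesis by simp
qed

lemma tlift_tensor:
  assumes "kbilinear \<beta>"
  shows "tlift \<beta> (v \<otimes>\<^sub>k w) = \<beta> v w"
proof -
  have "tlift \<beta> (v \<otimes>\<^sub>k axis j 1) = \<beta> v (axis j 1)" for j
  proof (rule klinear_eqI[of "\<lambda>v. tlift \<beta> (v \<otimes>\<^sub>k axis j 1)"])
    show "klinear (\<lambda>v. tlift \<beta> (v \<otimes>\<^sub>k axis j 1))"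
      by (rule klinear_comp[OF klinear_tlift]) (rule klinear_tensor)
  qed (use assms in \<open>auto simp: kbilinear_def axis_pair[symmetric] tlift_axis\<close>)
  moreover have "klinear (\<lambda>w. tlift \<beta> (v \<otimes>\<^sub>k w))"
    by (rule klinear_comp[OF klinear_tlift]) (rule klinear_tensor)
  ultimately show ?thesis
    using assms unfolding kbilinear_def by (metis (no_types, lifting) klinear_eqI)
qed

lemma tmap_tensor: "klinear f \<Longrightarrow> klinear g \<Longrightarrow> tmap f g (v \<otimes>\<^sub>k w) = f v \<otimes>\<^sub>k g w"
  unfolding tmap_def
  by (rule tlift_tensor) (auto simp: kbilinear_def klinear_iff vec_eq_iff algebra_simps)

lemma klinear_of_tlift: "klinear f \<Longrightarrow> f (tlift \<beta> t) = tlift (\<lambda>v w. f (\<beta> v w)) t"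
  unfolding tlift_def by (subst klinear_sum) (auto simp: klinear_iff)

lemma tlift_tmap:
  assumes "kbilinear \<beta>"
  shows "tlift \<beta> (tmap f g t) = tlift (\<lambda>v w. \<beta> (f v) (g w)) t"
  unfolding tmap_def by (simp add: klinear_of_tlift[OF klinear_tlift] tlift_tensor[OF assms])

lemma tmap_tmap:
  assumes "klinear f" "klinear g"
  shows "tmap f g (tmap f' g' t) = tmap (\<lambda>v. f (f' v)) (\<lambda>w. g (g' w)) t"
  by (simp add: tmap_def[of f' g'] klinear_of_tlift[OF klinear_tmap] tmap_tensor assms) (simp add: tmap_def)

lemma tmap_id: "tmap (\<lambda>v. v) (\<lambda>w. w) t = t" "tmap id id t = t"
  by (rule tensor_eqI[OF klinear_tmap klinear_id(1)]; simp add: tmap_tensor)+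

lemma klinear_tassoc: "klinear tassoc"
  by (auto simp: klinear_iff vec_eq_iff tassoc_def)

lemma tassoc_tensor: "tassoc ((u \<otimes>\<^sub>k v) \<otimes>\<^sub>k w) = u \<otimes>\<^sub>k (v \<otimes>\<^sub>k w)"
  by (auto simp: vec_eq_iff tassoc_def)

lemma tensor3_eqI:
  assumes "klinear f" "klinear g" "\<And>u v w. f ((u \<otimes>\<^sub>k v) \<otimes>\<^sub>k w) = g ((u \<otimes>\<^sub>k v) \<otimes>\<^sub>k w)"
  shows "f t = g t"
proof (rule tensor_eqI[OF assms(1,2)])
  fix t w show "f (t \<otimes>\<^sub>k w) = g (t \<otimes>\<^sub>k w)"
    by (rule tensor_eqI[OF klinear_comp[OF assms(1) klinear_tensor(1)]
          klinear_comp[OF assms(2) klinear_tensor(1)] assms(3)])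
qed

lemma tassoc_tmap:
  assumes "klinear f" "klinear g" "klinear h"
  shows "tassoc (tmap (tmap f g) h t) = tmap f (tmap g h) (tassoc t)"
  by (rule tensor3_eqI[of "\<lambda>t. tassoc (tmap (tmap f g) h t)"])
    (auto intro!: klinear_comp[OF klinear_tassoc klinear_tmap] klinear_comp[OF klinear_tmap klinear_tassoc]
      simp: tmap_tensor klinear_tmap assms tassoc_tensor)

lemma klinear_tmult: "klinear (tmult m n t)" "klinear (\<lambda>t. tmult m n t u)"
proof -
  show "klinear (\<lambda>t. tmult m n t u)" unfolding tmult_def by (rule klinear_tlift)
  show "klinear (tmult m n t)"
    unfolding tmult_def tlift_def[of _ t] klinear_iff
    by (simp add: klinear_tlift[unfolded klinear_iff] vec.scale_right_distrib sum.distrib vec.scale_sum_right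
        mult.commute)
qed

lemma tmult_tensor:
  assumes "kbilinear m" "kbilinear n"
  shows "tmult m n (v \<otimes>\<^sub>k w) (v' \<otimes>\<^sub>k w') = m v v' \<otimes>\<^sub>k n w w'"
proof -
  have "tlift (\<lambda>a' b'. m a a' \<otimes>\<^sub>k n b b') (v' \<otimes>\<^sub>k w') = m a v' \<otimes>\<^sub>k n b w'" for a b
    by (rule tlift_tensor) (use assms in \<open>auto simp: kbilinear_def klinear_iff vec_eq_iff algebra_simps\<close>)
  then show ?thesis unfolding tmult_def
    by simp (rule tlift_tensor, use assms in \<open>auto simp: kbilinear_def klinear_iff vec_eq_iff algebra_simps\<close>)
qed

lemma tensor2_eqI:
  assumes "\<And>u. klinear (\<lambda>t. f t u)" "\<And>t. klinear (f t)" "\<And>u. klinear (\<lambda>t. g t u)" "\<And>t. klinear (g t)"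
    and "\<And>v w v' w'. f (v \<otimes>\<^sub>k w) (v' \<otimes>\<^sub>k w') = g (v \<otimes>\<^sub>k w) (v' \<otimes>\<^sub>k w')"
  shows "f t u = g t u"
  by (rule tensor_eqI[OF assms(1) assms(3)], rule tensor_eqI[OF assms(2) assms(4)], rule assms(5))

lemma tmap_tmult:
  assumes "kbilinear m" "kbilinear n" "kbilinear m'" "kbilinear n'" "klinear f" "klinear g"
    and "\<And>a b. f (m a b) = m' (f a) (f b)" "\<And>a b. g (n a b) = n' (g a) (g b)"
  shows "tmap f g (tmult m n t u) = tmult m' n' (tmap f g t) (tmap f g u)"
  by (rule tensor2_eqI[of "\<lambda>t u. tmap f g (tmult m n t u)"])
    (auto intro!: klinear_comp[OF klinear_tmap] klinear_tmult klinear_comp[OF klinear_tmult(1)]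
      klinear_comp[OF klinear_tmult(2) klinear_tmap] klinear_tmap simp: tmult_tensor tmap_tensor assms)

lemma klinear_inv:
  assumes "klinear f" "bij f"
  shows "klinear (inv f)"
  unfolding klinear_iff using assms
  by (auto intro!: inv_f_eq[OF bij_is_inj] simp: klinear_iff bij_is_surj surj_f_inv_f)

text \<open>Bicrossed products are described by coordinates. These two rules evaluate iterated coproducts,
  such as both sides of coassociativity, coordinate by coordinate.\<close>

lemma tmap_slice_left:
  assumes "klinear f" shows "tmap f id t $ (i, j) = f (\<chi> p. t $ (p, j)) $ i"
proof -
  have "tmap f id t $ (i, j) = (\<Sum>p\<in>UNIV. \<Sum>q\<in>UNIV. if q = j then t $ (p, j) * f (axis p 1) $ i else 0)"
    unfolding tmap_nth by (intro sum.cong refl) (auto simp: axis_def)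
  then show ?thesis by (subst klinear_expand[OF assms]) simp
qed

lemma tmap_slice_right:
  assumes "klinear f" shows "tmap id f t $ (i, j) = f (\<chi> q. t $ (i, q)) $ j"
proof -
  have "tmap id f t $ (i, j) = (\<Sum>q\<in>UNIV. \<Sum>p\<in>UNIV. if p = i then t $ (i, q) * f (axis q 1) $ j else 0)"
    unfolding tmap_nth by (subst sum.swap, intro sum.cong refl) (auto simp: axis_def)
  then show ?thesis by (subst klinear_expand[OF assms]) simp
qed

section \<open>Contraction of tensors with linear forms\<close>

text \<open>Contracting \<open>\<Delta> a\<close> with a form \<open>h\<close> gives \<open>h(a\<^sub>2) a\<^sub>1\<close> or \<open>h(a\<^sub>1) a\<^sub>2\<close>, the two actions of the dual
  algebra on a coalgebra. A coaction of a group algebra is the family of contractions with its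
  coefficient forms, and the rules below reduce properties of such coactions to coassociativity.\<close>

definition contract_right :: "('k::field ^ 'c \<Rightarrow> 'k) \<Rightarrow> 'k ^ ('b \<times> 'c) \<Rightarrow> 'k ^ 'b" where
  "contract_right h t = tlift (\<lambda>v w. h w *s v) t"

definition contract_left :: "('k::field ^ 'b \<Rightarrow> 'k) \<Rightarrow> 'k ^ ('b \<times> 'c) \<Rightarrow> 'k ^ 'c" where
  "contract_left h t = tlift (\<lambda>v w. h v *s w) t"

lemma klinear_contract: "klinear (contract_right h)" "klinear (contract_left h)"
  unfolding contract_right_def contract_left_def by (rule klinear_tlift)+

lemma contract_tensor:
  assumes "klinear_form h"
  shows "contract_right h (v \<otimes>\<^sub>k w) = h w *s v" "contract_left h (w \<otimes>\<^sub>k v) = h w *s v"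
  unfolding contract_right_def contract_left_def
  by (rule tlift_tensor; use assms in \<open>auto simp: kbilinear_def klinear_iff klinear_form_iff vec_eq_iff algebra_simps\<close>)+

lemma contract_nth:
  assumes "klinear_form h"
  shows "contract_right h t $ i = h (\<chi> q. t $ (i, q))" "contract_left h t $ j = h (\<chi> p. t $ (p, j))"
proof -
  have "contract_right h t $ i = (\<Sum>q\<in>UNIV. \<Sum>p\<in>UNIV. if p = i then t $ (i, q) * h (axis q 1) else 0)"
    unfolding contract_right_def tlift_def UNIV_Times_UNIV[symmetric] sum.cartesian_product'
    by (simp del: UNIV_Times_UNIV sum.delta sum.delta', subst sum.swap, intro sum.cong refl) (auto simp: axis_def)
  then show "contract_right h t $ i = h (\<chi> q. t $ (i, q))"
    by (subst klinear_form_expand[OF assms]) simp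
  have "contract_left h t $ j = (\<Sum>p\<in>UNIV. \<Sum>q\<in>UNIV. if q = j then t $ (p, j) * h (axis p 1) else 0)"
    unfolding contract_left_def tlift_def UNIV_Times_UNIV[symmetric] sum.cartesian_product'
    by (simp del: UNIV_Times_UNIV sum.delta sum.delta', intro sum.cong refl) (auto simp: axis_def)
  then show "contract_left h t $ j = h (\<chi> p. t $ (p, j))"
    by (subst klinear_form_expand[OF assms]) simp
qed

lemma contract_right_tmap:
  assumes "klinear_form h" "klinear f" "klinear g"
  shows "contract_right h (tmap f g t) = f (contract_right (\<lambda>w. h (g w)) t)"
proof (rule tensor_eqI[of "\<lambda>t. contract_right h (tmap f g t)"])
  have "klinear_form (\<lambda>w. h (g w))" using assms by (auto simp: klinear_form_iff klinear_iff)
  then show "contract_right h (tmap f g (v \<otimes>\<^sub>k w)) = f (contract_right (\<lambda>w. h (g w)) (v \<otimes>\<^sub>k w))" for v w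
    using assms by (simp add: tmap_tensor contract_tensor) (simp add: klinear_iff)
qed (intro klinear_comp[OF klinear_contract(1) klinear_tmap] klinear_comp[OF assms(2) klinear_contract(1)])+

lemma contract_left_tmap:
  assumes "klinear_form h" "klinear f" "klinear g"
  shows "contract_left h (tmap f g t) = g (contract_left (\<lambda>v. h (f v)) t)"
proof (rule tensor_eqI[of "\<lambda>t. contract_left h (tmap f g t)"])
  have "klinear_form (\<lambda>w. h (f w))" using assms by (auto simp: klinear_form_iff klinear_iff)
  then show "contract_left h (tmap f g (v \<otimes>\<^sub>k w)) = g (contract_left (\<lambda>w. h (f w)) (v \<otimes>\<^sub>k w))" for v w
    using assms by (simp add: tmap_tensor contract_tensor) (simp add: klinear_iff)
qed (intro klinear_comp[OF klinear_contract(2) klinear_tmap] klinear_comp[OF assms(3) klinear_contract(2)])+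

lemma contract_right_tassoc:
  assumes "klinear_form h"
  shows "tmap id (contract_right h) (tassoc t) = contract_right h t"
  by (rule tensor3_eqI[of "\<lambda>t. tmap id (contract_right h) (tassoc t)"])
    (auto intro!: klinear_comp[OF klinear_tmap klinear_tassoc] klinear_contract
      simp: tassoc_tensor tmap_tensor klinear_contract contract_tensor assms vec_eq_iff)

lemma contract_middle:
  assumes "klinear_form h"
  shows "tmap id (contract_left h) (tassoc t) = tmap (contract_right h) id t"
  by (rule tensor3_eqI[of "\<lambda>t. tmap id (contract_left h) (tassoc t)"])
    (auto intro!: klinear_comp[OF klinear_tmap klinear_tassoc] klinear_tmap
      simp: tassoc_tensor tmap_tensor klinear_contract contract_tensor assms vec_eq_iff)

section \<open>Isomorphisms\<close>

text \<open>Identities in tensor powers are transported along isomorphisms by cancelling the map on every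
  factor.\<close>

lemma tmap_bij:
  assumes "klinear f" "bij f"
  shows "tmap (inv f) (inv f) (tmap f f t) = t" "tmap f f (tmap (inv f) (inv f) u) = u"
  by (subst tmap_tmap, simp_all add: assms klinear_inv bij_is_inj[OF assms(2)] surj_f_inv_f[OF bij_is_surj[OF assms(2)]] tmap_id)+

lemma hopf_iso_sym:
  assumes "H \<cong>\<^sub>H K" shows "K \<cong>\<^sub>H H"
proof -
  obtain f where f: "hopf_hom H K f" "bij f" using assms by (auto simp: hopf_iso_def)
  define g where "g = inv f"
  have g: "f (g b) = b" "g (f a) = a" for a b
    using f(2) by (auto simp: g_def bij_is_surj surj_f_inv_f bij_is_inj)
  have lin: "klinear f" "klinear g" using f klinear_inv by (auto simp: hopf_hom_def g_def)
  have "comult H (g b) = tmap g g (comult K b)" for b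
  proof -
    have "comult K (f (g b)) = tmap f f (comult H (g b))" using f(1) by (simp add: hopf_hom_def)
    then have "comult K b = tmap f f (comult H (g b))" by (simp add: g)
    then show ?thesis using tmap_bij(1)[OF lin(1) f(2)] by (simp add: g_def)
  qed
  moreover have "g (mul K a b) = mul H (g a) (g b)" for a b
  proof -
    have "f (mul H (g a) (g b)) = mul K a b" using f(1) by (simp add: hopf_hom_def g)
    then show ?thesis by (metis g(2))
  qed
  moreover have "g (unity K) = unity H" "counit H (g a) = counit K a" for a
  proof -
    have "f (unity H) = unity K" "counit K (f (g a)) = counit H (g a)" using f(1) by (simp_all add: hopf_hom_def)
    then show "g (unity K) = unity H" "counit H (g a) = counit K a" using g by (metis, simp)
  qed
  ultimately have "hopf_hom K H g" using lin by (auto simp: hopf_hom_def)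
  then show ?thesis using f(2) bij_imp_bij_inv by (auto simp: hopf_iso_def g_def)
qed

lemma hopf_iso_trans:
  assumes "H \<cong>\<^sub>H K" "K \<cong>\<^sub>H L" shows "H \<cong>\<^sub>H L"
proof -
  obtain f g where f: "hopf_hom H K f" "bij f" and g: "hopf_hom K L g" "bij g"
    using assms by (auto simp: hopf_iso_def)
  have "hopf_hom H L (g \<circ> f)" using f(1) g(1)
    by (auto simp: hopf_hom_def tmap_tmap comp_def klinear_comp)
  then show ?thesis using f g bij_comp by (auto simp: hopf_iso_def)
qed

lemma kbilinear_mul: "algebra_ax H \<Longrightarrow> kbilinear (mul H)"
  by (auto simp: algebra_ax_def kbilinear_def)

section \<open>Bicrossed products in coordinates\<close>

lemma sum_eq_single:
  fixes f :: "'a::finite \<Rightarrow> 'b::comm_monoid_add"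
  assumes "\<And>x. x \<noteq> a \<Longrightarrow> f x = 0"
  shows "(\<Sum>x\<in>UNIV. f x) = f a"
proof -
  have "(\<Sum>x\<in>UNIV. f x) = (\<Sum>x\<in>UNIV. if x = a then f x else 0)"
    using assms by (intro sum.cong) auto
  then show ?thesis by simp
qed

lemma sum_UNIV_prod:
  fixes f :: "'a::finite \<times> 'b::finite \<Rightarrow> 'c::comm_monoid_add"
  shows "(\<Sum>p\<in>UNIV. f p) = (\<Sum>x\<in>UNIV. \<Sum>y\<in>UNIV. f (x, y))"
  by (simp add: sum.cartesian_product' UNIV_Times_UNIV[symmetric] del: UNIV_Times_UNIV)

text \<open>Multiplication by the \<open>e\<^sub>s\<close>, projections to homogeneous components and rescalings of the basis
  are all diagonal maps, so this is how they act on coproducts.\<close>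

lemma tmap_diagonal:
  "tmap (\<lambda>v. \<chi> i. c i * v $ i) (\<lambda>v. \<chi> i. d i * v $ i) t $ (i, j) = c i * d j * t $ (i, j)"
  unfolding tmap_nth by (subst sum_eq_single[of i], (auto simp: axis_def)[], subst sum_eq_single[of j]) (auto simp: axis_def)

text \<open>The hypotheses describe a product whose structure constants, seen from the result, are
  indexed by a finite type of ways to split an index. The conclusion has the same shape, so the lemma
  can be iterated for threefold tensor products.\<close>

lemma tmult_coordinates:
  fixes g h :: "'b::finite \<Rightarrow> 'x::finite \<Rightarrow> 'b" and g' h' :: "'c::finite \<Rightarrow> 'y::finite \<Rightarrow> 'c"
    and m :: "'k::field ^ 'b \<Rightarrow> 'k ^ 'b \<Rightarrow> 'k ^ 'b"
  assumes m: "\<And>a b i. m a b $ i = (\<Sum>x\<in>UNIV. a $ g i x * b $ h i x * c i x)"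
    and n: "\<And>a b j. n a b $ j = (\<Sum>y\<in>UNIV. a $ g' j y * b $ h' j y * c' j y)"
  shows "tmult m n t u $ ij = (\<Sum>p\<in>UNIV. t $ (g (fst ij) (fst p), g' (snd ij) (snd p)) *
    u $ (h (fst ij) (fst p), h' (snd ij) (snd p)) * (c (fst ij) (fst p) * c' (snd ij) (snd p)))"
proof -
  have bil: "kbilinear m" "kbilinear n"
    by (auto simp: kbilinear_def klinear_iff vec_eq_iff m n algebra_simps sum.distrib sum_distrib_left)
  let ?r = "\<lambda>t u. \<chi> ij. (\<Sum>p\<in>UNIV. t $ (g (fst ij) (fst p), g' (snd ij) (snd p)) *
    u $ (h (fst ij) (fst p), h' (snd ij) (snd p)) * (c (fst ij) (fst p) * c' (snd ij) (snd p)))"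
  have "tmult m n t u = ?r t u"
  proof (rule tensor2_eqI[OF klinear_tmult(2) klinear_tmult(1)])
    show "klinear (\<lambda>t. ?r t u)" "klinear (?r t)" for t u
      by (auto simp: klinear_iff vec_eq_iff algebra_simps sum.distrib sum_distrib_left)
    show "tmult m n (v \<otimes>\<^sub>k w) (v' \<otimes>\<^sub>k w') = ?r (v \<otimes>\<^sub>k w) (v' \<otimes>\<^sub>k w')" for v w v' w'
      by (simp add: tmult_tensor[OF bil] vec_eq_iff m n sum_product sum_UNIV_prod)
        (simp add: mult_ac)
  qed
  then show ?thesis by simp
qed

lemma linear_bicrossed_product:
  "kbilinear (mul (bicrossed_product lact ract \<sigma> \<tau>))"
  "klinear (comult (bicrossed_product lact ract \<sigma> \<tau>))"
  "klinear_form (counit (bicrossed_product lact ract \<sigma> \<tau>))"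
proof -
  show "kbilinear (mul (bicrossed_product lact ract \<sigma> \<tau>))"
    by (auto simp: kbilinear_def klinear_iff bicrossed_product_def split_beta algebra_simps
        sum.distrib vec.scale_sum_right vec.scale_left_distrib)
  show "klinear (comult (bicrossed_product lact ract \<sigma> \<tau>))"
    by (auto simp: klinear_iff bicrossed_product_def split_beta algebra_simps
        sum.distrib vec.scale_sum_right[of _ _ UNIV] vec.scale_left_distrib)
  show "klinear_form (counit (bicrossed_product lact ract \<sigma> \<tau>))"
    by (auto simp: klinear_form_iff bicrossed_product_def split_beta sum_distrib_left
        sum.distrib[symmetric] intro!: sum.cong)
qed

lemma bicrossed_unity: "unity (bicrossed_product lact ract \<sigma> \<tau>) $ (s, x) = (if x = 0 then 1 else 0)"
proof -
  have "unity (bicrossed_product lact ract \<sigma> \<tau>) $ (s, x) =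
      (\<Sum>r\<in>UNIV. if r = s then if x = 0 then 1 else 0 else (0::'a::field))"
    unfolding bicrossed_product_def hopf.simps sum_component
    by (intro sum.cong refl) (auto simp: axis_def)
  then show ?thesis by simp
qed

lemma bicrossed_counit: "counit (bicrossed_product lact ract \<sigma> \<tau>) a = (\<Sum>x\<in>UNIV. a $ (0, x))"
  unfolding bicrossed_product_def hopf.simps sum_UNIV_prod by (subst sum.swap) simp

text \<open>\<open>diag2 b\<close> is the element \<open>\<Sum> b s t e\<^sub>s \<otimes> e\<^sub>t\<close> of the tensor square of \<open>k\<^sup>\<Gamma>\<close>.\<close>

definition diag2 :: "('g \<Rightarrow> 'g \<Rightarrow> 'k::field) \<Rightarrow> 'k ^ (('g::finite \<times> 'f::{zero,finite}) \<times> ('g \<times> 'f))" where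
  "diag2 b = (\<chi> p. if snd (fst p) = 0 \<and> snd (snd p) = 0 then b (fst (fst p)) (fst (snd p)) else 0)"

lemma diag2_nth: "diag2 b $ ((s, x), (t, y)) = (if x = 0 \<and> y = 0 then b s t else 0)"
  by (simp add: diag2_def)

text \<open>The pullback to \<open>k\<^sup>\<Gamma> # kF\<close> of the bilinear form on \<open>kF\<close> with matrix \<open>\<alpha>\<close>.\<close>

definition pullback_form :: "('f \<Rightarrow> 'f \<Rightarrow> 'k::field) \<Rightarrow> 'k ^ ('g::{zero,finite} \<times> 'f::finite) \<Rightarrow> 'k ^ ('g \<times> 'f) \<Rightarrow> 'k" where
  "pullback_form \<alpha> a b = (\<Sum>x\<in>UNIV. \<Sum>y\<in>UNIV. a $ (0, x) * b $ (0, y) * \<alpha> x y)"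

lemma bilinear_pullback_form: "bilinear_form (pullback_form \<alpha>)"
  by (auto simp: bilinear_form_def klinear_form_iff pullback_form_def algebra_simps sum.distrib sum_distrib_left)

lemma pullback_form_eq_0:
  "(\<And>x. a $ (0, x) = 0) \<Longrightarrow> pullback_form \<alpha> a b = 0" "(\<And>x. b $ (0, x) = 0) \<Longrightarrow> pullback_form \<alpha> a b = 0"
  by (auto simp: pullback_form_def)

lemma pullback_form_axis:
  "pullback_form \<alpha> (axis (s, x) 1) b = (if s = 0 then \<Sum>y\<in>UNIV. b $ (0, y) * \<alpha> x y else 0)"
  "pullback_form \<alpha> a (axis (t, y) 1) = (if t = 0 then \<Sum>x\<in>UNIV. a $ (0, x) * \<alpha> x y else 0)"
proof -
  have "pullback_form \<alpha> (axis (s, x) 1) b =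
      (\<Sum>z\<in>UNIV. if z = x then if s = 0 then \<Sum>y\<in>UNIV. b $ (0, y) * \<alpha> x y else 0 else 0)"
    unfolding pullback_form_def by (intro sum.cong refl) (auto simp: axis_def)
  then show "pullback_form \<alpha> (axis (s, x) 1) b = (if s = 0 then \<Sum>y\<in>UNIV. b $ (0, y) * \<alpha> x y else 0)"
    by simp
  have "pullback_form \<alpha> a (axis (t, y) 1) =
      (\<Sum>z\<in>UNIV. if z = y then if t = 0 then \<Sum>x\<in>UNIV. a $ (0, x) * \<alpha> x y else 0 else 0)"
    unfolding pullback_form_def by (subst sum.swap, intro sum.cong refl) (auto simp: axis_def)
  then show "pullback_form \<alpha> a (axis (t, y) 1) = (if t = 0 then \<Sum>x\<in>UNIV. a $ (0, x) * \<alpha> x y else 0)"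
    by simp
qed

lemma pullback_form_axis2:
  "pullback_form \<alpha> (axis (s, x) 1) (axis (t, y) 1) = (if s = 0 \<and> t = 0 then \<alpha> x y else 0)"
proof -
  have "pullback_form \<alpha> (axis (s, x) 1) (axis (t, y) 1) =
      (if s = 0 then \<Sum>z\<in>UNIV. if z = y then if t = 0 then \<alpha> x y else 0 else 0 else 0)"
    unfolding pullback_form_axis(1) by (intro if_cong sum.cong refl) (auto simp: axis_def)
  then show ?thesis by simp
qed

context matched_pair begin

lemma bic_tmult:
  fixes \<sigma> :: "'g \<Rightarrow> 'f \<Rightarrow> 'f \<Rightarrow> 'k::field" and \<tau> :: "'f \<Rightarrow> 'g \<Rightarrow> 'g \<Rightarrow> 'k"
  defines "m \<equiv> mul (bicrossed_product (\<triangleright>) (\<triangleleft>) \<sigma> \<tau>)"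
  shows "tmult m m t u $ ((s, z), (r, w)) = (\<Sum>x\<in>UNIV. \<Sum>y\<in>UNIV. t $ ((s, x), (r, y)) *
    u $ ((s \<triangleleft> x, - x + z), (r \<triangleleft> y, - y + w)) * (\<sigma> s x (- x + z) * \<sigma> r y (- y + w)))"
proof -
  let ?g = "\<lambda>i x. (fst i, x)" and ?h = "\<lambda>i x. (fst i \<triangleleft> x, - x + snd i)"
    and ?c = "\<lambda>i x. \<sigma> (fst i) x (- x + snd i)"
  have m: "m a b $ i = (\<Sum>x\<in>UNIV. a $ ?g i x * b $ ?h i x * ?c i x)" for a b and i :: "'g \<times> 'f"
    by (cases i) (simp add: m_def bic_mult)
  show ?thesis using tmult_coordinates[of m ?g ?h ?c m ?g ?h ?c t u "((s, z), (r, w))", OF m m]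
    by (simp add: sum_UNIV_prod)
qed

lemma bic_tmult3:
  fixes \<sigma> :: "'g \<Rightarrow> 'f \<Rightarrow> 'f \<Rightarrow> 'k::field" and \<tau> :: "'f \<Rightarrow> 'g \<Rightarrow> 'g \<Rightarrow> 'k"
  defines "m \<equiv> mul (bicrossed_product (\<triangleright>) (\<triangleleft>) \<sigma> \<tau>)"
  shows "tmult m (tmult m m) t u $ ((s, z), ((r, w), (q, v))) =
    (\<Sum>x\<in>UNIV. \<Sum>y\<in>UNIV. \<Sum>y'\<in>UNIV. t $ ((s, x), ((r, y), (q, y'))) *
    u $ ((s \<triangleleft> x, - x + z), ((r \<triangleleft> y, - y + w), (q \<triangleleft> y', - y' + v))) *
    (\<sigma> s x (- x + z) * (\<sigma> r y (- y + w) * \<sigma> q y' (- y' + v))))"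
proof -
  let ?g = "\<lambda>i x. (fst i, x)" and ?h = "\<lambda>i x. (fst i \<triangleleft> x, - x + snd i)"
    and ?c = "\<lambda>i x. \<sigma> (fst i) x (- x + snd i)"
  have m: "m a b $ i = (\<Sum>x\<in>UNIV. a $ ?g i x * b $ ?h i x * ?c i x)" for a b and i :: "'g \<times> 'f"
    by (cases i) (simp add: m_def bic_mult)
  note mm = tmult_coordinates[of m ?g ?h ?c m ?g ?h ?c, OF m m]
  show ?thesis using tmult_coordinates[of m ?g ?h ?c "tmult m m" "\<lambda>i p. (?g (fst i) (fst p), ?g (snd i) (snd p))"
      "\<lambda>i p. (?h (fst i) (fst p), ?h (snd i) (snd p))" "\<lambda>i p. ?c (fst i) (fst p) * ?c (snd i) (snd p)"
      t u "((s, z), ((r, w), (q, v)))", OF m mm]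
    by (simp add: sum_UNIV_prod)
qed

text \<open>Elements of tensor powers of \<open>k\<^sup>\<Gamma>\<close> act diagonally in the standard basis, but not in the same way on
  both sides: \<open>e\<^sub>s # x\<close> is fixed by \<open>e\<^sub>s\<close> from the left and by \<open>e\<^bsub>s \<triangleleft> x\<^esub>\<close> from the right.\<close>

lemma bic_tmult_diag2:
  fixes \<sigma> :: "'g \<Rightarrow> 'f \<Rightarrow> 'f \<Rightarrow> 'k::field" and \<tau> :: "'f \<Rightarrow> 'g \<Rightarrow> 'g \<Rightarrow> 'k"
  assumes "\<And>s x. \<sigma> s 0 x = 1" "\<And>s x. \<sigma> s x 0 = 1"
  defines "m \<equiv> mul (bicrossed_product (\<triangleright>) (\<triangleleft>) \<sigma> \<tau>)"
  shows "tmult m m (diag2 b) u $ ((s, z), (r, w)) = b s r * u $ ((s, z), (r, w))"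
    and "tmult m m t (diag2 b) $ ((s, z), (r, w)) = t $ ((s, z), (r, w)) * b (s \<triangleleft> z) (r \<triangleleft> w)"
proof -
  show "tmult m m (diag2 b) u $ ((s, z), (r, w)) = b s r * u $ ((s, z), (r, w))"
    unfolding m_def bic_tmult
    by (subst sum_eq_single[of 0], auto simp: diag2_nth, subst sum_eq_single[of 0], auto simp: assms ract_zero)
  have *: "- x + z = 0 \<longleftrightarrow> x = z" for x z :: 'f by (auto simp: add_eq_0_iff)
  show "tmult m m t (diag2 b) $ ((s, z), (r, w)) = t $ ((s, z), (r, w)) * b (s \<triangleleft> z) (r \<triangleleft> w)"
    unfolding m_def bic_tmult
    by (subst sum_eq_single[of z], auto simp: diag2_nth *, subst sum_eq_single[of w], auto simp: assms *)
qed

lemma bic_tmult3_diagonal: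
  fixes \<sigma> :: "'g \<Rightarrow> 'f \<Rightarrow> 'f \<Rightarrow> 'k::field" and \<tau> :: "'f \<Rightarrow> 'g \<Rightarrow> 'g \<Rightarrow> 'k"
  assumes "\<And>s x. \<sigma> s 0 x = 1"
    and t: "\<And>s x r y q z. t $ ((s, x), ((r, y), (q, z))) = (if x = 0 \<and> y = 0 \<and> z = 0 then b s r q else 0)"
  defines "m \<equiv> mul (bicrossed_product (\<triangleright>) (\<triangleleft>) \<sigma> \<tau>)"
  shows "tmult m (tmult m m) t u $ ((s, x), ((r, y), (q, z))) = b s r q * u $ ((s, x), ((r, y), (q, z)))"
  unfolding m_def bic_tmult3
  by (subst sum_eq_single[of 0], auto simp: t, subst sum_eq_single[of 0], auto, subst sum_eq_single[of 0],
      auto simp: assms ract_zero)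

section \<open>Twists of bicrossed products\<close>

text \<open>In \<open>J \<Delta>(e\<^sub>s # x) J\<inverse>\<close> the summand \<open>(e\<^sub>t # u \<triangleright> x) \<otimes> (e\<^sub>u # x)\<close> is multiplied by the value of \<open>b\<close> at its left
  idempotents and divided by the value at its right idempotents.\<close>

lemma comult_twist_bicrossed:
  fixes \<sigma> :: "'g \<Rightarrow> 'f \<Rightarrow> 'f \<Rightarrow> 'k::field" and \<tau> :: "'f \<Rightarrow> 'g \<Rightarrow> 'g \<Rightarrow> 'k"
  assumes "\<And>s x. \<sigma> s 0 x = 1" "\<And>s x. \<sigma> s x 0 = 1"
  shows "comult_twist (bicrossed_product (\<triangleright>) (\<triangleleft>) \<sigma> \<tau>) (diag2 b) (diag2 (\<lambda>s t. inverse (b s t))) =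
    bicrossed_product (\<triangleright>) (\<triangleleft>) \<sigma> (\<lambda>x t u. b t u * \<tau> x t u / b (t \<triangleleft> (u \<triangleright> x)) (u \<triangleleft> x))"
    (is "?L = ?R")
proof (rule hopf.equality)
  have "comult ?L a $ ((t, z), (u, x)) = comult ?R a $ ((t, z), (u, x))" for a t z u x
    by (simp add: comult_twist_def bic_tmult_diag2 assms bic_comult field_simps)
  then show "comult ?L = comult ?R" by (simp add: vec_eq_iff fun_eq_iff)
qed (simp_all add: comult_twist_def bicrossed_product_def)

text \<open>The equation for a twist lives in the third tensor power of \<open>k\<^sup>\<Gamma>\<close>, and its coefficient at
  \<open>e\<^sub>s \<otimes> e\<^sub>t \<otimes> e\<^sub>u\<close> is the cocycle identity.\<close>

lemma is_twist_diag2: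
  fixes \<sigma> :: "'g \<Rightarrow> 'f \<Rightarrow> 'f \<Rightarrow> 'k::field" and \<tau> :: "'f \<Rightarrow> 'g \<Rightarrow> 'g \<Rightarrow> 'k"
  assumes sg: "\<And>s x. \<sigma> s 0 x = 1" "\<And>s x. \<sigma> s x 0 = 1" and ta: "\<And>t u. \<tau> 0 t u = 1"
    and nz: "\<And>s t. b s t \<noteq> 0" and norm: "\<And>s. b 0 s = 1" "\<And>s. b s 0 = 1"
    and cocycle: "\<And>s t u. b (s + t) u * b s t = b s (t + u) * b t u"
  shows "is_twist (bicrossed_product (\<triangleright>) (\<triangleleft>) \<sigma> \<tau>) (diag2 b) (diag2 (\<lambda>s t. inverse (b s t)))"
proof -
  let ?B = "bicrossed_product (\<triangleright>) (\<triangleleft>) \<sigma> \<tau>"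
  let ?m = "mul ?B" and ?u = "unity ?B" and ?J = "diag2 b :: 'k ^ (('g \<times> 'f) \<times> ('g \<times> 'f))"
  let ?mm = "tmult ?m ?m"
  note lin = linear_bicrossed_product[of "(\<triangleright>)" "(\<triangleleft>)" \<sigma> \<tau>]
  have "?mm ?J (diag2 (\<lambda>s t. inverse (b s t))) = ?u \<otimes>\<^sub>k ?u" "?mm (diag2 (\<lambda>s t. inverse (b s t))) ?J = ?u \<otimes>\<^sub>k ?u"
    by (auto simp: vec_eq_iff bic_tmult_diag2 sg diag2_nth bicrossed_unity nz ract_zero)
  moreover have "contract_left (counit ?B) ?J = ?u" "contract_right (counit ?B) ?J = ?u"
    by (auto simp: vec_eq_iff contract_nth lin bicrossed_counit bicrossed_unity diag2_nth norm)
  moreover have "tmult ?m ?mm (?u \<otimes>\<^sub>k ?J) (tmap id (comult ?B) ?J) =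
      tmult ?m ?mm (tassoc (?J \<otimes>\<^sub>k ?u)) (tassoc (tmap (comult ?B) id ?J))"
  proof -
    have "tmult ?m ?mm (?u \<otimes>\<^sub>k ?J) (tmap id (comult ?B) ?J) $ ((s, x), ((t, y), (u, z))) =
       b t u * (tmap id (comult ?B) ?J) $ ((s, x), ((t, y), (u, z)))" for s t u x y z
      by (rule bic_tmult3_diagonal) (auto simp: sg bicrossed_unity diag2_nth)
    moreover have "tmult ?m ?mm (tassoc (?J \<otimes>\<^sub>k ?u)) (tassoc (tmap (comult ?B) id ?J)) $ ((s, x), ((t, y), (u, z))) =
       b s t * tassoc (tmap (comult ?B) id ?J) $ ((s, x), ((t, y), (u, z)))" for s t u x y z
      by (rule bic_tmult3_diagonal) (auto simp: sg bicrossed_unity diag2_nth tassoc_def)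
    ultimately show ?thesis using cocycle
      by (auto simp: vec_eq_iff tassoc_def tmap_slice_left tmap_slice_right lin bic_comult diag2_nth ta zero_lact
          mult.commute)
  qed
  ultimately show ?thesis
    unfolding is_twist_def Let_def contract_left_def contract_right_def by blast
qed

text \<open>A bilinear expression that factors through the projection to \<open>kF\<close> sees the elements \<open>e\<^sub>0 # x\<close>
  alone, and modulo the kernel of the projection these are grouplike.\<close>

lemma bic_tform:
  fixes \<sigma> :: "'g \<Rightarrow> 'f \<Rightarrow> 'f \<Rightarrow> 'k::field" and \<tau> :: "'f \<Rightarrow> 'g \<Rightarrow> 'g \<Rightarrow> 'k"
  assumes "\<And>x. \<tau> x 0 0 = 1"
    and "\<And>s x t y. s \<noteq> 0 \<or> t \<noteq> 0 \<Longrightarrow> \<beta> (axis (s, x) 1) (axis (t, y) 1) = 0"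
  shows "tform \<beta> (comult (bicrossed_product (\<triangleright>) (\<triangleleft>) \<sigma> \<tau>) a) =
    (\<Sum>x\<in>UNIV. a $ (0, x) * \<beta> (axis (0, x) 1) (axis (0, x) 1))"
proof -
  have "tform \<beta> (comult (bicrossed_product (\<triangleright>) (\<triangleleft>) \<sigma> \<tau>) a) = (\<Sum>t::'g\<in>UNIV. \<Sum>z\<in>UNIV. \<Sum>u::'g\<in>UNIV. \<Sum>x\<in>UNIV.
     if u = 0 then if t = 0 then if x = z then a $ (0, x) * \<beta> (axis (0, x) 1) (axis (0, x) 1) else 0 else 0 else 0)"
    unfolding tform_def sum_UNIV_prod fst_conv snd_conv bic_comult
    by (intro sum.cong refl) (auto simp: assms lact_zero)
  also have "\<dots> = (\<Sum>t::'g\<in>UNIV. \<Sum>z\<in>UNIV. \<Sum>u::'g\<in>UNIV. 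
     if u = 0 then if t = 0 then a $ (0, z) * \<beta> (axis (0, z) 1) (axis (0, z) 1) else 0 else 0)"
    by (intro sum.cong refl) auto
  also have "\<dots> = (\<Sum>t::'g\<in>UNIV. \<Sum>z\<in>UNIV. if t = 0 then a $ (0, z) * \<beta> (axis (0, z) 1) (axis (0, z) 1) else 0)"
    by simp
  finally show ?thesis by (subst (asm) sum.swap) simp
qed

text \<open>If the outer legs of \<open>a\<^sub>1 \<otimes> a\<^sub>2 \<otimes> a\<^sub>3\<close> are evaluated by forms that factor through \<open>kF\<close>, as happens
  in a multiplication twist by a pulled-back cocycle, then one term of the iterated coproduct of
  \<open>e\<^sub>u # x\<close> survives. Its outer legs have degrees \<open>u \<triangleright> x\<close> and \<open>x\<close>, the left and the right degree of
  \<open>e\<^sub>u # x\<close>.\<close>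

lemma bic_tlift3:
  fixes \<sigma> :: "'g \<Rightarrow> 'f \<Rightarrow> 'f \<Rightarrow> 'k::field" and \<tau> :: "'f \<Rightarrow> 'g \<Rightarrow> 'g \<Rightarrow> 'k"
    and E :: "'k ^ ('g \<times> 'f) \<Rightarrow> 'k ^ ('g \<times> 'f) \<Rightarrow> 'k ^ ('g \<times> 'f) \<Rightarrow> 'k ^ 'd"
  assumes ta: "\<And>x t. \<tau> x 0 t = 1" "\<And>x t. \<tau> x t 0 = 1"
    and E: "\<And>t z q r. t \<noteq> 0 \<Longrightarrow> E (axis (t, z) 1) q r = 0" "\<And>p q v x. v \<noteq> 0 \<Longrightarrow> E p q (axis (v, x) 1) = 0"
  defines "\<Delta> \<equiv> comult (bicrossed_product (\<triangleright>) (\<triangleleft>) \<sigma> \<tau>)"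
  shows "tlift (\<lambda>p. tlift (E p)) (tmap id \<Delta> (\<Delta> a)) =
    (\<Sum>u\<in>UNIV. \<Sum>x\<in>UNIV. a $ (u, x) *s E (axis (0, u \<triangleright> x) 1) (axis (u, x) 1) (axis (0, x) 1))"
proof -
  let ?e = "\<lambda>u x. a $ (u, x) *s E (axis (0, u \<triangleright> x) 1) (axis (u, x) 1) (axis (0, x) 1)"
  note lin = linear_bicrossed_product[of "(\<triangleright>)" "(\<triangleleft>)" \<sigma> \<tau>]
  have co: "tmap id \<Delta> (\<Delta> a) $ ((t, z), ((u, y), (v, x))) =
      (if y = v \<triangleright> x \<and> z = (u + v) \<triangleright> x then \<tau> x u v * \<tau> x t (u + v) * a $ (t + (u + v), x) else 0)" for t z u y v x
    by (simp add: tmap_slice_right lin \<Delta>_def bic_comult)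
  have "tlift (\<lambda>p. tlift (E p)) (tmap id \<Delta> (\<Delta> a)) =
    (\<Sum>t::'g\<in>UNIV. \<Sum>z\<in>UNIV. \<Sum>u\<in>UNIV. \<Sum>y\<in>UNIV. \<Sum>v::'g\<in>UNIV. \<Sum>x\<in>UNIV.
      if v = 0 then if x = y then if t = 0 then if z = u \<triangleright> y then ?e u y else 0 else 0 else 0 else 0)"
    unfolding tlift_def[of _ "tmap id \<Delta> (\<Delta> a)"] sum_UNIV_prod co fst_conv snd_conv tlift_axis
    by (intro sum.cong refl) (auto simp: ta E lact_zero)
  also have "\<dots> = (\<Sum>t::'g\<in>UNIV. \<Sum>z\<in>UNIV. \<Sum>u\<in>UNIV. \<Sum>y\<in>UNIV. \<Sum>v::'g\<in>UNIV. 
      if v = 0 then if t = 0 then if z = u \<triangleright> y then ?e u y else 0 else 0 else 0)"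
    by (intro sum.cong refl) auto
  also have "\<dots> = (\<Sum>t::'g\<in>UNIV. if t = 0 then \<Sum>z\<in>UNIV. \<Sum>u\<in>UNIV. \<Sum>y\<in>UNIV. if z = u \<triangleright> y then ?e u y else 0 else 0)"
    by (intro sum.cong refl) auto
  also have "\<dots> = (\<Sum>z\<in>UNIV. \<Sum>u\<in>UNIV. \<Sum>y\<in>UNIV. if z = u \<triangleright> y then ?e u y else 0)" by simp
  also have "\<dots> = (\<Sum>u\<in>UNIV. \<Sum>z\<in>UNIV. \<Sum>y\<in>UNIV. if z = u \<triangleright> y then ?e u y else 0)" by (rule sum.swap)
  also have "\<dots> = (\<Sum>u\<in>UNIV. \<Sum>y\<in>UNIV. \<Sum>z\<in>UNIV. if z = u \<triangleright> y then ?e u y else 0)"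
    by (rule sum.cong[OF refl]) (rule sum.swap)
  finally show ?thesis by simp
qed

lemma bic_mul_axis: "mul (bicrossed_product (\<triangleright>) (\<triangleleft>) \<sigma> \<tau>) (axis (s, x) 1) (axis (t, y) 1) =
   (if s \<triangleleft> x = t then \<sigma> s x y *s axis (s, x + y) 1 else 0)"
proof -
  have "mul (bicrossed_product (\<triangleright>) (\<triangleleft>) \<sigma> \<tau>) (axis (s, x) 1) (axis (t, y) 1) $ (r, z) =
    (if s \<triangleleft> x = t then \<sigma> s x y *s axis (s, x + y) 1 else 0) $ (r, z)" for r z
    unfolding bic_mult by (subst sum_eq_single[of x]) (auto simp: axis_def add_eq_0_iff algebra_simps)
  then show ?thesis by (simp add: vec_eq_iff)
qed

lemma mul_mult_twist: "mul (mult_twist B \<kappa> \<kappa>') a b =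
   tlift (\<lambda>a\<^sub>1. tlift (\<lambda>a\<^sub>2 a\<^sub>3. tlift (\<lambda>b\<^sub>1. tlift (\<lambda>b\<^sub>2 b\<^sub>3.
     (\<kappa> a\<^sub>1 b\<^sub>1 * \<kappa>' a\<^sub>3 b\<^sub>3) *s mul B a\<^sub>2 b\<^sub>2)) (tmap id (comult B) (comult B b))))
     (tmap id (comult B) (comult B a))"
  by (simp add: mult_twist_def)

text \<open>Each product \<open>(e\<^sub>s # x)(e\<^bsub>s \<triangleleft> x\<^esub> # y)\<close> is multiplied by \<open>\<alpha>\<close> at the left degrees of the factors and
  divided by \<open>\<alpha>\<close> at their right degrees.\<close>

lemma mult_twist_bicrossed:
  fixes \<sigma> :: "'g \<Rightarrow> 'f \<Rightarrow> 'f \<Rightarrow> 'k::field" and \<tau> :: "'f \<Rightarrow> 'g \<Rightarrow> 'g \<Rightarrow> 'k"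
  assumes ta: "\<And>x t. \<tau> x 0 t = 1" "\<And>x t. \<tau> x t 0 = 1"
  shows "mult_twist (bicrossed_product (\<triangleright>) (\<triangleleft>) \<sigma> \<tau>) (pullback_form \<alpha>) (pullback_form (\<lambda>x y. inverse (\<alpha> x y))) =
    bicrossed_product (\<triangleright>) (\<triangleleft>) (\<lambda>s x y. \<alpha> (s \<triangleright> x) ((s \<triangleleft> x) \<triangleright> y) * \<sigma> s x y / \<alpha> x y) \<tau>"
    (is "?L = ?R")
proof (rule hopf.equality)
  have "mul ?L a b = mul ?R a b" for a b
  proof -
    let ?B = "bicrossed_product (\<triangleright>) (\<triangleleft>) \<sigma> \<tau>"
    let ?k = "pullback_form \<alpha> :: 'k ^ ('g \<times> 'f) \<Rightarrow> _" and ?k' = "pullback_form (\<lambda>x y. inverse (\<alpha> x y)) :: 'k ^ ('g \<times> 'f) \<Rightarrow> _"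
    have inner: "tlift (\<lambda>b1. tlift (\<lambda>b2 b3. (?k p b1 * ?k' r b3) *s mul ?B q b2)) (tmap id (comult ?B) (comult ?B b)) =
      (\<Sum>t\<in>UNIV. \<Sum>y\<in>UNIV. b $ (t, y) *s ((?k p (axis (0, t \<triangleright> y) 1) * ?k' r (axis (0, y) 1)) *s mul ?B q (axis (t, y) 1)))"
      for p q r
      by (rule bic_tlift3[of \<tau>, OF ta]) (auto simp: pullback_form_eq_0 axis_def)
    have "mul ?L a b = (\<Sum>s\<in>UNIV. \<Sum>x\<in>UNIV. a $ (s, x) *s (\<Sum>t\<in>UNIV. \<Sum>y\<in>UNIV. b $ (t, y) *s
       ((?k (axis (0, s \<triangleright> x) 1) (axis (0, t \<triangleright> y) 1) * ?k' (axis (0, x) 1) (axis (0, y) 1)) *s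
         mul ?B (axis (s, x) 1) (axis (t, y) 1))))"
      unfolding mul_mult_twist inner
      by (rule bic_tlift3[of \<tau>, OF ta]) (auto simp: pullback_form_eq_0 axis_def)
    also have "\<dots> = (\<Sum>s\<in>UNIV. \<Sum>x\<in>UNIV. a $ (s, x) *s (\<Sum>t\<in>UNIV. \<Sum>y\<in>UNIV. b $ (t, y) *s
       ((\<alpha> (s \<triangleright> x) (t \<triangleright> y) * inverse (\<alpha> x y)) *s (if s \<triangleleft> x = t then \<sigma> s x y *s axis (s, x + y) 1 else 0))))"
      unfolding pullback_form_axis2 bic_mul_axis by simp
    also have "\<dots> = mul ?R a b"
      unfolding bicrossed_product_def hopf.simps sum_UNIV_prod
      by (auto simp: vec.scale_sum_right algebra_simps divide_inverse intro!: sum.cong)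
    finally show ?thesis .
  qed
  then show "mul ?L = mul ?R" by (simp add: fun_eq_iff)
qed (simp_all add: mult_twist_def bicrossed_product_def)

text \<open>The projection to \<open>kF\<close> is a map of bialgebras, and on \<open>kF\<close>, where the group elements are
  grouplike, a Hopf 2-cocycle is a 2-cocycle of the group. The projection remains such a map after a
  comultiplication twist by an element of \<open>k\<^sup>\<Gamma> \<otimes> k\<^sup>\<Gamma>\<close>, so the two kinds of twist can be combined.\<close>

lemma is_hopf_cocycle_pullback:
  fixes \<sigma> :: "'g \<Rightarrow> 'f \<Rightarrow> 'f \<Rightarrow> 'k::field" and \<tau> :: "'f \<Rightarrow> 'g \<Rightarrow> 'g \<Rightarrow> 'k"
  assumes ta: "\<And>x. \<tau> x 0 0 = 1" and sg: "\<And>x y. \<sigma> 0 x y = 1"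
    and nz: "\<And>x y. \<alpha> x y \<noteq> 0" and norm: "\<And>x. \<alpha> 0 x = 1" "\<And>x. \<alpha> x 0 = 1"
    and cocycle: "\<And>x y z. \<alpha> y z * \<alpha> x (y + z) = \<alpha> x y * \<alpha> (x + y) z"
  shows "is_hopf_cocycle (bicrossed_product (\<triangleright>) (\<triangleleft>) \<sigma> \<tau>) (pullback_form \<alpha>) (pullback_form (\<lambda>x y. inverse (\<alpha> x y)))"
proof -
  let ?B = "bicrossed_product (\<triangleright>) (\<triangleleft>) \<sigma> \<tau>"
  let ?k = "pullback_form \<alpha> :: 'k ^ ('g \<times> 'f) \<Rightarrow> _" and ?k' = "pullback_form (\<lambda>x y. inverse (\<alpha> x y)) :: 'k ^ ('g \<times> 'f) \<Rightarrow> _"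
  have conv: "convolve ?B (pullback_form c) (pullback_form d) a b = counit ?B a * counit ?B b"
    if "\<And>x y. c x y * d x y = 1" for c d a b
  proof -
    have inner: "tform (\<lambda>b1 b2. pullback_form c p b1 * pullback_form d q b2) (comult ?B b) =
      (\<Sum>y\<in>UNIV. b $ (0, y) * (pullback_form c p (axis (0, y) 1) * pullback_form d q (axis (0, y) 1)))" for p q
      by (rule bic_tform[of \<tau>, OF ta]) (auto simp: pullback_form_axis)
    have "convolve ?B (pullback_form c) (pullback_form d) a b = (\<Sum>x\<in>UNIV. a $ (0, x) * (\<Sum>y\<in>UNIV. b $ (0, y) *
        (pullback_form c (axis (0, x) 1 :: 'k ^ ('g \<times> 'f)) (axis (0, y) 1) * pullback_form d (axis (0, x) 1 :: 'k ^ ('g \<times> 'f)) (axis (0, y) 1))))"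
      unfolding convolve_def inner
      by (rule bic_tform[of \<tau>, OF ta]) (auto simp: pullback_form_axis2 pullback_form_eq_0 axis_def intro!: sum.neutral)
    also have "\<dots> = counit ?B a * counit ?B b"
      by (simp add: pullback_form_axis2 that bicrossed_counit sum_distrib_right)
    finally show ?thesis .
  qed
  have "?k (unity ?B) a = counit ?B a" for a
    unfolding pullback_form_def by (subst sum_eq_single[of 0]) (auto simp: bicrossed_unity norm bicrossed_counit)
  moreover have "?k a (unity ?B) = counit ?B a" for a
    unfolding pullback_form_def
    by (subst sum.swap, subst sum_eq_single[of 0]) (auto simp: bicrossed_unity norm bicrossed_counit)
  moreover have "tform (\<lambda>b1 b2. tform (\<lambda>c1 c2. ?k b1 c1 * ?k a (mul ?B b2 c2)) (comult ?B c)) (comult ?B b) =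
      tform (\<lambda>a1 a2. tform (\<lambda>b1 b2. ?k a1 b1 * ?k (mul ?B a2 b2) c) (comult ?B b)) (comult ?B a)" for a b c
  proof -
    have vanish: "(\<And>x. p $ (0, x) = 0) \<Longrightarrow> mul ?B p q $ (0, z) = 0" "(\<And>x. q $ (0, x) = 0) \<Longrightarrow> mul ?B p q $ (0, z) = 0" for p q z
      by (auto simp: bic_mult zero_ract)
    have "tform (\<lambda>c1 c2. ?k p c1 * ?k a (mul ?B q c2)) (comult ?B c) =
        (\<Sum>y\<in>UNIV. c $ (0, y) * (?k p (axis (0, y) 1) * ?k a (mul ?B q (axis (0, y) 1))))" for p q
      by (rule bic_tform[of \<tau>, OF ta]) (auto simp: pullback_form_axis pullback_form_eq_0 vanish axis_def)
    then have "tform (\<lambda>b1 b2. tform (\<lambda>c1 c2. ?k b1 c1 * ?k a (mul ?B b2 c2)) (comult ?B c)) (comult ?B b) =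
        (\<Sum>x\<in>UNIV. b $ (0, x) * (\<Sum>y\<in>UNIV. c $ (0, y) * (?k (axis (0, x) 1) (axis (0, y) 1) *
           ?k a (mul ?B (axis (0, x) 1) (axis (0, y) 1)))))"
      by simp (rule bic_tform[of \<tau>, OF ta], auto simp: pullback_form_eq_0 vanish axis_def intro!: sum.neutral)
    also have "\<dots> = (\<Sum>x\<in>UNIV. \<Sum>y\<in>UNIV. \<Sum>w\<in>UNIV. a $ (0, w) * b $ (0, x) * c $ (0, y) * (\<alpha> x y * \<alpha> w (x + y)))"
      by (simp add: pullback_form_axis2 bic_mul_axis zero_ract sg) (simp add: pullback_form_axis sum_distrib_left algebra_simps)
    finally have lhs: "tform (\<lambda>b1 b2. tform (\<lambda>c1 c2. ?k b1 c1 * ?k a (mul ?B b2 c2)) (comult ?B c)) (comult ?B b) = \<dots>" .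
    have "tform (\<lambda>b1 b2. ?k p b1 * ?k (mul ?B q b2) c) (comult ?B b) =
        (\<Sum>x\<in>UNIV. b $ (0, x) * (?k p (axis (0, x) 1) * ?k (mul ?B q (axis (0, x) 1)) c))" for p q
      by (rule bic_tform[of \<tau>, OF ta]) (auto simp: pullback_form_axis pullback_form_eq_0 vanish axis_def)
    then have "tform (\<lambda>a1 a2. tform (\<lambda>b1 b2. ?k a1 b1 * ?k (mul ?B a2 b2) c) (comult ?B b)) (comult ?B a) =
        (\<Sum>w\<in>UNIV. a $ (0, w) * (\<Sum>x\<in>UNIV. b $ (0, x) * (?k (axis (0, w) 1) (axis (0, x) 1) *
           ?k (mul ?B (axis (0, w) 1) (axis (0, x) 1)) c)))"
      by simp (rule bic_tform[of \<tau>, OF ta], auto simp: pullback_form_eq_0 vanish axis_def intro!: sum.neutral)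
    also have "\<dots> = (\<Sum>w\<in>UNIV. \<Sum>x\<in>UNIV. \<Sum>y\<in>UNIV. a $ (0, w) * b $ (0, x) * c $ (0, y) * (\<alpha> w x * \<alpha> (w + x) y))"
      by (simp add: pullback_form_axis2 bic_mul_axis zero_ract sg) (simp add: pullback_form_axis sum_distrib_left algebra_simps)
    also have "\<dots> = (\<Sum>x\<in>UNIV. \<Sum>w\<in>UNIV. \<Sum>y\<in>UNIV. a $ (0, w) * b $ (0, x) * c $ (0, y) * (\<alpha> w x * \<alpha> (w + x) y))"
      by (rule sum.swap)
    also have "\<dots> = (\<Sum>x\<in>UNIV. \<Sum>y\<in>UNIV. \<Sum>w\<in>UNIV. a $ (0, w) * b $ (0, x) * c $ (0, y) * (\<alpha> w x * \<alpha> (w + x) y))"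
      by (rule sum.cong[OF refl], rule sum.swap)
    finally show ?thesis unfolding lhs by (simp add: cocycle)
  qed
  ultimately show ?thesis
    unfolding is_hopf_cocycle_def using bilinear_pullback_form by (auto simp: conv nz)
qed

text \<open>Coboundaries do not change the isomorphism class: the isomorphism sends \<open>e\<^sub>s # x\<close> to \<open>c s x (e\<^sub>s # x)\<close>,
  and the normalization of \<open>c\<close> makes it preserve unit and counit.\<close>

lemma bicrossed_rescale:
  fixes \<sigma> :: "'g \<Rightarrow> 'f \<Rightarrow> 'f \<Rightarrow> 'k::field" and \<tau> :: "'f \<Rightarrow> 'g \<Rightarrow> 'g \<Rightarrow> 'k"
  assumes nz: "\<And>s x. c s x \<noteq> 0" and norm: "\<And>s. c s 0 = 1" "\<And>x. c 0 x = 1"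
    and sg: "\<And>s x y. \<sigma>' s x y = \<sigma> s x y * (c s x * c (s \<triangleleft> x) y / c s (x + y))"
    and ta: "\<And>x t u. \<tau>' x t u = \<tau> x t u * (c (t + u) x / (c t (u \<triangleright> x) * c u x))"
  shows "bicrossed_product (\<triangleright>) (\<triangleleft>) \<sigma>' \<tau>' \<cong>\<^sub>H bicrossed_product (\<triangleright>) (\<triangleleft>) \<sigma> \<tau>" (is "?B' \<cong>\<^sub>H ?B")
proof -
  define f where "f = (\<lambda>v :: 'k ^ ('g \<times> 'f). \<chi> p. c (fst p) (snd p) * v $ p)"
  define f' where "f' = (\<lambda>v :: 'k ^ ('g \<times> 'f). \<chi> p. v $ p / c (fst p) (snd p))"
  have f: "f v $ (s, x) = c s x * v $ (s, x)" for v s x by (simp add: f_def)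
  have "f (f' v) = v" "f' (f v) = v" for v by (auto simp: f_def f'_def vec_eq_iff nz)
  then have "bij f" by (metis bijI')
  moreover have "hopf_hom ?B' ?B f"
    unfolding hopf_hom_def
  proof (intro conjI allI)
    show "klinear f" by (auto simp: klinear_iff f_def vec_eq_iff algebra_simps)
    show "f (mul ?B' a b) = mul ?B (f a) (f b)" for a b
    proof -
      have "f (mul ?B' a b) $ (s, z) = mul ?B (f a) (f b) $ (s, z)" for s z
        unfolding f bic_mult sum_distrib_left by (intro sum.cong refl) (simp add: sg nz field_simps)
      then show ?thesis by (simp add: vec_eq_iff)
    qed
    show "f (unity ?B') = unity ?B" by (auto simp: vec_eq_iff f bicrossed_unity norm)
    show "comult ?B (f a) = tmap f f (comult ?B' a)" for a
      by (auto simp: vec_eq_iff f_def tmap_diagonal bic_comult ta nz)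
    show "counit ?B (f a) = counit ?B' a" for a by (simp add: bicrossed_counit f norm)
  qed
  ultimately show ?thesis by (auto simp: hopf_iso_def)
qed

end

section \<open>Averaging cocycles of a matched pair\<close>

definition group_cocycle :: "('h::group_add \<Rightarrow> 'h \<Rightarrow> 'k::field) \<Rightarrow> bool" where
  "group_cocycle a \<longleftrightarrow> (\<forall>x y. a x y \<noteq> 0) \<and> (\<forall>x. a 0 x = 1) \<and> (\<forall>x. a x 0 = 1) \<and>
     (\<forall>x y z. a x y * a (x + y) z = a y z * a x (y + z))"

lemma group_cocycle_mult:
  assumes "group_cocycle a" "group_cocycle a'"
  shows "group_cocycle (\<lambda>x y. a x y * a' x y)"
proof -
  have "a x y * a' x y * (a (x + y) z * a' (x + y) z) = a y z * a' y z * (a x (y + z) * a' x (y + z))" for x y z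
  proof -
    have "(a x y * a (x + y) z) * (a' x y * a' (x + y) z) = (a y z * a x (y + z)) * (a' y z * a' x (y + z))"
      using assms by (simp add: group_cocycle_def)
    then show ?thesis by (simp add: mult_ac)
  qed
  then show ?thesis using assms by (simp add: group_cocycle_def)
qed

lemma group_cocycle_powi: "group_cocycle a \<Longrightarrow> group_cocycle (\<lambda>x y. a x y powi n)"
  by (simp add: group_cocycle_def power_int_mult_distrib[symmetric])

context matched_pair begin

lemma prod_shift:
  "(\<Prod>y\<in>UNIV. h (x + y)) = (\<Prod>y\<in>UNIV. h (y :: 'f))"
  "(\<Prod>t\<in>UNIV. h' (t + u)) = (\<Prod>t\<in>UNIV. h' (t :: 'g))"
  "(\<Prod>x\<in>UNIV. h (u \<triangleright> x)) = (\<Prod>x\<in>UNIV. h x)"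
  "(\<Prod>s\<in>UNIV. h' (s \<triangleleft> x)) = (\<Prod>s\<in>UNIV. h' s)"
proof -
  show "(\<Prod>y\<in>UNIV. h (x + y)) = (\<Prod>y\<in>UNIV. h (y :: 'f))"
    by (rule prod.reindex_bij_witness[of _ "\<lambda>y. - x + y" "\<lambda>y. x + y"]) (auto simp: add.assoc[symmetric])
  show "(\<Prod>t\<in>UNIV. h' (t + u)) = (\<Prod>t\<in>UNIV. h' (t :: 'g))"
    by (rule prod.reindex_bij_witness[of _ "\<lambda>t. t - u" "\<lambda>t. t + u"]) auto
  show "(\<Prod>x\<in>UNIV. h (u \<triangleright> x)) = (\<Prod>x\<in>UNIV. h x)"
    by (rule prod.reindex_bij_witness[of _ "\<lambda>x. (- u) \<triangleright> x" "\<lambda>x. u \<triangleright> x"])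
      (auto simp: lact_add[symmetric] lact_zero)
  show "(\<Prod>s\<in>UNIV. h' (s \<triangleleft> x)) = (\<Prod>s\<in>UNIV. h' s)"
    by (rule prod.reindex_bij_witness[of _ "\<lambda>s. s \<triangleleft> (- x)" "\<lambda>s. s \<triangleleft> x"])
      (auto simp: ract_add[symmetric] ract_zero)
qed

text \<open>The conditions on \<open>(\<sigma>, \<tau>)\<close> under which the bicrossed product is a Hopf algebra with the
  standard unit and counit: \<open>\<sigma>\<close> gives an associative product, \<open>\<tau>\<close> a coassociative coproduct, and the
  last condition makes the coproduct multiplicative.\<close>

definition kac_cocycle :: "('g \<Rightarrow> 'f \<Rightarrow> 'f \<Rightarrow> 'k::field) \<Rightarrow> ('f \<Rightarrow> 'g \<Rightarrow> 'g \<Rightarrow> 'k) \<Rightarrow> bool" where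
  "kac_cocycle \<sigma> \<tau> \<longleftrightarrow>
     (\<forall>s x y. \<sigma> s x y \<noteq> 0) \<and> (\<forall>x t u. \<tau> x t u \<noteq> 0) \<and>
     (\<forall>s x. \<sigma> s 0 x = 1) \<and> (\<forall>s x. \<sigma> s x 0 = 1) \<and> (\<forall>x y. \<sigma> 0 x y = 1) \<and>
     (\<forall>x t. \<tau> x 0 t = 1) \<and> (\<forall>x t. \<tau> x t 0 = 1) \<and> (\<forall>t u. \<tau> 0 t u = 1) \<and>
     (\<forall>s x y z. \<sigma> s x y * \<sigma> s (x + y) z = \<sigma> (s \<triangleleft> x) y z * \<sigma> s x (y + z)) \<and>
     (\<forall>x s t u. \<tau> x (s + t) u * \<tau> (u \<triangleright> x) s t = \<tau> x s (t + u) * \<tau> x t u) \<and>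
     (\<forall>t u x y. \<sigma> (t + u) x y * \<tau> (x + y) t u =
        \<tau> x t u * \<tau> y (t \<triangleleft> (u \<triangleright> x)) (u \<triangleleft> x) * (\<sigma> t (u \<triangleright> x) ((u \<triangleleft> x) \<triangleright> y) * \<sigma> u x y))"

text \<open>\<open>(\<sigma>, \<tau>)\<close> is the pair obtained by twisting the split extension with group cocycles \<open>\<alpha>\<close> of \<open>F\<close>
  and \<open>\<beta>\<close> of \<open>\<Gamma>\<close>, up to the coboundary of \<open>c\<close>. This is the image of \<open>(\<alpha>, \<beta>)\<close> under the map
  \<open>H\<^sup>2(F, k\<^sup>\<times>) \<oplus> H\<^sup>2(\<Gamma>, k\<^sup>\<times>) \<rightarrow> Opext\<close> of the Kac exact sequence.\<close>

definition edge_image ::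
  "('f \<Rightarrow> 'f \<Rightarrow> 'k::field) \<Rightarrow> ('g \<Rightarrow> 'g \<Rightarrow> 'k) \<Rightarrow> ('g \<Rightarrow> 'f \<Rightarrow> 'k)
    \<Rightarrow> ('g \<Rightarrow> 'f \<Rightarrow> 'f \<Rightarrow> 'k) \<Rightarrow> ('f \<Rightarrow> 'g \<Rightarrow> 'g \<Rightarrow> 'k) \<Rightarrow> bool" where
  "edge_image \<alpha> \<beta> c \<sigma> \<tau> \<longleftrightarrow> group_cocycle \<alpha> \<and> group_cocycle \<beta> \<and>
     (\<forall>s x. c s x \<noteq> 0) \<and> (\<forall>s. c s 0 = 1) \<and> (\<forall>x. c 0 x = 1) \<and>
     (\<forall>s x y. \<sigma> s x y = \<alpha> (s \<triangleright> x) ((s \<triangleleft> x) \<triangleright> y) / \<alpha> x y * (c s (x + y) / (c s x * c (s \<triangleleft> x) y))) \<and>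
     (\<forall>x t u. \<tau> x t u = \<beta> t u / \<beta> (t \<triangleleft> (u \<triangleright> x)) (u \<triangleleft> x) * (c t (u \<triangleright> x) * c u x / c (t + u) x))"

lemma edge_image_mult:
  assumes "edge_image \<alpha> \<beta> c \<sigma> \<tau>" "edge_image \<alpha>' \<beta>' c' \<sigma>' \<tau>'"
  shows "edge_image (\<lambda>x y. \<alpha> x y * \<alpha>' x y) (\<lambda>s t. \<beta> s t * \<beta>' s t) (\<lambda>s x. c s x * c' s x)
    (\<lambda>s x y. \<sigma> s x y * \<sigma>' s x y) (\<lambda>x t u. \<tau> x t u * \<tau>' x t u)"
  using assms by (simp add: edge_image_def group_cocycle_mult mult_ac)

lemma edge_image_powi:
  assumes "edge_image \<alpha> \<beta> c \<sigma> \<tau>"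
  shows "edge_image (\<lambda>x y. \<alpha> x y powi n) (\<lambda>s t. \<beta> s t powi n) (\<lambda>s x. c s x powi n)
    (\<lambda>s x y. \<sigma> s x y powi n) (\<lambda>x t u. \<tau> x t u powi n)"
  using assms by (simp add: edge_image_def group_cocycle_powi power_int_mult_distrib power_int_divide_distrib)

text \<open>\<open>\<sigma>\<close> is a 2-cocycle on \<open>F\<close> with values in the functions on \<open>\<Gamma>\<close>, so multiplying
  over the last argument shows that \<open>\<sigma>\<close> to the power \<open>|F|\<close> is a coboundary. Once \<open>\<sigma>\<close> is trivial,
  the compatibility condition says that \<open>\<tau>\<close> is a 1-cocycle on \<open>F\<close> with values in the functions on
  \<open>\<Gamma> \<times> \<Gamma>\<close>; raising to the power \<open>|F|\<close> again makes it the coboundary of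
  \<open>\<Prod>y. \<tau> y\<close>, and since \<open>\<triangleright>\<close> permutes \<open>F\<close>, this product is an ordinary 2-cocycle of \<open>\<Gamma>\<close>.\<close>

lemma kac_cocycle_power_F:
  fixes \<sigma> :: "'g \<Rightarrow> 'f \<Rightarrow> 'f \<Rightarrow> 'k::field"
  assumes K: "kac_cocycle \<sigma> \<tau>"
  shows "\<exists>\<beta> c. edge_image (\<lambda>_ _. 1) \<beta> c (\<lambda>s x y. \<sigma> s x y ^ (CARD('f) * CARD('f))) (\<lambda>x t u. \<tau> x t u ^ (CARD('f) * CARD('f)))"
proof -
  let ?m = "CARD('f)"
  define N where "N s x = (\<Prod>z\<in>UNIV. \<sigma> s x z)" for s x
  have nz: "\<sigma> s x y \<noteq> 0" "\<tau> x t u \<noteq> 0" "N s x \<noteq> 0" for s x y t u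
    using K by (auto simp: kac_cocycle_def N_def)
  have sg: "\<sigma> s x y ^ ?m = N s x * N (s \<triangleleft> x) y / N s (x + y)" for s x y
  proof -
    have "(\<Prod>z\<in>UNIV. \<sigma> s x y * \<sigma> s (x + y) z) = (\<Prod>z\<in>UNIV. \<sigma> (s \<triangleleft> x) y z * \<sigma> s x (y + z))"
      using K by (simp add: kac_cocycle_def)
    then have "\<sigma> s x y ^ ?m * N s (x + y) = N (s \<triangleleft> x) y * N s x"
      by (simp add: prod.distrib prod_shift N_def)
    then show ?thesis by (simp add: nz field_simps)
  qed
  \<comment> \<open>\<open>T\<close> is what becomes of \<open>\<tau>\<close> to the power \<open>|F|\<close> when the basis is rescaled so that \<open>\<sigma>\<close> to the power \<open>|F|\<close> becomes \<open>1\<close>.\<close>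
  define T where "T x t u = \<tau> x t u ^ ?m * (N t (u \<triangleright> x) * N u x / N (t + u) x)" for x t u
  have T_nz: "T x t u \<noteq> 0" for x t u by (simp add: T_def nz)
  have T_F: "T (x + y) t u = T x t u * T y (t \<triangleleft> (u \<triangleright> x)) (u \<triangleleft> x)" for x y t u
  proof -
    have "(\<sigma> (t + u) x y * \<tau> (x + y) t u) ^ ?m =
        (\<tau> x t u * \<tau> y (t \<triangleleft> (u \<triangleright> x)) (u \<triangleleft> x) * (\<sigma> t (u \<triangleright> x) ((u \<triangleleft> x) \<triangleright> y) * \<sigma> u x y)) ^ ?m"
      using K by (simp add: kac_cocycle_def)
    then show ?thesis
      unfolding power_mult_distrib sg T_def lact_mult[symmetric] ract_mult by (simp add: nz field_simps)
  qed
  have T_\<Gamma>: "T x (s + t) u * T (u \<triangleright> x) s t = T x s (t + u) * T x t u" for x s t u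
  proof -
    have "(\<tau> x (s + t) u * \<tau> (u \<triangleright> x) s t) ^ ?m = (\<tau> x s (t + u) * \<tau> x t u) ^ ?m"
      using K by (simp add: kac_cocycle_def)
    then have "\<tau> x (s + t) u ^ ?m * \<tau> (u \<triangleright> x) s t ^ ?m = \<tau> x s (t + u) ^ ?m * \<tau> x t u ^ ?m"
      unfolding power_mult_distrib .
    then show ?thesis unfolding T_def
      by (simp add: nz field_simps lact_add add.assoc)
  qed
  define b where "b t u = (\<Prod>y\<in>UNIV. T y t u)" for t u
  have b_nz: "b t u \<noteq> 0" for t u by (simp add: b_def T_nz)
  have b: "T x t u ^ ?m = b t u / b (t \<triangleleft> (u \<triangleright> x)) (u \<triangleleft> x)" for x t u
  proof -
    have "(\<Prod>y\<in>UNIV. T (x + y) t u) = (\<Prod>y\<in>UNIV. T x t u * T y (t \<triangleleft> (u \<triangleright> x)) (u \<triangleleft> x))"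
      by (simp add: T_F)
    then have "b t u = T x t u ^ ?m * b (t \<triangleleft> (u \<triangleright> x)) (u \<triangleleft> x)"
      by (simp add: prod.distrib b_def prod_shift(1)[where h = "\<lambda>y. T y t u"])
    then show ?thesis by (simp add: b_nz)
  qed
  have N1: "N s 0 = 1" "N 0 x = 1" for s x using K by (simp_all add: N_def kac_cocycle_def)
  have "group_cocycle b"
    unfolding group_cocycle_def
  proof (intro conjI allI b_nz)
    show "b 0 t = 1" "b t 0 = 1" for t
      using K by (simp_all add: b_def T_def N1 nz kac_cocycle_def lact_zero)
    show "b s t * b (s + t) u = b t u * b s (t + u)" for s t u
    proof -
      have "(\<Prod>x\<in>UNIV. T x (s + t) u * T (u \<triangleright> x) s t) = (\<Prod>x\<in>UNIV. T x s (t + u) * T x t u)"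
        by (simp add: T_\<Gamma>)
      then show ?thesis by (simp add: prod.distrib b_def prod_shift(3)[where h = "\<lambda>x. T x s t"] mult.commute)
    qed
  qed
  moreover have "group_cocycle (\<lambda>_ _ :: 'f. 1 :: 'k)" by (simp add: group_cocycle_def)
  moreover have "\<sigma> s x y ^ (?m * ?m) = inverse (N s (x + y)) ^ ?m / (inverse (N s x) ^ ?m * inverse (N (s \<triangleleft> x) y) ^ ?m)" for s x y
    unfolding power_mult sg by (simp add: field_simps power_mult_distrib nz power_divide)
  moreover have "\<tau> x t u ^ (?m * ?m) = b t u / b (t \<triangleleft> (u \<triangleright> x)) (u \<triangleleft> x) *
      (inverse (N t (u \<triangleright> x)) ^ ?m * inverse (N u x) ^ ?m / inverse (N (t + u) x) ^ ?m)" for x t u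
  proof -
    have "(z * (p * q / r)) ^ ?m * (inverse p ^ ?m * inverse q ^ ?m / inverse r ^ ?m) = z ^ ?m"
      if "p \<noteq> 0" "q \<noteq> 0" "r \<noteq> 0" for z p q r :: 'k
      using that by (simp add: power_mult_distrib power_divide power_inverse field_simps)
    then show ?thesis unfolding power_mult b[symmetric] T_def by (simp add: nz)
  qed
  ultimately have "edge_image (\<lambda>_ _. 1) b (\<lambda>s x. inverse (N s x) ^ ?m)
      (\<lambda>s x y. \<sigma> s x y ^ (?m * ?m)) (\<lambda>x t u. \<tau> x t u ^ (?m * ?m))"
    by (simp add: edge_image_def nz N1)
  then show ?thesis by blast
qed

text \<open>The same argument with the roles of \<open>F\<close> and \<open>\<Gamma>\<close> exchanged: \<open>\<tau>\<close> is trivialized first and then the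
  remaining 1-cocycle \<open>S\<close> of \<open>\<Gamma>\<close> is averaged. The 2-cocycle of \<open>F\<close> is the inverse of the resulting product,
  because averaging puts the right degrees into the numerator, whereas twisting by \<open>\<alpha>\<close> puts the left
  degrees there.\<close>

lemma kac_cocycle_power_\<Gamma>:
  fixes \<sigma> :: "'g \<Rightarrow> 'f \<Rightarrow> 'f \<Rightarrow> 'k::field"
  assumes K: "kac_cocycle \<sigma> \<tau>"
  shows "\<exists>\<alpha> c. edge_image \<alpha> (\<lambda>_ _. 1) c (\<lambda>s x y. \<sigma> s x y ^ (CARD('g) * CARD('g))) (\<lambda>x t u. \<tau> x t u ^ (CARD('g) * CARD('g)))"
proof -
  let ?n = "CARD('g)"
  define M where "M x s = (\<Prod>r\<in>UNIV. \<tau> x r s)" for x s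
  have nz: "\<sigma> s x y \<noteq> 0" "\<tau> x t u \<noteq> 0" "M x s \<noteq> 0" for s x y t u
    using K by (auto simp: kac_cocycle_def M_def)
  have ta: "\<tau> x t u ^ ?n = M (u \<triangleright> x) t * M x u / M x (t + u)" for x t u
  proof -
    have "(\<Prod>s\<in>UNIV. \<tau> x (s + t) u * \<tau> (u \<triangleright> x) s t) = (\<Prod>s\<in>UNIV. \<tau> x s (t + u) * \<tau> x t u)"
      using K by (simp add: kac_cocycle_def)
    then have "M x u * M (u \<triangleright> x) t = M x (t + u) * \<tau> x t u ^ ?n"
      by (simp add: prod.distrib M_def prod_shift(2)[where h' = "\<lambda>s. \<tau> x s u"])
    then show ?thesis by (simp add: nz field_simps)
  qed
  \<comment> \<open>\<open>S\<close> is what becomes of \<open>\<sigma>\<close> to the power \<open>|\<Gamma>|\<close> when the basis is rescaled so that \<open>\<tau>\<close> to the power \<open>|\<Gamma>|\<close> becomes \<open>1\<close>.\<close>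
  define S where "S s x y = \<sigma> s x y ^ ?n * (M x s * M y (s \<triangleleft> x) / M (x + y) s)" for s x y
  have S_nz: "S s x y \<noteq> 0" for s x y by (simp add: S_def nz)
  have S_\<Gamma>: "S (t + u) x y = S t (u \<triangleright> x) ((u \<triangleleft> x) \<triangleright> y) * S u x y" for x y t u
  proof -
    have "(\<sigma> (t + u) x y * \<tau> (x + y) t u) ^ ?n =
        (\<tau> x t u * \<tau> y (t \<triangleleft> (u \<triangleright> x)) (u \<triangleleft> x) * (\<sigma> t (u \<triangleright> x) ((u \<triangleleft> x) \<triangleright> y) * \<sigma> u x y)) ^ ?n"
      using K by (simp add: kac_cocycle_def)
    then show ?thesis
      unfolding power_mult_distrib ta S_def lact_mult[symmetric] ract_mult by (simp add: nz field_simps)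
  qed
  have S_F: "S s x y * S s (x + y) z = S (s \<triangleleft> x) y z * S s x (y + z)" for s x y z
  proof -
    have "(\<sigma> s x y * \<sigma> s (x + y) z) ^ ?n = (\<sigma> (s \<triangleleft> x) y z * \<sigma> s x (y + z)) ^ ?n"
      using K by (simp add: kac_cocycle_def)
    then have "\<sigma> s x y ^ ?n * \<sigma> s (x + y) z ^ ?n = \<sigma> (s \<triangleleft> x) y z ^ ?n * \<sigma> s x (y + z) ^ ?n"
      unfolding power_mult_distrib .
    then show ?thesis unfolding S_def
      by (simp add: nz field_simps ract_add add.assoc)
  qed
  define a where "a x y = (\<Prod>t\<in>UNIV. S t x y)" for x y
  have a_nz: "a x y \<noteq> 0" for x y by (simp add: a_def S_nz)
  have a: "S s x y ^ ?n = a x y / a (s \<triangleright> x) ((s \<triangleleft> x) \<triangleright> y)" for s x y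
  proof -
    have "(\<Prod>t\<in>UNIV. S (t + s) x y) = (\<Prod>t\<in>UNIV. S t (s \<triangleright> x) ((s \<triangleleft> x) \<triangleright> y) * S s x y)"
      by (simp add: S_\<Gamma>)
    then have "a x y = a (s \<triangleright> x) ((s \<triangleleft> x) \<triangleright> y) * S s x y ^ ?n"
      by (simp add: prod.distrib a_def prod_shift(2)[where h' = "\<lambda>t. S t x y"])
    then show ?thesis by (simp add: a_nz)
  qed
  have M1: "M 0 s = 1" "M x 0 = 1" for s x using K by (simp_all add: M_def kac_cocycle_def)
  have "group_cocycle (\<lambda>x y. inverse (a x y))"
    unfolding group_cocycle_def
  proof (intro conjI allI)
    show "inverse (a 0 x) = 1" "inverse (a x 0) = 1" for x
      using K by (simp_all add: a_def S_def M1 nz kac_cocycle_def ract_zero)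
    show "inverse (a x y) * inverse (a (x + y) z) = inverse (a y z) * inverse (a x (y + z))" for x y z
    proof -
      have "(\<Prod>s\<in>UNIV. S s x y * S s (x + y) z) = (\<Prod>s\<in>UNIV. S (s \<triangleleft> x) y z * S s x (y + z))"
        by (simp add: S_F)
      then have "a x y * a (x + y) z = a y z * a x (y + z)"
        by (simp add: prod.distrib a_def prod_shift(4)[where h' = "\<lambda>s. S s y z"])
      then show ?thesis by (metis inverse_mult_distrib)
    qed
  qed (simp add: a_nz)
  moreover have "group_cocycle (\<lambda>_ _ :: 'g. 1 :: 'k)" by (simp add: group_cocycle_def)
  moreover have "\<tau> x t u ^ (?n * ?n) = M (u \<triangleright> x) t ^ ?n * M x u ^ ?n / M x (t + u) ^ ?n" for x t u
    unfolding power_mult ta by (simp add: power_mult_distrib power_divide)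
  moreover have "\<sigma> s x y ^ (?n * ?n) = inverse (a (s \<triangleright> x) ((s \<triangleleft> x) \<triangleright> y)) / inverse (a x y) *
      (M (x + y) s ^ ?n / (M x s ^ ?n * M y (s \<triangleleft> x) ^ ?n))" for s x y
  proof -
    have "\<sigma> s x y ^ (?n * ?n) = a x y / a (s \<triangleright> x) ((s \<triangleleft> x) \<triangleright> y) * (M (x + y) s ^ ?n / (M x s ^ ?n * M y (s \<triangleleft> x) ^ ?n))"
    proof -
      have "(z * (p * q / r)) ^ ?n * (r ^ ?n / (p ^ ?n * q ^ ?n)) = z ^ ?n"
        if "p \<noteq> 0" "q \<noteq> 0" "r \<noteq> 0" for z p q r :: 'k
        using that by (simp add: power_mult_distrib power_divide)
      then show ?thesis unfolding power_mult a[symmetric] S_def by (simp add: nz)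
    qed
    then show ?thesis by (simp add: field_simps)
  qed
  ultimately have "edge_image (\<lambda>x y. inverse (a x y)) (\<lambda>_ _. 1) (\<lambda>s x. M x s ^ ?n)
      (\<lambda>s x y. \<sigma> s x y ^ (?n * ?n)) (\<lambda>x t u. \<tau> x t u ^ (?n * ?n))"
    by (simp add: edge_image_def nz M1)
  then show ?thesis by blast
qed

text \<open>Pairs in the image are closed under products and integer powers, and the image contains the
  powers \<open>|F|\<^sup>2\<close> and \<open>|\<Gamma>|\<^sup>2\<close> of \<open>(\<sigma>, \<tau>)\<close>. A Bezout relation recovers \<open>(\<sigma>, \<tau>)\<close>.\<close>

lemma kac_cocycle_edge_image:
  fixes \<sigma> :: "'g \<Rightarrow> 'f \<Rightarrow> 'f \<Rightarrow> 'k::field"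
  assumes K: "kac_cocycle \<sigma> \<tau>" and "coprime CARD('f) CARD('g)"
  shows "\<exists>\<alpha> \<beta> c. edge_image \<alpha> \<beta> c \<sigma> \<tau>"
proof -
  let ?m = "CARD('f) * CARD('f)" and ?n = "CARD('g) * CARD('g)"
  have "coprime (int ?m) (int ?n)" using assms(2) by (simp add: coprime_mult_left_iff coprime_mult_right_iff)
  then obtain p q where pq: "p * int ?m + q * int ?n = 1"
    using bezout_int[of "int ?m" "int ?n"] by (auto simp: coprime_iff_gcd_eq_1)
  have pow: "(z ^ ?m) powi p * (z ^ ?n) powi q = z" if "z \<noteq> 0" for z :: 'k
  proof -
    have "(z ^ ?m) powi p * (z ^ ?n) powi q = z powi (int ?m * p) * z powi (int ?n * q)"
      by (simp only: power_int_mult power_int_of_nat)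
    also have "\<dots> = z powi (p * int ?m + q * int ?n)"
      using that by (simp add: power_int_add mult.commute)
    finally show ?thesis by (simp only: pq power_int_1_right)
  qed
  obtain \<alpha> \<beta> c c' where "edge_image (\<lambda>_ _. 1) \<beta> c (\<lambda>s x y. \<sigma> s x y ^ ?m) (\<lambda>x t u. \<tau> x t u ^ ?m)"
    "edge_image \<alpha> (\<lambda>_ _. 1) c' (\<lambda>s x y. \<sigma> s x y ^ ?n) (\<lambda>x t u. \<tau> x t u ^ ?n)"
    using kac_cocycle_power_F[OF K] kac_cocycle_power_\<Gamma>[OF K] by blast
  from edge_image_mult[OF edge_image_powi[OF this(1), of p] edge_image_powi[OF this(2), of q]]
  show ?thesis using K by (auto simp: pow kac_cocycle_def)
qed

text \<open>The cocycle \<open>\<beta>\<close> is the comultiplication twist, \<open>\<alpha>\<close> the multiplication twist, and \<open>c\<close> the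
  isomorphism.\<close>

lemma bicrossed_product_obtained_by_twisting:
  fixes \<sigma> :: "'g \<Rightarrow> 'f \<Rightarrow> 'f \<Rightarrow> 'k::field"
  assumes "edge_image \<alpha> \<beta> c \<sigma> \<tau>" and iso: "bicrossed_product (\<triangleright>) (\<triangleleft>) \<sigma> \<tau> \<cong>\<^sub>H A"
  shows "obtained_by_twisting A (split_extension (\<triangleright>) (\<triangleleft>))"
proof -
  let ?one = "\<lambda>_ _ _. 1 :: 'k"
  have al: "\<alpha> x y \<noteq> 0" "\<alpha> 0 x = 1" "\<alpha> x 0 = 1" "\<alpha> y z * \<alpha> x (y + z) = \<alpha> x y * \<alpha> (x + y) z" for x y z
    using assms(1) by (auto simp: edge_image_def group_cocycle_def)
  have be: "\<beta> s t \<noteq> 0" "\<beta> 0 s = 1" "\<beta> s 0 = 1" "\<beta> (s + t) u * \<beta> s t = \<beta> s (t + u) * \<beta> t u" for s t u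
    using assms(1) by (auto simp: edge_image_def group_cocycle_def mult.commute)
  define \<tau>' where "\<tau>' = (\<lambda>x t u. \<beta> t u * 1 / \<beta> (t \<triangleleft> (u \<triangleright> x)) (u \<triangleleft> x))"
  define \<sigma>' where "\<sigma>' = (\<lambda>s x y. \<alpha> (s \<triangleright> x) ((s \<triangleleft> x) \<triangleright> y) * 1 / \<alpha> x y)"
  have "twists_comult (split_extension (\<triangleright>) (\<triangleleft>)) (bicrossed_product (\<triangleright>) (\<triangleleft>) ?one \<tau>')"
  proof -
    have "is_twist (bicrossed_product (\<triangleright>) (\<triangleleft>) ?one ?one) (diag2 \<beta>) (diag2 (\<lambda>s t. inverse (\<beta> s t)))"
      by (rule is_twist_diag2) (simp_all add: be)
    moreover have "comult_twist (bicrossed_product (\<triangleright>) (\<triangleleft>) ?one ?one) (diag2 \<beta>) (diag2 (\<lambda>s t. inverse (\<beta> s t))) =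
        bicrossed_product (\<triangleright>) (\<triangleleft>) ?one \<tau>'"
      unfolding \<tau>'_def by (rule comult_twist_bicrossed) simp_all
    ultimately show ?thesis unfolding twists_comult_def split_extension_def by metis
  qed
  moreover have "twists_mult (bicrossed_product (\<triangleright>) (\<triangleleft>) ?one \<tau>') (bicrossed_product (\<triangleright>) (\<triangleleft>) \<sigma>' \<tau>')"
  proof -
    have ta: "\<tau>' x 0 t = 1" "\<tau>' x t 0 = 1" for x t by (simp_all add: \<tau>'_def be zero_ract)
    have "is_hopf_cocycle (bicrossed_product (\<triangleright>) (\<triangleleft>) ?one \<tau>') (pullback_form \<alpha>) (pullback_form (\<lambda>x y. inverse (\<alpha> x y)))"
      by (rule is_hopf_cocycle_pullback) (simp_all add: al(1-3) ta al(4))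
    moreover have "mult_twist (bicrossed_product (\<triangleright>) (\<triangleleft>) ?one \<tau>') (pullback_form \<alpha>) (pullback_form (\<lambda>x y. inverse (\<alpha> x y))) =
        bicrossed_product (\<triangleright>) (\<triangleleft>) \<sigma>' \<tau>'"
      unfolding \<sigma>'_def by (rule mult_twist_bicrossed) (simp_all add: ta)
    ultimately show ?thesis unfolding twists_mult_def by metis
  qed
  moreover have "A \<cong>\<^sub>H bicrossed_product (\<triangleright>) (\<triangleleft>) \<sigma>' \<tau>'"
  proof -
    have "bicrossed_product (\<triangleright>) (\<triangleleft>) \<sigma>' \<tau>' \<cong>\<^sub>H bicrossed_product (\<triangleright>) (\<triangleleft>) \<sigma> \<tau>"
      by (rule bicrossed_rescale[of c]) (use assms(1) in \<open>auto simp: edge_image_def \<sigma>'_def \<tau>'_def\<close>)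
    then show ?thesis using iso hopf_iso_trans hopf_iso_sym by blast
  qed
  ultimately show ?thesis unfolding obtained_by_twisting_def by blast
qed

end

section \<open>The grading of an extension\<close>

text \<open>If the forms \<open>h x\<close> are the coefficients of an algebra map to a group algebra, the contractions with
  them are the components of a grading. The summation variable \<open>x\<close> and \<open>- x + z\<close> run through all ways
  to write \<open>z\<close> as a sum.\<close>

lemma contract_right_tmult:
  fixes m :: "'k::field ^ 'b \<Rightarrow> 'k ^ 'b \<Rightarrow> 'k ^ 'b" and h :: "'f::{group_add,finite} \<Rightarrow> 'k ^ 'b \<Rightarrow> 'k"
  assumes m: "kbilinear m" and h: "\<And>x. klinear_form (h x)"
    and mult: "\<And>a b. h z (m a b) = (\<Sum>x\<in>UNIV. h x a * h (- x + z) b)"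
  shows "contract_right (h z) (tmult m m T U) =
    (\<Sum>x\<in>UNIV. m (contract_right (h x) T) (contract_right (h (- x + z)) U))"
proof (rule tensor2_eqI[of "\<lambda>T U. contract_right (h z) (tmult m m T U)"])
  have lin: "m (a + b) c = m a c + m b c" "m c (a + b) = m c a + m c b"
    "m (k *s a) b = k *s m a b" "m a (k *s b) = k *s m a b" for a b c k
    using m by (auto simp: kbilinear_def klinear_iff)
  have con: "contract_right (h x) (a + b) = contract_right (h x) a + contract_right (h x) b"
    "contract_right (h x) (k *s a) = k *s contract_right (h x) a" for x k and a b :: "'k ^ ('b \<times> 'b)"
    by (simp_all add: klinear_contract(1)[unfolded klinear_iff])
  show "klinear (\<lambda>T. \<Sum>x\<in>UNIV. m (contract_right (h x) T) (contract_right (h (- x + z)) U))"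
    "klinear (\<lambda>U. \<Sum>x\<in>UNIV. m (contract_right (h x) T) (contract_right (h (- x + z)) U))" for T U
    by (auto simp: klinear_iff con lin sum.distrib vec.scale_sum_right)
  show "contract_right (h z) (tmult m m (v \<otimes>\<^sub>k w) (v' \<otimes>\<^sub>k w')) =
      (\<Sum>x\<in>UNIV. m (contract_right (h x) (v \<otimes>\<^sub>k w)) (contract_right (h (- x + z)) (v' \<otimes>\<^sub>k w')))" for v w v' w'
    by (simp add: tmult_tensor m contract_tensor h mult lin vec.scale_sum_left mult.commute)
qed (intro klinear_comp[OF klinear_contract(1)] klinear_tmult)+

lemma tmult_tensor_left:
  assumes "kbilinear m" "kbilinear n"
  shows "tmult m n (a \<otimes>\<^sub>k b) t = tmap (m a) (n b) t"
proof (rule tensor_eqI[OF klinear_tmult(1) klinear_tmap])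
  have "klinear (m a)" "klinear (n b)" using assms by (auto simp: kbilinear_def)
  then show "tmult m n (a \<otimes>\<^sub>k b) (v \<otimes>\<^sub>k w) = tmap (m a) (n b) (v \<otimes>\<^sub>k w)" for v w
    by (simp add: tmult_tensor assms tmap_tensor)
qed

lemma group_algebra_mul: "mul group_algebra a b $ z = (\<Sum>x\<in>UNIV. a $ x * b $ (- x + z))"
proof -
  have "mul group_algebra a b $ z = (\<Sum>x\<in>UNIV. \<Sum>y\<in>UNIV. if y = - x + z then a $ x * b $ y else 0)"
    unfolding group_algebra_def hopf.simps sum_component vector_smult_component
    by (intro sum.cong refl) (auto simp: axis_def add.assoc[symmetric])
  then show ?thesis by simp
qed

lemma group_algebra_comult: "comult group_algebra a $ (x, y) = (if x = y then a $ x else 0)"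
proof -
  have "comult group_algebra a $ (x, y) = (\<Sum>z\<in>UNIV. if z = x then (if x = y then a $ x else 0) else 0)"
    unfolding group_algebra_def hopf.simps sum_component vector_smult_component
    by (intro sum.cong refl) (auto simp: axis_def)
  then show ?thesis by simp
qed

locale matched_pair_extension = matched_pair lact ract
  for lact :: "'g::{group_add,finite} \<Rightarrow> 'f::{group_add,finite} \<Rightarrow> 'f" (infixr "\<triangleright>" 68)
    and ract :: "'g \<Rightarrow> 'f \<Rightarrow> 'g" (infixl "\<triangleleft>" 68) +
  fixes A :: "('k::field, 'a::finite) hopf"
    and \<iota> :: "('k, 'g) vec \<Rightarrow> 'k ^ 'a" and \<pi> :: "'k ^ 'a \<Rightarrow> ('k, 'f) vec"
  assumes hopf: "hopf_algebra A"
    and exact: "exact_sequence function_algebra \<iota> A \<pi> group_algebra"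
    and affords: "affords (\<triangleright>) (\<triangleleft>) \<iota> A \<pi>"
begin

abbreviation mul_A (infixl "\<cdot>" 70) where "a \<cdot> b \<equiv> mul A a b"
abbreviation "\<Delta> \<equiv> comult A"
abbreviation "\<epsilon> \<equiv> counit A"

definition "e s = \<iota> (axis s 1)"
definition "proj_coeff x a = \<pi> a $ x"

text \<open>\<open>right_part x\<close> and \<open>left_part y\<close> are the projections to the components of the gradings by \<open>F\<close> that
  come from \<open>(id \<otimes> \<pi>)\<Delta>\<close> and \<open>(\<pi> \<otimes> id)\<Delta>\<close>. Being homogeneous of degree \<open>x\<close> is expressed as
  \<open>right_part x a = a\<close>.\<close>

definition "right_part x a = contract_right (proj_coeff x) (\<Delta> a)"
definition "left_part y a = contract_left (proj_coeff y) (\<Delta> a)"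

lemma alg: "algebra_ax A" and coalg: "coalgebra_ax A" and \<iota>: "hopf_hom function_algebra A \<iota>" and \<pi>: "hopf_hom A group_algebra \<pi>"
  using hopf exact by (auto simp: hopf_algebra_def bialgebra_def exact_sequence_def)

lemmas bilin = kbilinear_mul[OF alg]

lemma mul_simps:
  "(a \<cdot> b) \<cdot> c = a \<cdot> (b \<cdot> c)" "unity A \<cdot> a = a" "a \<cdot> unity A = a"
  "(a + b) \<cdot> c = a \<cdot> c + b \<cdot> c" "c \<cdot> (a + b) = c \<cdot> a + c \<cdot> b"
  "(k *s a) \<cdot> b = k *s (a \<cdot> b)" "a \<cdot> (k *s b) = k *s (a \<cdot> b)" "0 \<cdot> a = 0" "a \<cdot> 0 = 0"
  "(\<Sum>i\<in>I. f i) \<cdot> b = (\<Sum>i\<in>I. f i \<cdot> b)" "b \<cdot> (\<Sum>i\<in>I. f i) = (\<Sum>i\<in>I. b \<cdot> f i)"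
proof -
  have l: "klinear (\<lambda>a. a \<cdot> b)" "klinear (mul A b)" for b using alg by (auto simp: algebra_ax_def)
  show "(a \<cdot> b) \<cdot> c = a \<cdot> (b \<cdot> c)" "unity A \<cdot> a = a" "a \<cdot> unity A = a"
    using alg by (auto simp: algebra_ax_def)
  show "(a + b) \<cdot> c = a \<cdot> c + b \<cdot> c" "c \<cdot> (a + b) = c \<cdot> a + c \<cdot> b"
    "(k *s a) \<cdot> b = k *s (a \<cdot> b)" "a \<cdot> (k *s b) = k *s (a \<cdot> b)"
    using l by (auto simp: klinear_iff)
  show "0 \<cdot> a = 0" "a \<cdot> 0 = 0" using klinear_zero[OF l(1)] klinear_zero[OF l(2)] by auto
  show "(\<Sum>i\<in>I. f i) \<cdot> b = (\<Sum>i\<in>I. f i \<cdot> b)" "b \<cdot> (\<Sum>i\<in>I. f i) = (\<Sum>i\<in>I. b \<cdot> f i)"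
    using klinear_sum[OF l(1)] klinear_sum[OF l(2)] by auto
qed

lemma lin: "klinear \<Delta>" "klinear_form \<epsilon>" "klinear \<iota>" "klinear \<pi>"
  using coalg \<iota> \<pi> by (auto simp: coalgebra_ax_def hopf_hom_def)

lemma lin_proj_coeff: "klinear_form (proj_coeff x)"
  using lin(4) by (auto simp: klinear_iff klinear_form_iff proj_coeff_def)

lemma \<epsilon>_simps: "\<epsilon> (a + b) = \<epsilon> a + \<epsilon> b" "\<epsilon> (k *s a) = k * \<epsilon> a" "\<epsilon> 0 = 0" "\<epsilon> (a \<cdot> b) = \<epsilon> a * \<epsilon> b" "\<epsilon> (unity A) = 1"
  using lin(2) klinear_form_zero[OF lin(2)] hopf
  by (auto simp: klinear_form_iff hopf_algebra_def bialgebra_def)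

lemma lin_right_part: "klinear (right_part x)" and lin_left_part: "klinear (left_part x)"
  unfolding right_part_def left_part_def by (intro klinear_comp[OF klinear_contract(1) lin(1)] klinear_comp[OF klinear_contract(2) lin(1)])+

lemma right_part_simps: "right_part x (a + b) = right_part x a + right_part x b" "right_part x (k *s a) = k *s right_part x a" "right_part x 0 = 0"
  using lin_right_part[of x] klinear_zero[OF lin_right_part] by (auto simp: klinear_iff)

lemma tmap_\<pi>: "tmap id \<pi> t $ (i, x) = contract_right (proj_coeff x) t $ i" "tmap \<pi> id t $ (x, i) = contract_left (proj_coeff x) t $ i"
  by (simp_all add: tmap_slice_left tmap_slice_right contract_nth lin lin_proj_coeff) (simp_all add: proj_coeff_def)

lemma proj_coeff_mul: "proj_coeff z (a \<cdot> b) = (\<Sum>x\<in>UNIV. proj_coeff x a * proj_coeff (- x + z) b)"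
  using \<pi> by (simp add: hopf_hom_def proj_coeff_def group_algebra_mul)

lemma proj_coeff_unity: "proj_coeff x (unity A) = (if x = 0 then 1 else 0)"
  using \<pi> by (auto simp: hopf_hom_def proj_coeff_def group_algebra_def axis_def)

lemma sum_proj_coeff: "(\<Sum>x\<in>UNIV. proj_coeff x a) = \<epsilon> a"
proof -
  have "counit group_algebra (\<pi> a) = \<epsilon> a" using \<pi> by (simp add: hopf_hom_def)
  then show ?thesis by (simp add: group_algebra_def proj_coeff_def)
qed

text \<open>This says that \<open>\<pi>\<close> respects coproducts, together with the fact that group elements are grouplike.\<close>

lemma proj_coeff_right_part: "proj_coeff x (right_part y a) = (if x = y then proj_coeff x a else 0)"
proof -
  have "tmap \<pi> id (tmap id \<pi> (\<Delta> a)) = comult group_algebra (\<pi> a)"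
    using \<pi> lin(4) by (simp add: tmap_tmap hopf_hom_def)
  then have "tmap \<pi> id (tmap id \<pi> (\<Delta> a)) $ (x, y) = (if x = y then proj_coeff x a else 0)"
    by (simp add: group_algebra_comult proj_coeff_def)
  moreover have "tmap \<pi> id (tmap id \<pi> (\<Delta> a)) $ (x, y) = proj_coeff x (right_part y a)"
    by (subst tmap_slice_left[OF lin(4)]) (simp add: tmap_\<pi> proj_coeff_def right_part_def[symmetric])
  ultimately show ?thesis by simp
qed

lemma comult_right_part: "\<Delta> (right_part x a) = tmap id (right_part x) (\<Delta> a)"
proof -
  have "\<Delta> (right_part x a) = contract_right (proj_coeff x) (tmap \<Delta> id (\<Delta> a))"
    by (simp add: contract_right_tmap lin_proj_coeff lin right_part_def)
  also have "\<dots> = tmap id (contract_right (proj_coeff x)) (tassoc (tmap \<Delta> id (\<Delta> a)))"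
    by (simp add: contract_right_tassoc lin_proj_coeff)
  also have "\<dots> = tmap id (contract_right (proj_coeff x)) (tmap id \<Delta> (\<Delta> a))"
    using coalg by (simp add: coalgebra_ax_def)
  finally show ?thesis by (simp add: tmap_tmap klinear_contract right_part_def[abs_def] id_def)
qed

text \<open>Both sides apply \<open>\<pi>\<close> to the middle factor of the iterated coproduct. So in \<open>\<Delta> a\<close> the right degree of the
  first factor equals the left degree of the second.\<close>

lemma right_part_middle: "tmap (right_part x) id (\<Delta> a) = tmap id (left_part x) (\<Delta> a)"
proof -
  have "tmap (right_part x) id (\<Delta> a) = tmap (contract_right (proj_coeff x)) id (tmap \<Delta> id (\<Delta> a))"
    by (simp add: tmap_tmap klinear_contract right_part_def[abs_def] id_def)
  also have "\<dots> = tmap id (contract_left (proj_coeff x)) (tassoc (tmap \<Delta> id (\<Delta> a)))"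
    by (simp add: contract_middle lin_proj_coeff)
  also have "\<dots> = tmap id (contract_left (proj_coeff x)) (tmap id \<Delta> (\<Delta> a))"
    using coalg by (simp add: coalgebra_ax_def)
  finally show ?thesis by (simp add: tmap_tmap klinear_contract left_part_def[abs_def] id_def)
qed

lemma right_part_right_part: "right_part x (right_part y a) = (if x = y then right_part x a else 0)"
proof -
  have "right_part x (right_part y a) = contract_right (proj_coeff x) (tmap id (right_part y) (\<Delta> a))" by (simp add: right_part_def[of x] comult_right_part)
  also have "\<dots> = contract_right (\<lambda>w. proj_coeff x (right_part y w)) (\<Delta> a)"
    by (simp add: contract_right_tmap lin_proj_coeff lin_right_part)
  finally have "right_part x (right_part y a) = contract_right (\<lambda>w. proj_coeff x (right_part y w)) (\<Delta> a)" .
  moreover have "contract_right (\<lambda>w. 0) t = 0" for t :: "'k ^ ('a \<times> 'a)" by (simp add: contract_right_def tlift_def)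
  ultimately show ?thesis unfolding proj_coeff_right_part by (simp add: right_part_def cong: if_cong)
qed

lemma sum_right_part: "(\<Sum>x\<in>UNIV. right_part x a) = a"
proof -
  have "(\<Sum>x\<in>UNIV. right_part x a) = contract_right \<epsilon> (\<Delta> a)"
    by (simp add: vec_eq_iff right_part_def contract_nth lin lin_proj_coeff sum_proj_coeff)
  then show ?thesis using coalg by (simp add: coalgebra_ax_def contract_right_def)
qed

lemma \<epsilon>_right_part: "\<epsilon> (right_part x a) = proj_coeff x a"
  by (simp add: sum_proj_coeff[symmetric] proj_coeff_right_part)

lemma right_part_mul: "right_part z (a \<cdot> b) = (\<Sum>x\<in>UNIV. right_part x a \<cdot> right_part (- x + z) b)"
proof -
  have "\<Delta> (a \<cdot> b) = tmult (mul A) (mul A) (\<Delta> a) (\<Delta> b)" using hopf by (simp add: hopf_algebra_def bialgebra_def)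
  then show ?thesis unfolding right_part_def by (simp add: contract_right_tmult[OF bilin lin_proj_coeff proj_coeff_mul])
qed

lemma right_part_unity: "right_part x (unity A) = (if x = 0 then unity A else 0)"
proof -
  have "\<Delta> (unity A) = unity A \<otimes>\<^sub>k unity A" using hopf by (simp add: hopf_algebra_def bialgebra_def)
  then show ?thesis by (simp add: right_part_def contract_tensor lin_proj_coeff proj_coeff_unity)
qed

lemma right_part_homogeneous: "right_part x a = a \<Longrightarrow> right_part y a = (if y = x then a else 0)"
  by (metis right_part_right_part)

lemma homogeneous_mul: "right_part x a = a \<Longrightarrow> right_part y b = b \<Longrightarrow> right_part (x + y) (a \<cdot> b) = a \<cdot> b"
  unfolding right_part_mul by (subst sum_eq_single[of x]) (auto simp: right_part_homogeneous[of x a] add.assoc[symmetric] mul_simps)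

lemma homogeneous_tensor: "right_part x a = a \<longleftrightarrow> tmap id \<pi> (\<Delta> a) = a \<otimes>\<^sub>k axis x 1"
proof
  assume "right_part x a = a"
  then show "tmap id \<pi> (\<Delta> a) = a \<otimes>\<^sub>k axis x 1"
    by (auto simp: vec_eq_iff tmap_\<pi> right_part_def[symmetric] right_part_homogeneous axis_def)
next
  assume *: "tmap id \<pi> (\<Delta> a) = a \<otimes>\<^sub>k axis x 1"
  have "tmap id \<pi> (\<Delta> a) $ (i, x) = a $ i" for i unfolding * by (simp add: axis_def)
  then show "right_part x a = a" by (simp add: vec_eq_iff tmap_\<pi> right_part_def)
qed

lemma homogeneous_zero: "right_part 0 a = a \<longleftrightarrow> a \<in> range \<iota>"
  using exact unfolding homogeneous_tensor exact_sequence_def by (auto simp: group_algebra_def)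

lemma e_mul: "e s \<cdot> e t = (if s = t then e s else 0)"
proof -
  have "e s \<cdot> e t = \<iota> (mul function_algebra (axis s 1) (axis t 1))" using \<iota> by (simp add: hopf_hom_def e_def)
  also have "mul function_algebra (axis s 1) (axis t 1) = (if s = t then axis s 1 else 0 :: ('k, 'g) vec)"
    by (auto simp: vec_eq_iff function_algebra_def axis_def)
  finally show ?thesis by (auto simp: e_def klinear_zero lin)
qed

lemma \<iota>_expand: "\<iota> f = (\<Sum>s\<in>UNIV. f $ s *s e s)"
  unfolding e_def by (rule klinear_expand[OF lin(3)])

lemma sum_e: "(\<Sum>s\<in>UNIV. e s) = unity A"
proof -
  have "\<iota> (unity function_algebra) = unity A" using \<iota> by (simp add: hopf_hom_def)
  then show ?thesis by (simp add: \<iota>_expand function_algebra_def)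
qed

lemma e_nonzero: "e s \<noteq> 0"
proof
  assume "e s = 0"
  then have "\<iota> (axis s 1) = \<iota> 0" by (simp add: e_def klinear_zero lin)
  then have "axis s (1 :: 'k) = 0" using exact by (auto simp: exact_sequence_def dest: injD)
  then show False by simp
qed

lemma comult_e: "\<Delta> (e s) = (\<Sum>t\<in>UNIV. e t \<otimes>\<^sub>k e (- t + s))"
proof -
  have "comult function_algebra (axis s 1) = (\<Sum>t\<in>UNIV. axis t 1 \<otimes>\<^sub>k axis (- t + s) (1 :: 'k))"
  proof -
    have "(\<Sum>t\<in>UNIV. axis t 1 \<otimes>\<^sub>k axis (- t + s) (1 :: 'k)) $ (r, u) = axis s 1 $ (r + u)" for r u
      unfolding sum_component
      by (subst sum_eq_single[of r]) (auto simp: axis_def add.assoc[symmetric])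
    then show ?thesis by (simp add: vec_eq_iff function_algebra_def)
  qed
  moreover have "\<Delta> (e s) = tmap \<iota> \<iota> (comult function_algebra (axis s 1))"
    using \<iota> by (simp add: hopf_hom_def e_def)
  ultimately show ?thesis by (simp add: klinear_sum[OF klinear_tmap] tmap_tensor lin e_def)
qed

lemma \<epsilon>_e: "\<epsilon> (e s) = (if s = 0 then 1 else 0)"
proof -
  have "\<epsilon> (e s) = counit function_algebra (axis s 1)" using \<iota> by (simp add: hopf_hom_def e_def)
  then show ?thesis by (auto simp: function_algebra_def axis_def)
qed

lemma right_part_e: "right_part 0 (e s) = e s" by (simp add: homogeneous_zero e_def)

text \<open>Exactness identifies the component of degree \<open>0\<close> with \<open>k\<^sup>\<Gamma>\<close>, in which \<open>e s\<close> is a minimal idempotent.\<close>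

lemma e_mul_homogeneous_zero: "right_part 0 a = a \<Longrightarrow> \<exists>k. e s \<cdot> a = k *s e s"
proof -
  assume "right_part 0 a = a"
  then obtain f where a: "a = \<iota> f" by (auto simp: homogeneous_zero)
  have "e s \<cdot> a = (\<Sum>t\<in>UNIV. f $ t *s (e s \<cdot> e t))" by (simp add: a \<iota>_expand mul_simps)
  also have "\<dots> = f $ s *s e s" by (subst sum_eq_single[of s]) (auto simp: e_mul)
  finally show ?thesis by blast
qed

lemma homogeneous_e_mul: "right_part x a = a \<Longrightarrow> right_part x (e s \<cdot> a) = e s \<cdot> a" "right_part x a = a \<Longrightarrow> right_part x (a \<cdot> e s) = a \<cdot> e s"
  using homogeneous_mul[OF right_part_e, of x a s] homogeneous_mul[OF _ right_part_e, of x a s] by auto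

lemma e_commute: "right_part x a = a \<Longrightarrow> e s \<cdot> a = a \<cdot> e (s \<triangleleft> x)"
  and left_part_homogeneous: "right_part x a = a \<Longrightarrow> left_part y (e s \<cdot> a) = (if y = s \<triangleright> x then e s \<cdot> a else 0)"
proof -
  assume "right_part x a = a"
  then have *: "e s \<cdot> a = a \<cdot> e (s \<triangleleft> x)" "tmap \<pi> id (\<Delta> (e s \<cdot> a)) = axis (s \<triangleright> x) 1 \<otimes>\<^sub>k (e s \<cdot> a)"
    using affords unfolding affords_def homogeneous_tensor e_def by blast+
  show "e s \<cdot> a = a \<cdot> e (s \<triangleleft> x)" by (rule *)
  have "left_part y (e s \<cdot> a) $ i = (if y = s \<triangleright> x then e s \<cdot> a else 0) $ i" for i
    unfolding left_part_def tmap_\<pi>(2)[symmetric] *(2) by (auto simp: axis_def)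
  then show "left_part y (e s \<cdot> a) = (if y = s \<triangleright> x then e s \<cdot> a else 0)" by (simp add: vec_eq_iff)
qed

section \<open>One-dimensional pieces\<close>

lemma ex_homogeneous: "\<exists>b. right_part x b = b \<and> \<epsilon> b = 1"
proof -
  obtain a where "\<pi> a = axis x 1" using exact by (metis exact_sequence_def surj_def)
  then have "\<epsilon> (right_part x a) = 1" by (simp add: \<epsilon>_right_part proj_coeff_def)
  then show ?thesis by (metis right_part_right_part)
qed

text \<open>Let \<open>b\<close> have degree \<open>x\<close> and counit \<open>1\<close>. In \<open>S(b\<^sub>1) b\<^sub>2 = 1\<close> the factor \<open>b\<^sub>2\<close> may be taken of degree \<open>x\<close>,
  and since \<open>1\<close> has degree \<open>0\<close>, the factor \<open>S(b\<^sub>1)\<close> may be replaced by its component of degree \<open>-x\<close>.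
  Multiplied by \<open>e s\<close>, the sum is not zero, so some summand is a nonzero multiple of \<open>e s\<close>.\<close>

lemma strongly_graded: "\<exists>c d. right_part (- x) c = c \<and> right_part x d = d \<and> e s \<cdot> c = c \<and> d \<cdot> e s = d \<and> c \<cdot> d = e s"
proof -
  obtain b where b: "right_part x b = b" "\<epsilon> b = 1" using ex_homogeneous by blast
  obtain S where S: "klinear S" "tlift (\<lambda>v w. S v \<cdot> w) (\<Delta> b) = \<epsilon> b *s unity A"
    using hopf by (auto simp: hopf_algebra_def antipode_def)
  have "kbilinear (\<lambda>v w. S v \<cdot> w)"
    using S(1) by (auto simp: kbilinear_def klinear_iff mul_simps)
  then have "tlift (\<lambda>v w. S v \<cdot> right_part x w) (\<Delta> b) = tlift (\<lambda>v w. S v \<cdot> w) (tmap id (right_part x) (\<Delta> b))"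
    by (simp add: tlift_tmap)
  also have "\<dots> = unity A" using S(2) b comult_right_part[of x b] by simp
  finally have "right_part 0 (unity A) = tlift (\<lambda>v w. right_part 0 (S v \<cdot> right_part x w)) (\<Delta> b)"
    by (metis klinear_of_tlift[OF lin_right_part])
  moreover have "right_part 0 (p \<cdot> right_part x w) = right_part (- x) p \<cdot> right_part x w" for p w
    unfolding right_part_mul by (subst sum_eq_single[of "- x"]) (auto simp: right_part_right_part mul_simps)
  ultimately have "unity A = tlift (\<lambda>v w. right_part (- x) (S v) \<cdot> right_part x w) (\<Delta> b)" by (simp add: right_part_unity)
  moreover have "klinear (mul A (e s))" using bilin by (simp add: kbilinear_def)
  ultimately have es: "e s = tlift (\<lambda>v w. e s \<cdot> (right_part (- x) (S v) \<cdot> right_part x w)) (\<Delta> b)"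
    by (metis klinear_of_tlift mul_simps(3))
  have "\<exists>v w. e s \<cdot> (right_part (- x) (S v) \<cdot> right_part x w) \<noteq> 0"
  proof (rule ccontr)
    assume "\<nexists>v w. e s \<cdot> (right_part (- x) (S v) \<cdot> right_part x w) \<noteq> 0"
    then have "e s = 0" by (subst es) (simp add: tlift_def)
    then show False using e_nonzero by blast
  qed
  then obtain c d where cd: "right_part (- x) c = c" "right_part x d = d" "e s \<cdot> (c \<cdot> d) \<noteq> 0" by (metis right_part_right_part)
  then obtain k where k: "e s \<cdot> (c \<cdot> d) = k *s e s"
    using e_mul_homogeneous_zero homogeneous_mul[OF cd(1,2)] by auto
  then have "k \<noteq> 0" using cd(3) by auto
  let ?c = "(1 / k) *s (e s \<cdot> c)" and ?d = "d \<cdot> e s"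
  have "?c \<cdot> ?d = (1 / k) *s ((e s \<cdot> (c \<cdot> d)) \<cdot> e s)" by (simp add: mul_simps)
  also have "\<dots> = e s" using \<open>k \<noteq> 0\<close> by (simp add: k mul_simps e_mul)
  finally have "?c \<cdot> ?d = e s" .
  moreover have "e s \<cdot> ?c = ?c" by (simp add: mul_simps(7) mul_simps(1)[symmetric] e_mul)
  moreover have "?d \<cdot> e s = ?d" by (simp add: mul_simps(1) e_mul)
  ultimately show ?thesis using homogeneous_e_mul cd(1,2) by (metis right_part_simps(2))
qed

text \<open>For \<open>a\<close> in the same piece as \<open>d\<close>, the product \<open>a c\<close> has degree \<open>0\<close> and is fixed by \<open>e t\<close>, hence is a
  multiple of \<open>e t\<close>, and \<open>a = (a c) d\<close>.\<close>

lemma one_dimensional: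
  "\<exists>c d. right_part x d = d \<and> e t \<cdot> d = d \<and> c \<cdot> d = e (t \<triangleleft> x) \<and> (\<forall>a. right_part x a = a \<longrightarrow> e t \<cdot> a = a \<longrightarrow> (\<exists>k. a = k *s d))"
proof -
  obtain c d where cd: "right_part (- x) c = c" "right_part x d = d" "d \<cdot> e (t \<triangleleft> x) = d" "c \<cdot> d = e (t \<triangleleft> x)"
    using strongly_graded by blast
  have ed: "e t \<cdot> d = d" using e_commute cd(2,3) by simp
  have "\<exists>k. a = k *s d" if a: "right_part x a = a" "e t \<cdot> a = a" for a
  proof -
    have "right_part 0 (a \<cdot> c) = a \<cdot> c" using homogeneous_mul[OF a(1) cd(1)] by simp
    then obtain k where k: "e t \<cdot> (a \<cdot> c) = k *s e t" using e_mul_homogeneous_zero by blast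
    have "a = e t \<cdot> (a \<cdot> e (t \<triangleleft> x))" using e_commute[OF a(1)] a(2) by simp
    also have "\<dots> = (e t \<cdot> (a \<cdot> c)) \<cdot> d" by (simp add: cd(4)[symmetric] mul_simps)
    also have "\<dots> = k *s d" by (simp add: k mul_simps ed)
    finally show ?thesis by blast
  qed
  then show ?thesis using cd ed by blast
qed

text \<open>The last two conditions normalize the basis. With them, \<open>\<sigma>\<close> and \<open>\<tau>\<close> are normalized and unit and
  counit take the standard form. They agree at \<open>t = 0\<close>, \<open>x = 0\<close> because \<open>\<epsilon> (e 0) = 1\<close>.\<close>

definition "basis_element t x d \<longleftrightarrow> right_part x d = d \<and> e t \<cdot> d = d \<and> (\<exists>c. c \<cdot> d = e (t \<triangleleft> x)) \<and>
  (\<forall>a. right_part x a = a \<longrightarrow> e t \<cdot> a = a \<longrightarrow> (\<exists>k. a = k *s d)) \<and> (t = 0 \<longrightarrow> \<epsilon> d = 1) \<and> (x = 0 \<longrightarrow> d = e t)"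

lemma ex_basis_element: "\<exists>d. basis_element t x d"
proof -
  obtain c d where cd: "right_part x d = d" "e t \<cdot> d = d" "c \<cdot> d = e (t \<triangleleft> x)"
    and span: "\<And>a. right_part x a = a \<Longrightarrow> e t \<cdot> a = a \<Longrightarrow> \<exists>k. a = k *s d"
    using one_dimensional by metis
  obtain b where b: "right_part x b = b" "\<epsilon> b = 1" using ex_homogeneous by blast
  have "d \<noteq> 0" using cd(3) e_nonzero by (metis mul_simps(9))
  have "\<exists>d'. right_part x d' = d' \<and> e t \<cdot> d' = d' \<and> d' \<noteq> 0 \<and> (t = 0 \<longrightarrow> \<epsilon> d' = 1) \<and> (x = 0 \<longrightarrow> d' = e t)"
  proof (cases "x = 0")
    case True then show ?thesis by (intro exI[of _ "e t"]) (simp add: right_part_e e_mul e_nonzero \<epsilon>_e)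
  next
    case False
    show ?thesis
    proof (cases "t = 0")
      case True
      have "\<epsilon> (e 0 \<cdot> b) = 1" by (simp add: \<epsilon>_simps \<epsilon>_e b)
      moreover have "e 0 \<cdot> (e 0 \<cdot> b) = e 0 \<cdot> b" by (simp add: mul_simps(1)[symmetric] e_mul)
      moreover have "e 0 \<cdot> b \<noteq> 0" using \<open>\<epsilon> (e 0 \<cdot> b) = 1\<close> \<epsilon>_simps(3) by (metis zero_neq_one)
      ultimately show ?thesis using True False homogeneous_e_mul(1)[OF b(1)] by blast
    next
      case False then show ?thesis using cd \<open>x \<noteq> 0\<close> \<open>d \<noteq> 0\<close> by blast
    qed
  qed
  then obtain d' where d': "right_part x d' = d'" "e t \<cdot> d' = d'" "d' \<noteq> 0" "t = 0 \<longrightarrow> \<epsilon> d' = 1" "x = 0 \<longrightarrow> d' = e t"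
    by blast
  obtain k where k: "d' = k *s d" using span d' by blast
  then have "k \<noteq> 0" using d'(3) by auto
  then have "((1 / k) *s c) \<cdot> d' = e (t \<triangleleft> x)" by (simp add: k mul_simps cd)
  moreover have "\<exists>l. a = l *s d'" if "right_part x a = a" "e t \<cdot> a = a" for a
  proof -
    obtain l where "a = l *s d" using span \<open>right_part x a = a\<close> \<open>e t \<cdot> a = a\<close> by blast
    then have "a = (l / k) *s d'" using \<open>k \<noteq> 0\<close> by (simp add: k)
    then show ?thesis by blast
  qed
  ultimately show ?thesis unfolding basis_element_def using d' by blast
qed

definition "d t x = (SOME d. basis_element t x d)"

lemma basis_element_d: "basis_element t x (d t x)"
  unfolding d_def using ex_basis_element by (rule someI_ex)

lemma right_part_d: "right_part y (d t x) = (if y = x then d t x else 0)"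
  using basis_element_d right_part_homogeneous by (simp add: basis_element_def)

lemma e_d: "e s \<cdot> d t x = (if s = t then d t x else 0)"
proof -
  have "d t x = e t \<cdot> d t x" using basis_element_d by (simp add: basis_element_def)
  then have "e s \<cdot> d t x = (e s \<cdot> e t) \<cdot> d t x" by (metis mul_simps(1))
  then show ?thesis using basis_element_d by (auto simp: basis_element_def e_mul mul_simps)
qed

lemma d_e: "d t x \<cdot> e u = (if u = t \<triangleleft> x then d t x else 0)"
proof -
  have *: "d t x = d t x \<cdot> e (t \<triangleleft> x)" using e_commute[of x "d t x" t] by (simp add: right_part_d e_d)
  then have "d t x \<cdot> e u = d t x \<cdot> (e (t \<triangleleft> x) \<cdot> e u)" by (metis mul_simps(1))
  then show ?thesis using * by (simp add: e_mul mul_simps)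
qed

lemma d_left_inverse: "\<exists>c. c \<cdot> d t x = e (t \<triangleleft> x)"
  using basis_element_d by (simp add: basis_element_def)

lemma d_nonzero: "d t x \<noteq> 0"
  using d_left_inverse e_nonzero mul_simps(9) by metis

lemma d_span: "right_part x a = a \<Longrightarrow> e t \<cdot> a = a \<Longrightarrow> \<exists>k. a = k *s d t x"
  using basis_element_d by (simp add: basis_element_def)

lemma d_0: "d t 0 = e t"
  using basis_element_d by (simp add: basis_element_def)

lemma \<epsilon>_d: "\<epsilon> (d t x) = (if t = 0 then 1 else 0)"
proof (cases "t = 0")
  case False
  have "\<epsilon> (d t x) = \<epsilon> (e t \<cdot> d t x)" by (simp add: e_d)
  then show ?thesis using False by (simp only: \<epsilon>_simps \<epsilon>_e) simp
qed (use basis_element_d in \<open>simp add: basis_element_def\<close>)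

text \<open>The linear map sending the standard basis vector \<open>e\<^sub>s # x\<close> to \<open>d s x\<close>.\<close>

definition "\<phi> v = (\<Sum>p\<in>UNIV. v $ p *s d (fst p) (snd p))"

lemma lin_\<phi>: "klinear \<phi>"
  by (auto simp: klinear_iff \<phi>_def vec.scale_left_distrib sum.distrib vec.scale_sum_right)

lemma \<phi>_axis: "\<phi> (axis (s, x) 1) = d s x"
  unfolding \<phi>_def by (subst sum_eq_single[of "(s, x)"]) (auto simp: axis_def)

lemma diagonal_\<phi>:
  assumes "klinear f" "\<And>t x. f (d t x) = c (t, x) *s d t x"
  shows "f (\<phi> v) = \<phi> (\<chi> p. c p * v $ p)"
  unfolding \<phi>_def klinear_sum[OF assms(1)]
  by (rule sum.cong) (use assms in \<open>auto simp: klinear_iff mult.commute\<close>)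

lemma lin_e: "klinear (mul A (e s))"
  using bilin by (simp add: kbilinear_def)

lemma e_right_part_\<phi>: "e t \<cdot> right_part x (\<phi> v) = v $ (t, x) *s d t x"
proof -
  have "e t \<cdot> right_part x (\<phi> v) = \<phi> (\<chi> p. (if p = (t, x) then 1 else 0) * v $ p)"
    by (rule diagonal_\<phi>[OF klinear_comp[OF lin_e lin_right_part]]) (auto simp: right_part_d e_d mul_simps)
  also have "\<dots> = v $ (t, x) *s d t x"
    unfolding \<phi>_def by (subst sum_eq_single[of "(t, x)"]) auto
  finally show ?thesis .
qed

text \<open>The coordinate of \<open>a\<close> at \<open>(t, x)\<close> is read off from \<open>e t \<cdot> right_part x a\<close>. Surjectivity holds because
  these elements sum to \<open>a\<close> and each lies on the line spanned by \<open>d t x\<close>.\<close>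

lemma bij_\<phi>: "bij \<phi>"
proof (rule bijI)
  show "inj \<phi>"
  proof (rule injI)
    fix v w assume "\<phi> v = \<phi> w"
    then have "v $ (t, x) *s d t x = w $ (t, x) *s d t x" for t x by (metis e_right_part_\<phi>)
    then have "v $ (t, x) = w $ (t, x)" for t x using d_nonzero vec.scale_cancel_right by blast
    then show "v = w" by (simp add: vec_eq_iff)
  qed
  show "surj \<phi>"
  proof (rule surjI)
    fix a
    have "\<exists>k. e t \<cdot> right_part x a = k *s d t x" for t x
    proof (rule d_span)
      show "right_part x (e t \<cdot> right_part x a) = e t \<cdot> right_part x a" by (rule homogeneous_e_mul) (simp add: right_part_right_part)
      show "e t \<cdot> (e t \<cdot> right_part x a) = e t \<cdot> right_part x a" by (simp add: mul_simps(1)[symmetric] e_mul)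
    qed
    then have "e t \<cdot> right_part x a = (SOME k. e t \<cdot> right_part x a = k *s d t x) *s d t x" for t x by (metis (mono_tags) someI_ex)
    moreover have "a = (\<Sum>t\<in>UNIV. \<Sum>x\<in>UNIV. e t \<cdot> right_part x a)"
      by (simp add: mul_simps(11)[symmetric] sum_right_part mul_simps(10)[symmetric] sum_e mul_simps(2))
    ultimately show "\<phi> (\<chi> p. SOME k. e (fst p) \<cdot> right_part (snd p) a = k *s d (fst p) (snd p)) = a"
      by (simp add: \<phi>_def sum_UNIV_prod)
  qed
qed

abbreviation "\<psi> \<equiv> inv \<phi>"

lemma \<psi>: "\<psi> (\<phi> v) = v" "\<phi> (\<psi> a) = a" "klinear \<psi>"
  using bij_\<phi> lin_\<phi> klinear_inv by (auto simp: bij_is_inj bij_is_surj surj_f_inv_f)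

lemma diagonal_\<psi>:
  assumes "klinear f" "\<And>t x. f (d t x) = c (t, x) *s d t x"
  shows "\<psi> (f a) = (\<chi> p. c p * \<psi> a $ p)"
  using arg_cong[OF diagonal_\<phi>[where c = c, OF assms, of "\<psi> a"], of \<psi>] by (simp add: \<psi>)

lemma diagonal_tmap_\<psi>:
  assumes "klinear f" "\<And>t x. f (d t x) = c (t, x) *s d t x" "klinear g" "\<And>t x. g (d t x) = c' (t, x) *s d t x"
  shows "tmap \<psi> \<psi> (tmap f g T) $ (i, j) = c i * c' j * tmap \<psi> \<psi> T $ (i, j)"
proof -
  let ?D = "\<lambda>c v. \<chi> p. c p * v $ p"
  have "klinear (?D c)" for c :: "'g \<times> 'f \<Rightarrow> 'k" by (auto simp: klinear_iff vec_eq_iff algebra_simps)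
  then have "tmap \<psi> \<psi> (tmap f g T) = tmap (?D c) (?D c') (tmap \<psi> \<psi> T)"
    by (simp add: tmap_tmap \<psi> diagonal_\<psi>[where c = c, OF assms(1,2)] diagonal_\<psi>[where c = c', OF assms(3,4)])
  then show ?thesis by (simp add: tmap_diagonal)
qed

section \<open>Structure constants\<close>

definition "\<sigma> s x y = (SOME k. d s x \<cdot> d (s \<triangleleft> x) y = k *s d s (x + y))"

lemma d_mul: "d s x \<cdot> d t y = (if s \<triangleleft> x = t then \<sigma> s x y *s d s (x + y) else 0)"
proof (cases "s \<triangleleft> x = t")
  case True
  have "\<exists>k. d s x \<cdot> d t y = k *s d s (x + y)"
    by (rule d_span) (simp_all add: homogeneous_mul right_part_d mul_simps(1)[symmetric] e_d)
  then show ?thesis using True someI_ex[of "\<lambda>k. d s x \<cdot> d (s \<triangleleft> x) y = k *s d s (x + y)"] by (simp add: \<sigma>_def)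
next
  case False
  have "d s x \<cdot> d t y = (d s x \<cdot> e (s \<triangleleft> x)) \<cdot> (e t \<cdot> d t y)" by (simp add: d_e e_d)
  also have "\<dots> = d s x \<cdot> ((e (s \<triangleleft> x) \<cdot> e t) \<cdot> d t y)" by (simp only: mul_simps(1))
  finally show ?thesis using False by (simp add: e_mul mul_simps)
qed

text \<open>Because \<open>d s x\<close> has a left inverse up to an idempotent, multiplying by it from the left is injective on
  the pieces that it does not kill.\<close>

lemma \<sigma>_nonzero: "\<sigma> s x y \<noteq> 0"
proof
  assume 0: "\<sigma> s x y = 0"
  obtain c where "c \<cdot> d s x = e (s \<triangleleft> x)" using d_left_inverse by blast
  then have "c \<cdot> (d s x \<cdot> d (s \<triangleleft> x) y) = d (s \<triangleleft> x) y" by (simp add: mul_simps(1)[symmetric] e_d)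
  then show False using d_nonzero by (simp add: d_mul 0 mul_simps)
qed

definition "comult_coords s x = tmap \<psi> \<psi> (\<Delta> (d s x))"

lemma comult_d: "\<Delta> (d s x) = tmap \<phi> \<phi> (comult_coords s x)"
  unfolding comult_coords_def by (rule tmap_bij(2)[OF lin_\<phi> bij_\<phi>, symmetric])

text \<open>Since \<open>d s x = e s \<cdot> d s x\<close>, multiplying \<open>\<Delta>(d s x)\<close> by \<open>\<Delta>(e s) = \<Sum> e t \<otimes> e (- t + s)\<close> does not
  change it, which leaves only terms whose indices add up to \<open>s\<close>.\<close>

lemma comult_coords_mul:
  assumes "u \<noteq> - t + s"
  shows "comult_coords s x $ ((t, y), (u, z)) = 0"
proof -
  have "\<Delta> (d s x) = \<Delta> (e s \<cdot> d s x)" by (simp add: e_d)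
  also have "\<dots> = tmult (mul A) (mul A) (\<Delta> (e s)) (\<Delta> (d s x))"
    using hopf by (simp add: hopf_algebra_def bialgebra_def)
  also have "\<dots> = (\<Sum>r\<in>UNIV. tmap (mul A (e r)) (mul A (e (- r + s))) (\<Delta> (d s x)))"
    by (simp add: comult_e klinear_sum[OF klinear_tmult(2)] tmult_tensor_left bilin)
  finally have "comult_coords s x = (\<Sum>r\<in>UNIV. tmap \<psi> \<psi> (tmap (mul A (e r)) (mul A (e (- r + s))) (\<Delta> (d s x))))"
    unfolding comult_coords_def klinear_sum[OF klinear_tmap, symmetric] by (rule arg_cong)
  then have "comult_coords s x $ ((t, y), (u, z)) =
      (\<Sum>r\<in>UNIV. tmap \<psi> \<psi> (tmap (mul A (e r)) (mul A (e (- r + s))) (\<Delta> (d s x))) $ ((t, y), (u, z)))"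
    by (simp only: sum_component)
  also have "\<dots> = (\<Sum>r\<in>UNIV. (if t = r then 1 else 0) * (if u = - r + s then 1 else 0) * comult_coords s x $ ((t, y), (u, z)))"
  proof (rule sum.cong[OF refl])
    fix r
    show "tmap \<psi> \<psi> (tmap (mul A (e r)) (mul A (e (- r + s))) (\<Delta> (d s x))) $ ((t, y), (u, z)) =
      (if t = r then 1 else 0) * (if u = - r + s then 1 else 0) * comult_coords s x $ ((t, y), (u, z))"
      unfolding comult_coords_def
      using diagonal_tmap_\<psi>[of "mul A (e r)" "\<lambda>p. if fst p = r then 1 else 0" "mul A (e (- r + s))" "\<lambda>p. if fst p = - r + s then 1 else 0"
          "\<Delta> (d s x)" "(t, y)" "(u, z)"]
      by (auto simp: e_d lin_e)
  qed
  also have "\<dots> = 0" using assms by (intro sum.neutral) auto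
  finally show ?thesis .
qed

lemma left_part_d: "left_part y (d u x) = (if y = u \<triangleright> x then d u x else 0)"
  using left_part_homogeneous[of x "d u x" y u] by (simp add: right_part_d e_d)

text \<open>The second factors of \<open>\<Delta>(d s x)\<close> have right degree \<open>x\<close>, and the right degree of the first factor equals
  the left degree of the second. As the extension affords \<open>\<triangleright>\<close>, the left degree of \<open>d u x\<close> is \<open>u \<triangleright> x\<close>.\<close>

lemma comult_coords_degree:
  assumes "z \<noteq> x \<or> y \<noteq> u \<triangleright> x"
  shows "comult_coords s x $ ((t, y), (u, z)) = 0"
proof -
  have D: "\<Delta> (d s x) = tmap id (right_part x) (\<Delta> (d s x))" using comult_right_part[of x "d s x"] by (simp add: right_part_d)
  have "tmap (right_part y) id (\<Delta> (d s x)) = tmap id (left_part y) (tmap id (right_part x) (\<Delta> (d s x)))"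
    by (subst right_part_middle) (simp add: D[symmetric])
  also have "\<dots> = tmap id (\<lambda>a. left_part y (right_part x a)) (\<Delta> (d s x))" by (simp add: tmap_tmap lin_left_part id_def)
  finally have *: "tmap (right_part y) id (\<Delta> (d s x)) = tmap id (\<lambda>a. left_part y (right_part x a)) (\<Delta> (d s x))" .
  have "tmap \<psi> \<psi> (tmap (right_part y) id (\<Delta> (d s x))) $ ((t, y), (u, z)) = comult_coords s x $ ((t, y), (u, z))"
    unfolding comult_coords_def
    using diagonal_tmap_\<psi>[of "right_part y" "\<lambda>p. if y = snd p then 1 else 0" id "\<lambda>p. 1" "\<Delta> (d s x)" "(t, y)" "(u, z)"]
    by (simp add: lin_right_part right_part_d)
  moreover have "tmap \<psi> \<psi> (tmap id (\<lambda>a. left_part y (right_part x a)) (\<Delta> (d s x))) $ ((t, y), (u, z)) =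
      (if x = z \<and> y = u \<triangleright> x then 1 else 0) * comult_coords s x $ ((t, y), (u, z))"
    unfolding comult_coords_def
    using diagonal_tmap_\<psi>[of id "\<lambda>p. 1" "\<lambda>a. left_part y (right_part x a)" "\<lambda>p. if x = snd p \<and> y = fst p \<triangleright> x then 1 else 0" "\<Delta> (d s x)" "(t, y)" "(u, z)"]
    by (auto simp: klinear_comp[OF lin_left_part lin_right_part] right_part_d left_part_d klinear_zero[OF lin_left_part])
  ultimately show ?thesis unfolding * using assms by auto
qed

definition "\<tau> x t u = comult_coords (t + u) x $ ((t, u \<triangleright> x), (u, x))"

abbreviation "B \<equiv> bicrossed_product (\<triangleright>) (\<triangleleft>) \<sigma> \<tau>"

text \<open>By the two preceding lemmas, only the coordinates that define \<open>\<tau>\<close> can be different from zero.\<close>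

lemma comult_coords_eq: "comult_coords s x = comult B (axis (s, x) 1)"
proof -
  have "comult_coords s x $ ((t, y), (u, z)) = comult B (axis (s, x) 1) $ ((t, y), (u, z))" for t y u z
  proof (cases "z = x \<and> y = u \<triangleright> x \<and> s = t + u")
    case True then show ?thesis by (simp add: bic_comult \<tau>_def axis_def)
  next
    case False
    then have "u \<noteq> - t + s \<or> (z \<noteq> x \<or> y \<noteq> u \<triangleright> x)" by (auto simp: add.assoc[symmetric])
    then have "comult_coords s x $ ((t, y), (u, z)) = 0"
      using comult_coords_mul comult_coords_degree by blast
    then show ?thesis using False by (auto simp: bic_comult axis_def)
  qed
  then show ?thesis by (simp add: vec_eq_iff)
qed

lemmas lin_B = linear_bicrossed_product[of "(\<triangleright>)" "(\<triangleleft>)" \<sigma> \<tau>]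

lemma \<phi>_mul: "\<phi> (mul B v w) = \<phi> v \<cdot> \<phi> w"
proof -
  have l: "klinear (\<lambda>v. \<phi> (mul B v w))" "klinear (\<lambda>w. \<phi> (mul B v w))" "klinear (\<lambda>v. \<phi> v \<cdot> \<phi> w)" "klinear (\<lambda>w. \<phi> v \<cdot> \<phi> w)" for v w
    using lin_\<phi> lin_B(1) by (auto simp: klinear_iff kbilinear_def mul_simps)
  have "\<phi> (mul B (axis p 1) (axis q 1)) = \<phi> (axis p 1) \<cdot> \<phi> (axis q 1)" for p q
    using lin_\<phi> by (cases p; cases q) (auto simp: bic_mul_axis \<phi>_axis d_mul klinear_zero klinear_iff)
  then have "\<phi> (mul B v (axis q 1)) = \<phi> v \<cdot> \<phi> (axis q 1)" for v q
    by (rule klinear_eqI[OF l(1) l(3)])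
  then show ?thesis by (rule klinear_eqI[OF l(2) l(4)])
qed

lemma \<phi>_comult: "\<Delta> (\<phi> v) = tmap \<phi> \<phi> (comult B v)"
proof (rule klinear_eqI[of "\<lambda>v. \<Delta> (\<phi> v)"])
  show "\<Delta> (\<phi> (axis p 1)) = tmap \<phi> \<phi> (comult B (axis p 1))" for p
    by (cases p) (simp add: \<phi>_axis comult_d comult_coords_eq)
qed (intro klinear_comp[OF lin(1) lin_\<phi>] klinear_comp[OF klinear_tmap lin_B(2)])+

lemma \<phi>_counit: "\<epsilon> (\<phi> v) = counit B v"
proof -
  have "\<epsilon> (\<phi> v) = (\<Sum>s\<in>UNIV. \<Sum>x\<in>UNIV. v $ (s, x) * (if s = 0 then 1 else 0))"
    by (simp add: \<phi>_def klinear_form_sum[OF lin(2)] \<epsilon>_simps sum_UNIV_prod \<epsilon>_d)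
  also have "\<dots> = (\<Sum>x\<in>UNIV. v $ (0, x))"
    by (subst sum.swap, rule sum.cong[OF refl], subst sum_eq_single[of 0]) auto
  finally show ?thesis by (simp add: bicrossed_counit)
qed

lemma \<phi>_unity: "\<phi> (unity B) = unity A"
proof -
  have "\<phi> (unity B) = (\<Sum>s\<in>UNIV. \<phi> (axis (s, 0) 1))"
    by (simp add: bicrossed_product_def klinear_sum[OF lin_\<phi>])
  then show ?thesis by (simp add: \<phi>_axis d_0 sum_e)
qed

lemma bicrossed_iso: "B \<cong>\<^sub>H A"
  unfolding hopf_iso_def hopf_hom_def using lin_\<phi> \<phi>_mul \<phi>_comult \<phi>_counit \<phi>_unity bij_\<phi> by auto

lemma \<sigma>_cocycle: "\<sigma> s x y * \<sigma> s (x + y) z = \<sigma> (s \<triangleleft> x) y z * \<sigma> s x (y + z)"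
proof -
  let ?z = "d (s \<triangleleft> (x + y)) z"
  have "(d s x \<cdot> d (s \<triangleleft> x) y) \<cdot> ?z = d s x \<cdot> (d (s \<triangleleft> x) y \<cdot> ?z)" by (simp add: mul_simps)
  then have "(\<sigma> s x y * \<sigma> s (x + y) z) *s d s (x + y + z) = (\<sigma> (s \<triangleleft> x) y z * \<sigma> s x (y + z)) *s d s (x + y + z)"
    by (simp add: d_mul mul_simps ract_add[symmetric] add.assoc)
  then show ?thesis using d_nonzero vec.scale_cancel_right by blast
qed

lemma \<sigma>_norm: "\<sigma> s 0 x = 1" "\<sigma> s x 0 = 1" "\<sigma> 0 x y = 1"
proof -
  have "\<sigma> s 0 x *s d s x = 1 *s d s x" using d_mul[of s 0 s x] by (simp add: ract_zero d_0 e_d)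
  then show "\<sigma> s 0 x = 1" using d_nonzero vec.scale_cancel_right by blast
  have "\<sigma> s x 0 *s d s x = 1 *s d s x" using d_mul[of s x "s \<triangleleft> x" 0] by (simp add: d_0 d_e)
  then show "\<sigma> s x 0 = 1" using d_nonzero vec.scale_cancel_right by blast
  have "\<epsilon> (d 0 x \<cdot> d 0 y) = \<epsilon> (\<sigma> 0 x y *s d 0 (x + y))" by (simp add: d_mul zero_ract)
  then show "\<sigma> 0 x y = 1" by (simp add: \<epsilon>_simps \<epsilon>_d)
qed

text \<open>The axioms of \<open>A\<close> are transported to the bicrossed product along \<open>\<phi>\<close>. Read off at one coordinate
  of a basis vector, each of them is one of the cocycle conditions.\<close>

lemma B_coassoc: "tassoc (tmap (comult B) id (comult B v)) = tmap id (comult B) (comult B v)"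
proof -
  let ?F = "tmap \<phi> (tmap \<phi> \<phi>)" and ?G = "tmap \<psi> (tmap \<psi> \<psi>)"
  have GF: "?G (?F T) = T" for T
    by (simp add: tmap_tmap klinear_tmap \<psi> lin_\<phi> tmap_id)
  have left: "tmap (tmap \<phi> \<phi>) \<phi> (tmap (comult B) id X) = tmap \<Delta> id (tmap \<phi> \<phi> X)" for X
  proof -
    have "tmap (tmap \<phi> \<phi>) \<phi> (tmap (comult B) id X) = tmap (\<lambda>v. \<Delta> (\<phi> v)) \<phi> X"
      by (simp add: tmap_tmap klinear_tmap lin_\<phi> \<phi>_comult)
    then show ?thesis by (simp add: tmap_tmap lin)
  qed
  have right: "?F (tmap id (comult B) X) = tmap id \<Delta> (tmap \<phi> \<phi> X)" for X
  proof -
    have "?F (tmap id (comult B) X) = tmap \<phi> (\<lambda>v. \<Delta> (\<phi> v)) X"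
      by (simp add: tmap_tmap klinear_tmap lin_\<phi> \<phi>_comult)
    then show ?thesis by (simp add: tmap_tmap lin)
  qed
  have "?F (tassoc (tmap (comult B) id (comult B v))) = tassoc (tmap (tmap \<phi> \<phi>) \<phi> (tmap (comult B) id (comult B v)))"
    by (simp add: tassoc_tmap lin_\<phi>)
  also have "\<dots> = tassoc (tmap \<Delta> id (tmap \<phi> \<phi> (comult B v)))"
    by (simp only: left)
  also have "\<dots> = tmap id \<Delta> (tmap \<phi> \<phi> (comult B v))"
    using coalg by (simp add: coalgebra_ax_def \<phi>_comult[symmetric])
  also have "\<dots> = ?F (tmap id (comult B) (comult B v))"
    by (simp only: right)
  finally have "?G (?F (tassoc (tmap (comult B) id (comult B v)))) = ?G (?F (tmap id (comult B) (comult B v)))"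
    by (rule arg_cong)
  then show ?thesis by (simp only: GF)
qed

lemma B_comult_mul: "comult B (mul B v w) = tmult (mul B) (mul B) (comult B v) (comult B w)"
proof -
  have "tmap \<phi> \<phi> (comult B (mul B v w)) = \<Delta> (\<phi> v \<cdot> \<phi> w)" by (simp add: \<phi>_comult[symmetric] \<phi>_mul)
  also have "\<dots> = tmult (mul A) (mul A) (\<Delta> (\<phi> v)) (\<Delta> (\<phi> w))"
    using hopf by (simp add: hopf_algebra_def bialgebra_def)
  also have "\<dots> = tmap \<phi> \<phi> (tmult (mul B) (mul B) (comult B v) (comult B w))"
    unfolding \<phi>_comult by (rule tmap_tmult[symmetric]) (simp_all add: lin_B bilin lin_\<phi> \<phi>_mul)
  finally have "tmap \<psi> \<psi> (tmap \<phi> \<phi> (comult B (mul B v w))) =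
      tmap \<psi> \<psi> (tmap \<phi> \<phi> (tmult (mul B) (mul B) (comult B v) (comult B w)))"
    by (rule arg_cong)
  then show ?thesis by (simp only: tmap_bij(1)[OF lin_\<phi> bij_\<phi>])
qed

lemma \<tau>_cocycle: "\<tau> x (s + t) u * \<tau> (u \<triangleright> x) s t = \<tau> x s (t + u) * \<tau> x t u"
proof -
  let ?v = "axis (s + t + u, x) (1 :: 'k)" and ?i = "((s, (t + u) \<triangleright> x), ((t, u \<triangleright> x), (u, x)))"
  have "tassoc (tmap (comult B) id (comult B ?v)) $ ?i = tmap id (comult B) (comult B ?v) $ ?i"
    by (simp add: B_coassoc)
  then show ?thesis
    by (simp add: tassoc_def tmap_slice_left tmap_slice_right lin_B bic_comult lact_add axis_def add.assoc mult.commute)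
qed

lemma \<sigma>_\<tau>_compatible: "\<sigma> (t + u) x y * \<tau> (x + y) t u =
    \<tau> x t u * \<tau> y (t \<triangleleft> (u \<triangleright> x)) (u \<triangleleft> x) * (\<sigma> t (u \<triangleright> x) ((u \<triangleleft> x) \<triangleright> y) * \<sigma> u x y)"
proof -
  let ?v = "axis (t + u, x) (1 :: 'k)" and ?w = "axis ((t + u) \<triangleleft> x, y) (1 :: 'k)"
  let ?i = "((t, u \<triangleright> (x + y)), (u, x + y))"
  have "comult B (mul B ?v ?w) $ ?i = \<sigma> (t + u) x y * \<tau> (x + y) t u"
    by (simp add: bic_mul_axis bic_comult mult.commute)
  moreover have "tmult (mul B) (mul B) (comult B ?v) (comult B ?w) $ ?i =
      \<tau> x t u * \<tau> y (t \<triangleleft> (u \<triangleright> x)) (u \<triangleleft> x) * (\<sigma> t (u \<triangleright> x) ((u \<triangleleft> x) \<triangleright> y) * \<sigma> u x y)"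
    unfolding bic_tmult
    by (subst sum_eq_single[of "u \<triangleright> x"], (auto simp: bic_comult axis_def intro!: sum.neutral)[],
        subst sum_eq_single[of x], (auto simp: bic_comult axis_def)[])
      (simp add: bic_comult axis_def lact_mult ract_mult add.assoc[symmetric])
  ultimately show ?thesis by (simp add: B_comult_mul)
qed

lemma B_counit: "contract_left (counit B) (comult B v) = v" "contract_right (counit B) (comult B v) = v"
proof -
  have "\<phi> (contract_left (counit B) (comult B v)) = contract_left \<epsilon> (\<Delta> (\<phi> v))"
    by (simp add: \<phi>_comult contract_left_tmap lin lin_\<phi> \<phi>_counit)
  also have "\<dots> = \<phi> v" using coalg by (simp add: coalgebra_ax_def contract_left_def)
  finally show "contract_left (counit B) (comult B v) = v" by (metis \<psi>(1))
  have "\<phi> (contract_right (counit B) (comult B v)) = contract_right \<epsilon> (\<Delta> (\<phi> v))"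
    by (simp add: \<phi>_comult contract_right_tmap lin lin_\<phi> \<phi>_counit)
  also have "\<dots> = \<phi> v" using coalg by (simp add: coalgebra_ax_def contract_right_def)
  finally show "contract_right (counit B) (comult B v) = v" by (metis \<psi>(1))
qed

lemma \<tau>_norm: "\<tau> x 0 t = 1" "\<tau> x t 0 = 1" "\<tau> 0 t u = 1"
proof -
  have "contract_left (counit B) (comult B (axis (t, x) 1)) $ (t, x) = 1" by (simp add: B_counit axis_def)
  then show "\<tau> x 0 t = 1" by (simp add: contract_nth lin_B bicrossed_counit bic_comult axis_def)
  have "contract_right (counit B) (comult B (axis (t, x) 1)) $ (t, x) = 1" by (simp add: B_counit axis_def)
  then have "(\<Sum>z\<in>UNIV. if z = x then \<tau> x t 0 else 0) = 1"
    by (simp add: contract_nth lin_B bicrossed_counit bic_comult axis_def lact_zero if_distrib cong: if_cong)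
  then show "\<tau> x t 0 = 1" by simp
  have "comult_coords (t + u) 0 = (\<Sum>r\<in>UNIV. axis (r, 0) 1 \<otimes>\<^sub>k axis (- r + (t + u), 0) 1)"
    by (simp add: comult_coords_def d_0 comult_e klinear_sum[OF klinear_tmap] tmap_tensor \<psi>)
      (simp add: d_0[symmetric] \<phi>_axis[symmetric] \<psi>)
  then have "\<tau> 0 t u = (\<Sum>r\<in>UNIV. (axis (r, 0) 1 \<otimes>\<^sub>k axis (- r + (t + u), 0) 1) $ ((t, 0 :: 'f), (u, 0 :: 'f)))"
    by (simp add: \<tau>_def zero_lact)
  also have "\<dots> = 1" by (subst sum_eq_single[of t]) (auto simp: axis_def add.assoc[symmetric])
  finally show "\<tau> 0 t u = 1" .
qed

text \<open>Multiplied from the right by the idempotent \<open>e (t \<triangleleft> x)\<close>, the antipode identity for \<open>d 0 x\<close> has on its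
  left-hand side only the summand with coefficient \<open>\<tau> x (- t) t\<close>, but its right-hand side is not zero.\<close>

lemma \<tau>_inverse_nonzero: "\<tau> x (- t) t \<noteq> 0"
proof
  assume 0: "\<tau> x (- t) t = 0"
  obtain S where S: "klinear S" "tlift (\<lambda>v w. S v \<cdot> w) (\<Delta> (d 0 x)) = \<epsilon> (d 0 x) *s unity A"
    using hopf by (auto simp: hopf_algebra_def antipode_def)
  have "klinear (\<lambda>a. a \<cdot> e (t \<triangleleft> x))" using bilin by (simp add: kbilinear_def)
  then have "tlift (\<lambda>v w. (S v \<cdot> w) \<cdot> e (t \<triangleleft> x)) (\<Delta> (d 0 x)) = unity A \<cdot> e (t \<triangleleft> x)"
    by (subst klinear_of_tlift[of "\<lambda>a. a \<cdot> e (t \<triangleleft> x)", symmetric]) (simp_all add: S(2) \<epsilon>_d)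
  moreover have "kbilinear (\<lambda>v w. (S v \<cdot> w) \<cdot> e (t \<triangleleft> x))"
    using S(1) by (auto simp: kbilinear_def klinear_iff mul_simps)
  ultimately have "e (t \<triangleleft> x) = tlift (\<lambda>v w. (S (\<phi> v) \<cdot> \<phi> w) \<cdot> e (t \<triangleleft> x)) (comult_coords 0 x)"
    by (simp add: comult_d tlift_tmap mul_simps)
  also have "\<dots> = 0"
  proof -
    have zero: "comult_coords 0 x $ ((r, y), (u, z)) *s ((S (\<phi> (axis (r, y) 1)) \<cdot> \<phi> (axis (u, z) 1)) \<cdot> e (t \<triangleleft> x)) = 0"
      for r y u z
    proof (cases "comult_coords 0 x $ ((r, y), (u, z)) = 0")
      case False
      then have "z = x" "y = u \<triangleright> x" "u = - r"
        using comult_coords_mul[of u r 0 x y z] comult_coords_degree[of z x y u 0 r] by auto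
      then have "u \<noteq> t" using False 0 by (auto simp: \<tau>_def)
      then have "t \<triangleleft> x \<noteq> u \<triangleleft> x" by (simp add: ract_eq_iff)
      then show ?thesis by (simp add: \<phi>_axis mul_simps d_e \<open>z = x\<close>)
    qed simp
    show ?thesis unfolding tlift_def sum_UNIV_prod fst_conv snd_conv zero by simp
  qed
  finally show False using e_nonzero by blast
qed

text \<open>The cocycle identity for \<open>t, u, - u\<close> expresses a product with factor \<open>\<tau> x t u\<close> by values at inverse
  elements.\<close>

lemma \<tau>_nonzero: "\<tau> x t u \<noteq> 0"
proof -
  have "(- u) \<triangleright> (u \<triangleright> x) = x" by (simp add: lact_add[symmetric] lact_zero)
  then have "\<tau> (u \<triangleright> x) (t + u) (- u) * \<tau> x t u = \<tau> (u \<triangleright> x) t 0 * \<tau> (u \<triangleright> x) u (- u)"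
    using \<tau>_cocycle[of "u \<triangleright> x" t u "- u"] by simp
  then show ?thesis using \<tau>_inverse_nonzero[of "u \<triangleright> x" "- u"] by (auto simp: \<tau>_norm)
qed

lemma ex_bicrossed_product: "\<exists>\<sigma> \<tau>. kac_cocycle \<sigma> \<tau> \<and> bicrossed_product (\<triangleright>) (\<triangleleft>) \<sigma> \<tau> \<cong>\<^sub>H A"
proof -
  have "kac_cocycle \<sigma> \<tau>" unfolding kac_cocycle_def
    using \<sigma>_nonzero \<tau>_nonzero \<sigma>_norm \<tau>_norm \<sigma>_cocycle \<tau>_cocycle \<sigma>_\<tau>_compatible by blast
  then show ?thesis using bicrossed_iso by blast
qed

end

section \<open>Extensions of groups of coprime orders\<close>

theorem proposition5p22:
  fixes lact :: "'g::{group_add,finite} \<Rightarrow> 'f::{group_add,finite} \<Rightarrow> 'f"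
    and ract :: "'g \<Rightarrow> 'f \<Rightarrow> 'g"
    and A :: "('k::{alg_closed_field,field_char_0}, 'a::finite) hopf"
    and \<iota> :: "('k, 'g) vec \<Rightarrow> 'k ^ 'a"
    and \<pi> :: "'k ^ 'a \<Rightarrow> ('k, 'f) vec"
  assumes "matched_pair lact ract"
    and "coprime CARD('f) CARD('g)"
    and "hopf_algebra A"
    and "exact_sequence function_algebra \<iota> A \<pi> group_algebra"
    and "affords lact ract \<iota> A \<pi>"
  shows "obtained_by_twisting A (split_extension lact ract)"
proof -
  interpret matched_pair_extension lact ract A \<iota> \<pi>
    using assms by (simp add: matched_pair_extension_def matched_pair_extension_axioms_def)
  obtain \<sigma> \<tau> where K: "kac_cocycle \<sigma> \<tau>" and iso: "bicrossed_product lact ract \<sigma> \<tau> \<cong>\<^sub>H A"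
    using ex_bicrossed_product by blast
  obtain \<alpha> \<beta> c where "edge_image \<alpha> \<beta> c \<sigma> \<tau>" using kac_cocycle_edge_image[OF K assms(2)] by blast
  then show ?thesis using iso by (rule bicrossed_product_obtained_by_twisting)
qed

end
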